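(* Let $\mathcal{Z}$ be a well-behaved percolation on $\mathbb{H}^2$ and let $\alpha\ge 0$ be its decay exponent. If $\alpha\ge 1$, then almost surely there are no half-lines contained in $\mathcal{Z}$.
   Context: A half-line is an infinite geodesic ray in the hyperbolic plane $\mathbb{H}^2$. Fix a closed disk $B\subset\mathbb{H}^2$ of radius $1$. A well-behaved percolation on $\mathbb{H}^2$ is a random closed subset $\mathcal{Z}\subset\mathbb{H}^2$ satisfying: (1) The law of $\mathcal{Z}$ is invariant under isometries of $\mathbb{H}^2$. (2) $\mathcal{Z}$ satisfies positive correlations: for every pair $g,h$ of bounded increasing measurable functions of $\mathcal{Z}$, $\mathbf{E}[g(\mathcal{Z})h(\mathcal{Z})]\ge\mathbf{E}[g(\mathcal{Z})]\,\mathbf{E}[h(\mathcal{Z})]$. (3) There is some $R_0<\infty$ such that $\mathcal{Z}$ satisfies independence at distance $R_0$: for every pair of subsets $A,A'\subset\mathbb{H}^2$ with $\inf\{d(a,a'):a\in A,a'\in A'\}\ge R_0$, the intersections $\mathcal{Z}\cap A$ and $\mathcal{Z}\cap A'$ are independent. (4) The expected number $m$ of connected components of $B\setminus\mathcal{Z}$ is finite. (5) The expected length $\ell$ of $B\cap\partial\mathcal{Z}$ is finite. (6) $p_0:=\mathbf{P}[B\subset\mathcal{Z}]>0$. Let $f(r)$ be the probability that a fixed geodesic line segment of length $r$ in $\mathbb{H}^2$ is contained in $\mathcal{Z}$. For a well-behaved $\mathcal{Z}$ there is a unique $\alpha\ge 0$ (depending on the law of $\mathcal{Z}$) for which there is a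 constant $c>0$ with $c\,e^{-\alpha r}\le f(r)\le e^{-\alpha r}$ for all $r\ge 0$; this $\alpha$ is the decay exponent of $\mathcal{Z}$. *)

theory Defs
  imports "HOL-Probability.Probability"
begin

section \<open>The hyperbolic plane\<close>

text \<open>
  Poincare disk model, with the metric of curvature \<open>-1\<close>, that is, the length metric of
  \<open>4 |dz|^2 / (1 - |z|^2)^2\<close>. The normalisation of the curvature matters, since the critical
  value \<open>1\<close> of the decay exponent depends on it.
\<close>

typedef hyperbolic_plane = "ball (0::complex) 1"
  morphisms coord Point
  by (rule exI[of _ 0]) simp

lemma coord_less_1: "cmod (coord x) < 1"
  using coord[of x] by simp

definition disk_ratio :: "complex \<Rightarrow> complex \<Rightarrow> real" where
  "disk_ratio z w = cmod (z - w) / cmod (1 - cnj w * z)"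

lemma disk_denom_nonzero:
  assumes "cmod z < 1" "cmod w < 1"
  shows "1 - cnj w * z \<noteq> 0"
proof
  assume "1 - cnj w * z = 0"
  then have "cmod (cnj w * z) = 1" by (metis eq_iff_diff_eq_0 norm_one)
  moreover have "cmod w * cmod z < 1 * 1"
    using assms by (intro mult_strict_mono) auto
  ultimately show False by (simp add: norm_mult)
qed

lemma disk_ratio_commute: "disk_ratio z w = disk_ratio w z"
proof -
  have "cmod (1 - cnj w * z) = cmod (cnj (1 - cnj w * z))"
    by (simp only: complex_mod_cnj)
  then show ?thesis
    by (simp add: disk_ratio_def norm_minus_commute mult.commute)
qed

lemma disk_ratio_identity:
  assumes "cmod z < 1" "cmod w < 1"
  shows "1 - (disk_ratio z w)\<^sup>2 = (1 - (cmod z)\<^sup>2) * (1 - (cmod w)\<^sup>2) / (cmod (1 - cnj w * z))\<^sup>2"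
proof -
  have "(cmod (1 - cnj w * z))\<^sup>2 - (cmod (z - w))\<^sup>2 = (1 - (cmod z)\<^sup>2) * (1 - (cmod w)\<^sup>2)"
    unfolding cmod_power2 by (simp add: power2_eq_square algebra_simps)
  moreover have "cmod (1 - cnj w * z) \<noteq> 0"
    using disk_denom_nonzero[OF assms] by simp
  ultimately show ?thesis
    unfolding disk_ratio_def power_divide by (simp add: field_simps)
qed

lemma disk_ratio_less_1:
  assumes "cmod z < 1" "cmod w < 1"
  shows "disk_ratio z w < 1"
proof -
  have "0 < (1 - (cmod z)\<^sup>2) * (1 - (cmod w)\<^sup>2) / (cmod (1 - cnj w * z))\<^sup>2"
    using assms disk_denom_nonzero[OF assms]
    by (intro divide_pos_pos mult_pos_pos) (auto simp: abs_square_less_1)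
  then have "(disk_ratio z w)\<^sup>2 < 1"
    using disk_ratio_identity[OF assms] by simp
  then show ?thesis
    by (simp add: abs_square_less_1)
qed

lemma disk_ratio_nonneg: "0 \<le> disk_ratio z w"
  by (simp add: disk_ratio_def)

lemma disk_ratio_triangle:
  assumes x: "cmod x < 1" and y: "cmod y < 1" and z: "cmod z < 1"
  defines "a \<equiv> disk_ratio x y" and "c \<equiv> disk_ratio y z"
  shows "disk_ratio x z \<le> (a + c) / (1 + a * c)"
proof -
  define a' where "a' = (x - y) / (1 - cnj y * x)"
  define c' where "c' = (z - y) / (1 - cnj y * z)"
  have a'a: "cmod a' = a" by (simp add: a'_def a_def disk_ratio_def norm_divide)
  have c'c: "cmod c' = c"
    unfolding c_def disk_ratio_commute[of y] by (simp add: c'_def disk_ratio_def norm_divide)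
  have nz: "1 - cnj y * x \<noteq> 0" "1 - cnj y * z \<noteq> 0" "1 - cnj z * y \<noteq> 0" "1 - cnj z * x \<noteq> 0"
    using disk_denom_nonzero x y z by blast+
  have eq: "1 - cnj c' * a' = (1 - cnj y * y) * (1 - cnj z * x) / ((1 - cnj y * x) * (1 - cnj z * y))"
  proof -
    have nz': "1 - y * cnj z \<noteq> 0" using nz(3) by (simp add: mult.commute)
    have cc: "cnj c' = (cnj z - cnj y) / (1 - y * cnj z)" by (simp add: c'_def)
    show ?thesis
      unfolding cc a'_def using nz nz' by (simp add: divide_simps) (simp add: algebra_simps)
  qed
  have a1: "0 \<le> a" "a < 1" "0 \<le> c" "c < 1"
    unfolding a_def c_def using disk_ratio_nonneg disk_ratio_less_1 x y z by auto
  have yy: "1 - cnj y * y = of_real (1 - (cmod y)\<^sup>2)"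
    by (simp add: complex_norm_square mult.commute del: of_real_power)
  have ypos: "0 < 1 - (cmod y)\<^sup>2" using y by (simp add: abs_square_less_1)
  define A B C where "A = cmod (1 - cnj y * x)" and "B = cmod (1 - cnj z * y)"
    and "C = cmod (1 - cnj z * x)"
  have pos: "0 < A" "0 < B" "0 < C" using nz by (auto simp: A_def B_def C_def)
  have N: "cmod (1 - cnj c' * a') = (1 - (cmod y)\<^sup>2) * C / (A * B)"
    unfolding eq norm_divide norm_mult yy A_def B_def C_def norm_of_real using ypos by simp
  have N_pos: "0 < cmod (1 - cnj c' * a')"
    unfolding N using pos ypos by simp
  have N_le: "cmod (1 - cnj c' * a') \<le> 1 + a * c"
    using norm_triangle_ineq4[of 1 "cnj c' * a'"] by (simp add: norm_mult a'a c'c mult.commute)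
  have "1 - (disk_ratio x z)\<^sup>2 = (1 - (cmod x)\<^sup>2) * (1 - (cmod z)\<^sup>2) / C\<^sup>2"
    using disk_ratio_identity[OF x z] by (simp add: C_def)
  also have "\<dots> = (1 - a\<^sup>2) * (1 - c\<^sup>2) / (cmod (1 - cnj c' * a'))\<^sup>2"
    unfolding N a_def c_def disk_ratio_identity[OF x y] disk_ratio_identity[OF y z]
      A_def[symmetric] B_def[symmetric]
    using pos ypos by (simp add: power2_eq_square divide_simps)
  also have "\<dots> \<ge> (1 - a\<^sup>2) * (1 - c\<^sup>2) / (1 + a * c)\<^sup>2"
  proof (rule divide_left_mono)
    show "(cmod (1 - cnj c' * a'))\<^sup>2 \<le> (1 + a * c)\<^sup>2"
      using N_le by (intro power_mono) auto
    show "0 \<le> (1 - a\<^sup>2) * (1 - c\<^sup>2)"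
      using a1 by (intro mult_nonneg_nonneg) (auto simp: abs_square_le_1)
    show "0 < (1 + a * c)\<^sup>2 * (cmod (1 - cnj c' * a'))\<^sup>2"
      using N_pos a1 by (intro mult_pos_pos zero_less_power) (auto intro: add_pos_nonneg)
  qed
  finally have *: "(1 - a\<^sup>2) * (1 - c\<^sup>2) / (1 + a * c)\<^sup>2 \<le> 1 - (disk_ratio x z)\<^sup>2" .
  have ac: "0 < 1 + a * c" using a1 by (intro add_pos_nonneg) auto
  have "1 - ((a + c) / (1 + a * c))\<^sup>2 = (1 - a\<^sup>2) * (1 - c\<^sup>2) / (1 + a * c)\<^sup>2"
    using ac by (simp add: power_divide divide_simps) (simp add: power2_eq_square algebra_simps)
  with * have "(disk_ratio x z)\<^sup>2 \<le> ((a + c) / (1 + a * c))\<^sup>2" by simp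
  then show ?thesis
    by (rule power2_le_imp_le) (use a1 ac in auto)
qed

lemma artanh_mono_real:
  assumes "0 \<le> s" "s \<le> t" "t < (1::real)"
  shows "artanh s \<le> artanh t"
proof -
  have "(1 + s) / (1 - s) \<le> (1 + t) / (1 - t)"
    using assms by (intro frac_le) auto
  then show ?thesis
    unfolding artanh_def using assms by (simp add: divide_pos_pos)
qed

lemma artanh_add_real:
  assumes "0 \<le> s" "s < 1" "0 \<le> t" "t < (1::real)"
  shows "artanh ((s + t) / (1 + s * t)) = artanh s + artanh t"
proof -
  have st: "0 < 1 + s * t" using assms by (intro add_pos_nonneg) auto
  have "(1 + (s + t) / (1 + s * t)) / (1 - (s + t) / (1 + s * t)) =
        (1 + s * t + (s + t)) / (1 + s * t - (s + t))"
  proof -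
    have "1 + (s + t) / (1 + s * t) = (1 + s * t + (s + t)) / (1 + s * t)"
      "1 - (s + t) / (1 + s * t) = (1 + s * t - (s + t)) / (1 + s * t)"
      using st by (simp_all add: add_divide_distrib diff_divide_distrib)
    then show ?thesis using st by simp
  qed
  also have "\<dots> = ((1 + s) * (1 + t)) / ((1 - s) * (1 - t))"
    by (simp add: algebra_simps)
  also have "\<dots> = ((1 + s) / (1 - s)) * ((1 + t) / (1 - t))"
    by simp
  finally have *: "(1 + (s + t) / (1 + s * t)) / (1 - (s + t) / (1 + s * t)) =
    ((1 + s) / (1 - s)) * ((1 + t) / (1 - t))" .
  have "ln (((1 + s) / (1 - s)) * ((1 + t) / (1 - t))) = ln ((1 + s) / (1 - s)) + ln ((1 + t) / (1 - t))"
    using assms by (intro ln_mult_pos) auto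
  then show ?thesis
    unfolding artanh_def * by (simp add: add_divide_distrib)
qed

instantiation hyperbolic_plane :: metric_space
begin

definition dist_hyperbolic_plane_def:
  "dist x y = 2 * artanh (cmod (coord x - coord y) / cmod (1 - cnj (coord y) * coord x))"

definition uniformity_hyperbolic_plane_def:
  "(uniformity :: (hyperbolic_plane \<times> hyperbolic_plane) filter) =
     (INF e\<in>{0<..}. principal {(x, y). dist x y < e})"

definition open_hyperbolic_plane_def:
  "open (U :: hyperbolic_plane set) \<longleftrightarrow>
     (\<forall>x\<in>U. eventually (\<lambda>(x', y). x' = x \<longrightarrow> y \<in> U) uniformity)"

instance
proof
  fix x y z :: hyperbolic_plane
  have d: "dist x y = 2 * artanh (disk_ratio (coord x) (coord y))" for x y :: hyperbolic_plane
    by (simp add: dist_hyperbolic_plane_def disk_ratio_def)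
  note less = disk_ratio_less_1[OF coord_less_1 coord_less_1]
  show "dist x y = 0 \<longleftrightarrow> x = y"
  proof
    let ?r = "disk_ratio (coord x) (coord y)"
    assume "dist x y = 0"
    then have "ln ((1 + ?r) / (1 - ?r)) = 0"
      by (simp add: d artanh_def)
    then have "(1 + ?r) / (1 - ?r) = 1"
      using less[of x y] disk_ratio_nonneg[of "coord x" "coord y"]
      by (subst (asm) ln_eq_zero_iff) auto
    then have "?r = 0" using less[of x y] by (simp add: field_simps)
    then have "coord x = coord y"
      using disk_denom_nonzero[OF coord_less_1[of x] coord_less_1[of y]]
      by (simp add: disk_ratio_def)
    then show "x = y" by (simp add: coord_inject)
  next
    assume "x = y"
    then show "dist x y = 0" by (simp add: d disk_ratio_def)
  qed
  show "dist x y \<le> dist x z + dist y z"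
  proof -
    let ?a = "disk_ratio (coord x) (coord z)" and ?c = "disk_ratio (coord z) (coord y)"
    have ac: "0 \<le> ?a" "?a < 1" "0 \<le> ?c" "?c < 1"
      using less disk_ratio_nonneg by auto
    then have pos: "0 < 1 + ?a * ?c" by (intro add_pos_nonneg) auto
    have "0 < (1 - ?a) * (1 - ?c)" using ac by simp
    then have "(?a + ?c) / (1 + ?a * ?c) < 1"
      using pos by (simp add: field_simps)
    then have "artanh (disk_ratio (coord x) (coord y)) \<le> artanh ((?a + ?c) / (1 + ?a * ?c))"
      by (intro artanh_mono_real disk_ratio_nonneg disk_ratio_triangle coord_less_1)
    also have "\<dots> = artanh ?a + artanh ?c"
      using ac by (rule artanh_add_real)
    finally show ?thesis
      unfolding d by (simp add: disk_ratio_commute[of "coord y"])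
  qed
qed (simp_all add: uniformity_hyperbolic_plane_def open_hyperbolic_plane_def)

end

definition isometry :: "(hyperbolic_plane \<Rightarrow> hyperbolic_plane) \<Rightarrow> bool" where
  "isometry \<phi> \<longleftrightarrow> surj \<phi> \<and> (\<forall>x y. dist (\<phi> x) (\<phi> y) = dist x y)"

definition geodesic_segment :: "real \<Rightarrow> hyperbolic_plane set \<Rightarrow> bool" where
  "geodesic_segment r S \<longleftrightarrow>
     (\<exists>\<gamma>. (\<forall>s\<in>{0..r}. \<forall>t\<in>{0..r}. dist (\<gamma> s) (\<gamma> t) = \<bar>s - t\<bar>) \<and> S = \<gamma> ` {0..r})"

definition half_line :: "hyperbolic_plane set \<Rightarrow> bool" where
  "half_line L \<longleftrightarrow>
     (\<exists>\<gamma>. (\<forall>s\<in>{0..}. \<forall>t\<in>{0..}. dist (\<gamma> s) (\<gamma> t) = \<bar>s - t\<bar>) \<and> L = \<gamma> ` {0::real..})"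

definition base_segment :: "real \<Rightarrow> hyperbolic_plane set" where
  "base_segment r = (\<lambda>t. Point (complex_of_real (tanh (t / 2)))) ` {0..r}"

lemma geodesic_segment_base_segment: "geodesic_segment r (base_segment r)"
proof -
  let ?g = "\<lambda>t. Point (complex_of_real (tanh (t / 2)))"
  have "dist (?g s) (?g t) = \<bar>s - t\<bar>" for s t :: real
  proof -
    have c: "coord (?g u) = complex_of_real (tanh (u / 2))" for u
      by (rule Point_inverse) (use tanh_real_bounds[of "u / 2"] in \<open>auto simp: abs_less_iff\<close>)
    let ?s = "tanh (s / 2)" and ?t = "tanh (t / 2)"
    have nz: "cosh (s / 2) \<noteq> 0" "cosh (- (t / 2)) \<noteq> 0" by simp_all
    have "tanh ((s - t) / 2) = (?s - ?t) / (1 - ?t * ?s)"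
      using tanh_add[OF nz] by (simp add: diff_divide_distrib mult.commute)
    then have "\<bar>?s - ?t\<bar> / \<bar>1 - ?t * ?s\<bar> = \<bar>tanh ((s - t) / 2)\<bar>"
      by (simp add: abs_divide)
    also have "\<dots> = tanh (\<bar>s - t\<bar> / 2)"
      by (simp add: tanh_real_abs[symmetric] abs_divide)
    finally have "\<bar>?s - ?t\<bar> / \<bar>1 - ?t * ?s\<bar> = tanh (\<bar>s - t\<bar> / 2)" .
    moreover have "cmod (1 - cnj (complex_of_real ?t) * complex_of_real ?s) = \<bar>1 - ?t * ?s\<bar>"
      by (metis complex_cnj_complex_of_real norm_of_real of_real_1 of_real_diff of_real_mult)
    moreover have "cmod (complex_of_real ?s - complex_of_real ?t) = \<bar>?s - ?t\<bar>"
      by (metis norm_of_real of_real_diff)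
    ultimately show ?thesis
      unfolding dist_hyperbolic_plane_def c by (simp only: artanh_tanh_real) simp
  qed
  then show ?thesis
    unfolding geodesic_segment_def base_segment_def by (intro exI[of _ ?g]) simp
qed


section \<open>Length\<close>

text \<open>The length of an arbitrary subset is its one-dimensional Hausdorff measure.\<close>

definition length_at_scale :: "real \<Rightarrow> 'a::metric_space set \<Rightarrow> ennreal" where
  "length_at_scale \<delta> S =
     (INF U\<in>{U :: nat \<Rightarrow> 'a set. S \<subseteq> (\<Union>i. U i) \<and> (\<forall>i. bounded (U i) \<and> diameter (U i) \<le> \<delta>)}.
        \<Sum>i. ennreal (diameter (U i)))"

definition hausdorff_length :: "'a::metric_space set \<Rightarrow> ennreal" where
  "hausdorff_length S = (SUP \<delta>\<in>{0<..}. length_at_scale \<delta> S)"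


section \<open>Random closed sets\<close>

text \<open>
  The relatively closed subsets of \<open>A\<close>, with the \<open>\<sigma>\<close>-algebra generated by the events that a
  compact subset of \<open>A\<close> is hit. For \<open>A = UNIV\<close> this is the usual Borel (Fell, Effros)
  \<open>\<sigma>\<close>-algebra on the space of closed sets.
\<close>

definition closed_sets_in :: "'a::topological_space set \<Rightarrow> 'a set measure" where
  "closed_sets_in A = sigma {C. closedin (top_of_set A) C}
     {{C. closedin (top_of_set A) C \<and> C \<inter> K \<noteq> {}} |K. compact K \<and> K \<subseteq> A}"

abbreviation closed_sets :: "'a::topological_space set measure" where
  "closed_sets \<equiv> closed_sets_in UNIV"


section \<open>Well-behaved percolation\<close>

text \<open>
  \<open>b\<close> is the centre of the fixed disk \<open>B\<close>. The number of components is counted in \<open>ennreal\<close>,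
  so that it may be infinite. The two measurability clauses say that the number of components
  and the boundary length are random variables, as is implicit in speaking of their
  expectations (the nonnegative integral alone would be a lower integral).
\<close>

locale well_behaved_percolation = prob_space M
  for M :: "'w measure" and Z :: "'w \<Rightarrow> hyperbolic_plane set" and b :: hyperbolic_plane +
  assumes random_closed_set: "Z \<in> measurable M closed_sets"
  and invariance: "isometry \<phi> \<Longrightarrow> distr M closed_sets (\<lambda>\<omega>. \<phi> ` Z \<omega>) = distr M closed_sets Z"
  and positive_correlations:
    "\<lbrakk>g \<in> borel_measurable closed_sets; h \<in> borel_measurable closed_sets;
      bounded (g ` {C. closed C}); bounded (h ` {C. closed C});
      mono_on {C. closed C} g; mono_on {C. closed C} h\<rbrakk>
      \<Longrightarrow> expectation (\<lambda>\<omega>. g (Z \<omega>) * h (Z \<omega>))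
          \<ge> expectation (\<lambda>\<omega>. g (Z \<omega>)) * (expectation (\<lambda>\<omega>. h (Z \<omega>)) :: real)"
  and independence_at_distance:
    "\<exists>R\<^sub>0::real. \<forall>A A'. (\<forall>a\<in>A. \<forall>a'\<in>A'. R\<^sub>0 \<le> dist a a') \<longrightarrow>
       indep_var (closed_sets_in A) (\<lambda>\<omega>. Z \<omega> \<inter> A) (closed_sets_in A') (\<lambda>\<omega>. Z \<omega> \<inter> A')"
  and components_measurable:
    "(\<lambda>\<omega>. emeasure (count_space UNIV) (components (cball b 1 - Z \<omega>))) \<in> borel_measurable M"
  and finite_expected_components:
    "(\<integral>\<^sup>+ \<omega>. emeasure (count_space UNIV) (components (cball b 1 - Z \<omega>)) \<partial>M) < \<infinity>"
  and boundary_length_measurable: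
    "(\<lambda>\<omega>. hausdorff_length (cball b 1 \<inter> frontier (Z \<omega>))) \<in> borel_measurable M"
  and finite_expected_boundary_length:
    "(\<integral>\<^sup>+ \<omega>. hausdorff_length (cball b 1 \<inter> frontier (Z \<omega>)) \<partial>M) < \<infinity>"
  and ball_covered: "prob {\<omega> \<in> space M. cball b 1 \<subseteq> Z \<omega>} > 0"

text \<open>
  By isometry invariance the choice of the segment of length \<open>r\<close> is immaterial.
\<close>

definition segment_prob :: "'w measure \<Rightarrow> ('w \<Rightarrow> hyperbolic_plane set) \<Rightarrow> real \<Rightarrow> real" where
  "segment_prob M Z r = measure M {\<omega> \<in> space M. base_segment r \<subseteq> Z \<omega>}"

definition decay_exponent ::
  "'w measure \<Rightarrow> ('w \<Rightarrow> hyperbolic_plane set) \<Rightarrow> real \<Rightarrow> bool" where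
  "decay_exponent M Z \<alpha> \<longleftrightarrow> \<alpha> \<ge> 0 \<and>
     (\<exists>c>0. \<forall>r\<ge>0. c * exp (- \<alpha> * r) \<le> segment_prob M Z r \<and> segment_prob M Z r \<le> exp (- \<alpha> * r))"

lemma decay_exponent_unique:
  assumes "decay_exponent M Z \<alpha>" "decay_exponent M Z \<beta>"
  shows "\<alpha> = \<beta>"
proof -
  have le: "\<beta> \<le> \<alpha>" if a: "decay_exponent M Z \<alpha>" and b: "decay_exponent M Z \<beta>" for \<alpha> \<beta>
  proof (rule ccontr)
    assume "\<not> \<beta> \<le> \<alpha>"
    then have lt: "0 < \<beta> - \<alpha>" by simp
    from a obtain c where c: "c > 0" "\<And>r. r \<ge> 0 \<Longrightarrow> c * exp (- \<alpha> * r) \<le> segment_prob M Z r"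
      unfolding decay_exponent_def by blast
    define r where "r = (\<bar>ln c\<bar> + 1) / (\<beta> - \<alpha>)"
    have r: "r \<ge> 0" using lt by (simp add: r_def)
    have "c * exp (- \<alpha> * r) \<le> exp (- \<beta> * r)"
      using c(2)[OF r] b r unfolding decay_exponent_def by force
    then have "exp (ln c + - \<alpha> * r) \<le> exp (- \<beta> * r)"
      using c(1) by (simp only: exp_add exp_ln)
    then have "ln c + (\<beta> - \<alpha>) * r \<le> 0" by (simp add: algebra_simps)
    then show False using lt by (simp add: r_def)
  qed
  show ?thesis using le[OF assms] le[OF assms(2,1)] by simp
qed

end

theory Submission
  imports Defs
begin

text \<open>
  A sphere of radius \<open>n\<close> in the hyperbolic plane has about \<open>exp n\<close> essentially different
  directions, and for \<open>\<alpha> \<ge> 1\<close> a segment of length \<open>n\<close> is covered with probability at most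
  \<open>exp (- n)\<close>. The expected number of directions in which one sees to distance \<open>n\<close> from a small ball
  therefore stays bounded, and a population of bounded mean that can die out at every step with a
  probability bounded below dies out almost surely. This argument covers the critical case \<open>\<alpha> = 1\<close>
  and \<open>\<alpha> > 1\<close> alike. Two points carry it.

  First, seeing some point of a small ball from some point of another one must not be much more
  likely than seeing one fixed point from another (\<open>tube_prob_le_seg_prob\<close>). Let \<open>x'\<close> and \<open>y'\<close> be within
  \<open>\<rho>\<close> of the ends \<open>x\<close> and \<open>y\<close> of a segment of length \<open>n\<close>. At distance \<open>s\<close> from \<open>x\<close> the segment from
  \<open>x'\<close> to \<open>y'\<close> deviates from the one from \<open>x\<close> to \<open>y\<close> by only about
  \<open>\<rho> (exp (- s) + exp (- (n - s)))\<close> (\<open>fellow_travel\<close>). If the first is covered and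
  the second is not, then at some \<open>s\<close> there is a near miss: a covered segment within some small
  distance \<open>w\<close> of an uncovered one. A near miss has probability at most \<open>c w\<close> (\<open>prob_near_miss_le\<close>):
  a component of the complement meets the uncovered segment, cannot cross the covered one, and so
  ends within \<open>w\<close> on one side; among about \<open>1 / w\<close> parallel translates
  of the picture, each of the components in a unit ball, whose mean number is finite, is responsible
  for at most two near misses. Independence at a distance separates the near miss from the parts of the
  long segment before and after it, which are again crossings of tubes. This gives a recursion
  (\<open>tube_prob_recursion\<close>) that closes by induction when \<open>\<rho>\<close> is small, because the deviations have a sum
  of order \<open>\<rho>\<close> and because covering probabilities of fixed segments are supermultiplicative.

  Second, when only \<open>m\<close> small balls on the sphere of radius \<open>n\<close> are seen, all continuations beyond them are
  blocked with a probability bounded below in terms of \<open>m\<close>: finitely many decreasing events are positively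
  correlated, and far enough out they are independent of what has been seen. As the mean number of balls
  seen is bounded, survival for ever has probability \<open>0\<close> (\<open>extinction\<close>). Countably many small balls
  contain the starting points of all half-lines.
\<close>

section \<open>The hyperboloid model and segments\<close>

text \<open>
  Coordinates on the sheet \<open>ht\<^sup>2 - hx\<^sup>2 - hy\<^sup>2 = 1\<close> of the hyperboloid. In them the distance is given by a
  bilinear form, isometries are linear and segments are cut out by nonnegative combinations, so that all
  hyperbolic trigonometry reduces to polynomial identities.
\<close>

definition ht :: "hyperbolic_plane \<Rightarrow> real" where
  "ht x = (1 + (cmod (coord x))\<^sup>2) / (1 - (cmod (coord x))\<^sup>2)"

definition hx :: "hyperbolic_plane \<Rightarrow> real" where
  "hx x = 2 * Re (coord x) / (1 - (cmod (coord x))\<^sup>2)"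

definition hy :: "hyperbolic_plane \<Rightarrow> real" where
  "hy x = 2 * Im (coord x) / (1 - (cmod (coord x))\<^sup>2)"

definition lorentz :: "hyperbolic_plane \<Rightarrow> hyperbolic_plane \<Rightarrow> real" where
  "lorentz x y = ht x * ht y - hx x * hx y - hy x * hy y"

definition hpoint :: "real \<Rightarrow> real \<Rightarrow> hyperbolic_plane" where
  "hpoint a b = Point (Complex a b / (1 + sqrt (1 + a\<^sup>2 + b\<^sup>2)))"

lemma coord_denom_pos: "0 < 1 - (cmod (coord x))\<^sup>2"
  using coord_less_1[of x] by (simp add: abs_square_less_1)

lemma lorentz_self: "(ht x)\<^sup>2 - (hx x)\<^sup>2 - (hy x)\<^sup>2 = 1"
proof -
  define n where "n = 1 - (cmod (coord x))\<^sup>2"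
  have n: "n > 0" "(cmod (coord x))\<^sup>2 = 1 - n" "(Re (coord x))\<^sup>2 + (Im (coord x))\<^sup>2 = 1 - n"
    using coord_denom_pos[of x] by (auto simp: n_def cmod_power2)
  have "(2 - n)\<^sup>2 - 4 * ((Re (coord x))\<^sup>2 + (Im (coord x))\<^sup>2) = n\<^sup>2"
    unfolding n(3) by (simp add: power2_eq_square algebra_simps)
  then have "((2 - n)\<^sup>2 - (2 * Re (coord x))\<^sup>2 - (2 * Im (coord x))\<^sup>2) / n\<^sup>2 = 1"
    using n(1) by (simp add: power2_eq_square algebra_simps)
  moreover have "ht x = (2 - n) / n" "hx x = 2 * Re (coord x) / n" "hy x = 2 * Im (coord x) / n"
    by (simp_all add: ht_def hx_def hy_def n_def)
  ultimately show ?thesis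
    by (simp only: power_divide diff_divide_distrib[symmetric])
qed

lemma ht_pos: "0 < ht x"
  unfolding ht_def using coord_denom_pos[of x] by (intro divide_pos_pos add_pos_nonneg) auto

lemma ht_eq_sqrt: "ht x = sqrt (1 + (hx x)\<^sup>2 + (hy x)\<^sup>2)"
  using lorentz_self[of x] ht_pos[of x] by (intro real_sqrt_unique[symmetric]) auto

lemma cosh_dist: "cosh (dist x y) = lorentz x y"
proof -
  define r where "r = disk_ratio (coord x) (coord y)"
  define a where "a = 1 - (cmod (coord x))\<^sup>2"
  define b where "b = 1 - (cmod (coord y))\<^sup>2"
  define e where "e = (cmod (1 - cnj (coord y) * coord x))\<^sup>2"
  have r: "0 \<le> r" "r < 1"
    using disk_ratio_nonneg disk_ratio_less_1[OF coord_less_1 coord_less_1] by (auto simp: r_def)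
  have a: "a > 0" and b: "b > 0" using coord_denom_pos by (auto simp: a_def b_def)
  have e: "e > 0"
    using disk_denom_nonzero[OF coord_less_1[of x] coord_less_1[of y]] by (simp add: e_def)
  have i: "1 - r\<^sup>2 = a * b / e"
    unfolding r_def a_def b_def e_def by (rule disk_ratio_identity[OF coord_less_1 coord_less_1])
  have r2: "r\<^sup>2 < 1" using r by (simp add: abs_square_less_1)
  have d: "dist x y = ln ((1 + r) / (1 - r))"
    unfolding dist_hyperbolic_plane_def r_def disk_ratio_def artanh_def by simp
  have "cosh (dist x y) = ((1 + r) / (1 - r) + (1 - r) / (1 + r)) / 2"
    unfolding d using r by (subst cosh_ln_real) auto
  also have "\<dots> = (1 + r\<^sup>2) / (1 - r\<^sup>2)"
  proof -
    have "(1 - r) * (1 + r) = 1 - r\<^sup>2" by (simp add: power2_eq_square algebra_simps)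
    then show ?thesis using r r2
      by (simp add: divide_simps) (simp add: power2_eq_square algebra_simps)
  qed
  also have "\<dots> = (2 - (1 - r\<^sup>2)) / (1 - r\<^sup>2)" by simp
  also have "\<dots> = (2 * e - a * b) / (a * b)"
    unfolding i using a b e by (simp add: field_simps)
  also have "\<dots> = lorentz x y"
  proof -
    have ex: "2 * e - a * b = (1 + (cmod (coord x))\<^sup>2) * (1 + (cmod (coord y))\<^sup>2)
        - (2 * Re (coord x)) * (2 * Re (coord y)) - (2 * Im (coord x)) * (2 * Im (coord y))"
      unfolding e_def a_def b_def cmod_power2 by (simp add: power2_eq_square algebra_simps)
    show ?thesis
      unfolding ex lorentz_def ht_def hx_def hy_def a_def[symmetric] b_def[symmetric]
      by (simp add: diff_divide_distrib)
  qed
  finally show ?thesis .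
qed

lemma hpoint_coords [simp]:
  "hx (hpoint a b) = a" "hy (hpoint a b) = b" "ht (hpoint a b) = sqrt (1 + a\<^sup>2 + b\<^sup>2)"
proof -
  define t where "t = sqrt (1 + a\<^sup>2 + b\<^sup>2)"
  have t2: "t\<^sup>2 = 1 + a\<^sup>2 + b\<^sup>2" unfolding t_def by (subst real_sqrt_pow2) auto
  have t1: "t > 0" unfolding t_def by (simp add: add_pos_nonneg)
  define z where "z = Complex a b / (1 + t)"
  have m: "(cmod z)\<^sup>2 = (t - 1) / (1 + t)"
  proof -
    have "cmod (1 + complex_of_real t) = 1 + t"
      using t1 by (metis abs_of_pos add_pos_pos norm_of_real of_real_1 of_real_add zero_less_one)
    then have "(cmod z)\<^sup>2 = (a\<^sup>2 + b\<^sup>2) / (1 + t)\<^sup>2"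
      by (simp add: z_def norm_divide power_divide cmod_power2)
    also have "a\<^sup>2 + b\<^sup>2 = (t - 1) * (1 + t)" using t2 by (simp add: power2_eq_square algebra_simps)
    finally show ?thesis using t1 by (simp add: power2_eq_square)
  qed
  have m1: "1 - (cmod z)\<^sup>2 = 2 / (1 + t)" unfolding m using t1 by (simp add: field_simps)
  have "0 < 1 - (cmod z)\<^sup>2" unfolding m1 using t1 by simp
  then have "cmod z < 1" by (simp add: abs_square_less_1)
  then have c: "coord (hpoint a b) = z"
    by (simp add: hpoint_def z_def t_def Point_inverse)
  have ri: "Re z = a / (1 + t)" "Im z = b / (1 + t)"
  proof -
    have "z = Complex a b / complex_of_real (1 + t)" by (simp add: z_def)
    then show "Re z = a / (1 + t)" "Im z = b / (1 + t)"
      by (simp_all only: Re_divide_of_real Im_divide_of_real complex.sel)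
  qed
  show x: "hx (hpoint a b) = a" and y: "hy (hpoint a b) = b"
    unfolding hx_def hy_def c m1 ri using t1 by auto
  show "ht (hpoint a b) = sqrt (1 + a\<^sup>2 + b\<^sup>2)"
    using ht_eq_sqrt[of "hpoint a b"] x y by simp
qed

lemma hpoint_ht:
  assumes "c\<^sup>2 - a\<^sup>2 - b\<^sup>2 = 1" "c > 0"
  shows "ht (hpoint a b) = c"
  using assms by (auto intro!: real_sqrt_unique)

lemma dist_eqI: "lorentz x y = lorentz x' y' \<Longrightarrow> dist x y = dist x' y'"
  by (metis cosh_dist arcosh_cosh_real zero_le_dist)

lemma lorentz_1: "lorentz x x = 1"
  using lorentz_self[of x] by (simp add: lorentz_def power2_eq_square)

lemma hyperboloid_eqI: "hx x = hx y \<Longrightarrow> hy x = hy y \<Longrightarrow> x = y"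
proof -
  assume a: "hx x = hx y" "hy x = hy y"
  then have "ht x = ht y" by (simp add: ht_eq_sqrt)
  with a have "lorentz x y = lorentz x x" by (simp add: lorentz_def)
  then have "dist x y = dist x x" by (rule dist_eqI)
  then show ?thesis by simp
qed

lemma hpoint_collapse [simp]: "hpoint (hx x) (hy x) = x"
  by (rule hyperboloid_eqI) auto

lemma cosh_real_inj: "cosh s = cosh t \<Longrightarrow> 0 \<le> s \<Longrightarrow> 0 \<le> t \<Longrightarrow> s = (t::real)"
  by (metis arcosh_cosh_real)

lemma cosh_dist_le_iff: "0 \<le> r \<Longrightarrow> dist x y \<le> r \<longleftrightarrow> lorentz x y \<le> cosh r"
  by (simp add: cosh_dist[symmetric] cosh_real_nonneg_le_iff)

text \<open>The unit-speed line that carries the base segments; it serves as the axis of all frames.\<close>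

definition base_pt :: "real \<Rightarrow> hyperbolic_plane" where
  "base_pt t = hpoint (sinh t) 0"

lemma cosh_eq_sqrt: "sqrt (1 + (sinh t)\<^sup>2) = cosh (t::real)"
  by (rule real_sqrt_unique) (auto simp: cosh_square_eq)

lemma base_pt_coords [simp]:
  "hx (base_pt t) = sinh t" "hy (base_pt t) = 0" "ht (base_pt t) = cosh t"
  by (auto simp: base_pt_def cosh_eq_sqrt)

lemma base_pt_eq_Point: "base_pt t = Point (complex_of_real (tanh (t / 2)))"
proof -
  define s where "s = t / 2"
  have "sinh t = 2 * sinh s * cosh s" "cosh t = 2 * (cosh s)\<^sup>2 - 1"
    using sinh_double[of s] cosh_double_cosh[of s] by (simp_all add: s_def)
  then have "tanh s = sinh t / (1 + cosh t)"
    by (simp add: tanh_def power2_eq_square)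
  then show ?thesis
    by (simp add: s_def base_pt_def hpoint_def cosh_eq_sqrt flip: complex_of_real_def)
qed

lemma dist_base_pt: "dist (base_pt s) (base_pt t) = \<bar>s - t\<bar>"
proof -
  have "cosh (dist (base_pt s) (base_pt t)) = cosh \<bar>s - t\<bar>"
    by (simp add: cosh_dist lorentz_def cosh_diff)
  then show ?thesis by (rule cosh_real_inj) auto
qed

lemma lorentz_ge_1: "lorentz x y \<ge> 1"
  using cosh_real_ge_1[of "dist x y"] by (simp add: cosh_dist)

text \<open>
  Each coordinate is a combination of hyperbolic cosines of distances to fixed points, which makes its
  continuity for the metric topology immediate.
\<close>

lemma continuous_on_ht: "continuous_on S ht"
proof -
  have eq: "ht = (\<lambda>x. cosh (dist x (base_pt 0)))" by (auto simp: cosh_dist lorentz_def)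
  show ?thesis unfolding eq by (intro continuous_intros)
qed

lemma continuous_on_hx: "continuous_on S hx"
proof -
  have eq: "hx = (\<lambda>x. (ht x * cosh 1 - cosh (dist x (base_pt 1))) / sinh 1)"
    by (auto simp: cosh_dist lorentz_def)
  show ?thesis by (subst eq) (intro continuous_intros continuous_on_ht, simp)
qed

lemma continuous_on_hy: "continuous_on S hy"
proof -
  have eq: "hy = (\<lambda>x. ht x * sqrt 2 - cosh (dist x (hpoint 0 1)))"
    by (auto simp: cosh_dist lorentz_def)
  show ?thesis by (subst eq) (intro continuous_intros continuous_on_ht)
qed

lemma continuous_on_coords [continuous_intros]:
  assumes "continuous_on S f"
  shows "continuous_on S (\<lambda>x. ht (f x))" "continuous_on S (\<lambda>x. hx (f x))" "continuous_on S (\<lambda>x. hy (f x))"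
  using assms continuous_on_ht continuous_on_hx continuous_on_hy
  by (auto intro: continuous_on_compose2[OF _ assms subset_UNIV])

text \<open>
  Conversely the Lorentz form of two points is continuous in their coordinates and tends to \<open>1\<close> on the
  diagonal, so their distance tends to \<open>0\<close>.
\<close>

lemma continuous_on_hpoint [continuous_intros]:
  assumes f: "continuous_on S f" and g: "continuous_on S g"
  shows "continuous_on S (\<lambda>x. hpoint (f x) (g x))"
  unfolding continuous_on_def
proof
  fix x assume x: "x \<in> S"
  define P where "P y = hpoint (f y) (g y)" for y
  have "continuous_on S (\<lambda>y. lorentz (P y) (P x))"
    unfolding lorentz_def P_def hpoint_coords by (intro continuous_intros f g)
  then have "continuous_on S (\<lambda>y. arcosh (lorentz (P y) (P x)))"
    by (rule continuous_on_compose2[OF continuous_on_arcosh[OF order_refl]]) (auto simp: lorentz_ge_1)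
  then have "continuous_on S (\<lambda>y. dist (P y) (P x))"
    by (simp add: cosh_dist[symmetric] arcosh_cosh_real)
  then have "((\<lambda>y. dist (P y) (P x)) \<longlongrightarrow> dist (P x) (P x)) (at x within S)"
    using x unfolding continuous_on_def by blast
  then have "((\<lambda>y. dist (P y) (P x)) \<longlongrightarrow> 0) (at x within S)" by simp
  then show "((\<lambda>y. hpoint (f y) (g y)) \<longlongrightarrow> hpoint (f x) (g x)) (at x within S)"
    unfolding P_def[symmetric] by (rule tendsto_dist_iff[THEN iffD2])
qed

lemma abs_hx_le_ht: "\<bar>hx x\<bar> \<le> ht x" and abs_hy_le_ht: "\<bar>hy x\<bar> \<le> ht x"
proof -
  have "(hx x)\<^sup>2 \<le> (ht x)\<^sup>2" "(hy x)\<^sup>2 \<le> (ht x)\<^sup>2"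
    using lorentz_self[of x] by (smt (verit) zero_le_power2)+
  then show "\<bar>hx x\<bar> \<le> ht x" "\<bar>hy x\<bar> \<le> ht x"
    using ht_pos[of x] by (auto simp: abs_le_square_iff[symmetric])
qed

text \<open>
  The metric interval makes the invariance under isometries evident; the two lemmas on combinations below
  identify it with the intersection of the hyperboloid and a two-dimensional cone.
\<close>

definition seg :: "hyperbolic_plane \<Rightarrow> hyperbolic_plane \<Rightarrow> hyperbolic_plane set" where
  "seg x y = {p. dist x p + dist p y = dist x y}"

lemma seg_commute: "seg x y = seg y x"
  by (auto simp: seg_def dist_commute)

lemma seg_ends [simp]: "x \<in> seg x y" "y \<in> seg x y"
  by (auto simp: seg_def)

lemma combination_norm:
  assumes "ht p = \<alpha> * ht x + \<beta> * ht y" "hx p = \<alpha> * hx x + \<beta> * hx y" "hy p = \<alpha> * hy x + \<beta> * hy y"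
  shows "\<alpha>\<^sup>2 + \<beta>\<^sup>2 + 2 * \<alpha> * \<beta> * lorentz x y = 1" "lorentz x p = \<alpha> + \<beta> * lorentz x y"
    "lorentz p y = \<alpha> * lorentz x y + \<beta>"
proof -
  have "1 = lorentz p p" by (simp add: lorentz_1)
  also have "\<dots> = \<alpha>\<^sup>2 * lorentz x x + \<beta>\<^sup>2 * lorentz y y + 2 * \<alpha> * \<beta> * lorentz x y"
    unfolding lorentz_def assms by (simp add: power2_eq_square algebra_simps)
  finally show "\<alpha>\<^sup>2 + \<beta>\<^sup>2 + 2 * \<alpha> * \<beta> * lorentz x y = 1" by (simp add: lorentz_1)
  have "lorentz x p = \<alpha> * lorentz x x + \<beta> * lorentz x y" "lorentz p y = \<alpha> * lorentz x y + \<beta> * lorentz y y"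
    unfolding lorentz_def assms by (simp_all add: algebra_simps)
  then show "lorentz x p = \<alpha> + \<beta> * lorentz x y" "lorentz p y = \<alpha> * lorentz x y + \<beta>"
    by (simp_all add: lorentz_1)
qed

text \<open>
  For a combination with coefficients \<open>\<alpha>\<close> and \<open>\<beta>\<close> the distances from \<open>p\<close> to \<open>x\<close> and \<open>y\<close> have hyperbolic sines
  \<open>\<beta> sinh d\<close> and \<open>\<alpha> sinh d\<close>, where \<open>d\<close> is the distance of \<open>x\<close> and \<open>y\<close>; the addition theorem then gives
  \<open>cosh d\<close> for the sum of the two distances.
\<close>

lemma seg_combI:
  assumes "\<alpha> \<ge> 0" "\<beta> \<ge> 0"
    and p: "ht p = \<alpha> * ht x + \<beta> * ht y" "hx p = \<alpha> * hx x + \<beta> * hx y" "hy p = \<alpha> * hy x + \<beta> * hy y"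
  shows "p \<in> seg x y"
proof -
  define c where "c = lorentz x y"
  note n = combination_norm[OF p, folded c_def]
  have c: "cosh (dist x y) = c" by (simp add: cosh_dist c_def)
  have c2: "(sinh (dist x y))\<^sup>2 = c\<^sup>2 - 1" using c by (simp add: sinh_square_eq)
  have "(sinh (dist x p))\<^sup>2 = (\<alpha> + \<beta> * c)\<^sup>2 - (\<alpha>\<^sup>2 + \<beta>\<^sup>2 + 2 * \<alpha> * \<beta> * c)"
    by (simp add: sinh_square_eq cosh_dist n)
  also have "\<dots> = (\<beta> * sinh (dist x y))\<^sup>2"
    unfolding power_mult_distrib c2 by (simp add: power2_eq_square algebra_simps)
  finally have s1: "sinh (dist x p) = \<beta> * sinh (dist x y)"
    using assms by (simp add: power2_eq_iff_nonneg)
  have "(sinh (dist p y))\<^sup>2 = (\<alpha> * c + \<beta>)\<^sup>2 - (\<alpha>\<^sup>2 + \<beta>\<^sup>2 + 2 * \<alpha> * \<beta> * c)"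
    by (simp add: sinh_square_eq cosh_dist n)
  also have "\<dots> = (\<alpha> * sinh (dist x y))\<^sup>2"
    unfolding power_mult_distrib c2 by (simp add: power2_eq_square algebra_simps)
  finally have s2: "sinh (dist p y) = \<alpha> * sinh (dist x y)"
    using assms by (simp add: power2_eq_iff_nonneg)
  have "cosh (dist x p + dist p y) = (\<alpha> + \<beta> * c) * (\<alpha> * c + \<beta>) + \<alpha> * \<beta> * (sinh (dist x y))\<^sup>2"
    by (simp add: cosh_add s1 s2 cosh_dist n power2_eq_square)
  also have "\<dots> = c * (\<alpha>\<^sup>2 + \<beta>\<^sup>2 + 2 * \<alpha> * \<beta> * c)"
    unfolding c2 by (simp add: power2_eq_square algebra_simps)
  finally have "cosh (dist x p + dist p y) = cosh (dist x y)" unfolding n(1) c by simp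
  then have "dist x p + dist p y = dist x y" by (rule cosh_real_inj) auto
  then show ?thesis unfolding seg_def by simp
qed

text \<open>
  The distances from \<open>p\<close> to the ends prescribe the coefficients by the law of sines. The point with
  these coefficients has Lorentz product \<open>1\<close> with \<open>p\<close>, hence is \<open>p\<close>.
\<close>

lemma seg_combE:
  assumes "p \<in> seg x y"
  obtains \<alpha> \<beta> where "\<alpha> \<ge> 0" "\<beta> \<ge> 0" "ht p = \<alpha> * ht x + \<beta> * ht y"
    "hx p = \<alpha> * hx x + \<beta> * hx y" "hy p = \<alpha> * hy x + \<beta> * hy y"
proof (cases "x = y")
  case True
  then have "p = x" using assms by (simp add: seg_def dist_commute)
  then show thesis using True by (intro that[of 1 0]) auto
next
  case False
  define d where "d = dist x y"
  define e where "e = dist x p"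
  have d: "d > 0" "dist p y = d - e" "0 \<le> e" "e \<le> d"
    using False assms zero_le_dist[of p y] zero_le_dist[of x p] unfolding seg_def d_def e_def
    by (simp_all del: zero_le_dist)
  define \<alpha> where "\<alpha> = sinh (d - e) / sinh d"
  define \<beta> where "\<beta> = sinh e / sinh d"
  have ab: "\<alpha> \<ge> 0" "\<beta> \<ge> 0" using d by (auto simp: \<alpha>_def \<beta>_def)
  have sd: "sinh d > 0" using d by simp
  have c: "lorentz x y = cosh d" by (simp add: d_def cosh_dist)
  have "(sinh (d - e))\<^sup>2 + (sinh e)\<^sup>2 + 2 * sinh (d - e) * sinh e * cosh d = (sinh d)\<^sup>2"
  proof -
    define A B u v where "A = sinh (d - e)" and "B = cosh (d - e)" and "u = sinh e" and "v = cosh e"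
    have "sinh d = A * v + B * u" "cosh d = B * v + A * u"
      using sinh_add[of "d - e" e] cosh_add[of "d - e" e] by (simp_all add: A_def B_def u_def v_def)
    moreover have "v\<^sup>2 = u\<^sup>2 + 1" "B\<^sup>2 = A\<^sup>2 + 1"
      by (simp_all add: A_def B_def u_def v_def cosh_square_eq)
    then have "(A * v + B * u)\<^sup>2 = A\<^sup>2 + u\<^sup>2 + 2 * A * u * (B * v + A * u)"
      by (simp add: power2_sum power_mult_distrib) (simp add: power2_eq_square algebra_simps)
    ultimately show ?thesis
      unfolding A_def[symmetric] u_def[symmetric] by simp
  qed
  then have n: "\<alpha>\<^sup>2 + \<beta>\<^sup>2 + 2 * \<alpha> * \<beta> * cosh d = 1"
    using sd unfolding \<alpha>_def \<beta>_def by (simp add: field_simps power2_eq_square)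
  define q where "q = hpoint (\<alpha> * hx x + \<beta> * hx y) (\<alpha> * hy x + \<beta> * hy y)"
  have "(\<alpha> * ht x + \<beta> * ht y)\<^sup>2 - (\<alpha> * hx x + \<beta> * hx y)\<^sup>2 - (\<alpha> * hy x + \<beta> * hy y)\<^sup>2
      = \<alpha>\<^sup>2 * lorentz x x + \<beta>\<^sup>2 * lorentz y y + 2 * \<alpha> * \<beta> * lorentz x y"
    unfolding lorentz_def by (simp add: power2_eq_square algebra_simps)
  moreover have "\<alpha> \<noteq> 0 \<or> \<beta> \<noteq> 0" using n by auto
  then have "\<alpha> * ht x + \<beta> * ht y > 0"
    using ab ht_pos[of x] ht_pos[of y] by (smt (verit) mult_nonneg_nonneg mult_pos_pos)
  ultimately have q: "ht q = \<alpha> * ht x + \<beta> * ht y"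
    unfolding q_def using n c by (intro hpoint_ht) (auto simp: lorentz_1)
  have "cosh (dist p q) = \<alpha> * lorentz x p + \<beta> * lorentz p y"
    unfolding cosh_dist lorentz_def q by (simp add: q_def algebra_simps)
  also have "\<dots> = \<alpha> * cosh e + \<beta> * cosh (d - e)"
    using d(2) by (simp add: e_def cosh_dist[symmetric])
  also have "\<dots> = sinh (d - e + e) / sinh d"
    unfolding sinh_add by (simp add: \<alpha>_def \<beta>_def add_divide_distrib mult.commute)
  also have "\<dots> = cosh 0" using sd by simp
  finally have "p = q" using cosh_real_inj[of "dist p q" 0] by simp
  then show thesis using ab q by (intro that[of \<alpha> \<beta>]) (auto simp: q_def)
qed

text \<open>Euclidean interpolation in the ambient space, projected radially back to the hyperboloid.\<close>

definition mix :: "hyperbolic_plane \<Rightarrow> hyperbolic_plane \<Rightarrow> real \<Rightarrow> hyperbolic_plane" where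
  "mix x y t = (let N = sqrt ((1 - t)\<^sup>2 + t\<^sup>2 + 2 * (1 - t) * t * lorentz x y) in
     hpoint (((1 - t) * hx x + t * hx y) / N) (((1 - t) * hy x + t * hy y) / N))"

lemma mix_norm_pos:
  assumes "0 \<le> t" "t \<le> 1"
  shows "1 \<le> (1 - t)\<^sup>2 + t\<^sup>2 + 2 * (1 - t) * t * lorentz x y"
proof -
  have "2 * (1 - t) * t * 1 \<le> 2 * (1 - t) * t * lorentz x y"
    using assms lorentz_ge_1 by (intro mult_left_mono) auto
  moreover have "(1 - t)\<^sup>2 + t\<^sup>2 + 2 * (1 - t) * t * 1 = 1"
    by (simp add: power2_eq_square algebra_simps)
  ultimately show ?thesis by linarith
qed

lemma mix_coords:
  fixes x y :: hyperbolic_plane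
  assumes "0 \<le> t" "t \<le> 1"
  defines "N \<equiv> sqrt ((1 - t)\<^sup>2 + t\<^sup>2 + 2 * (1 - t) * t * lorentz x y)"
  shows "N > 0" "ht (mix x y t) = (1 - t) / N * ht x + t / N * ht y"
    "hx (mix x y t) = (1 - t) / N * hx x + t / N * hx y"
    "hy (mix x y t) = (1 - t) / N * hy x + t / N * hy y"
proof -
  have N: "N\<^sup>2 = (1 - t)\<^sup>2 + t\<^sup>2 + 2 * (1 - t) * t * lorentz x y"
    unfolding N_def using mix_norm_pos[OF assms(1,2), of x y] by simp
  show N0: "N > 0" unfolding N_def using mix_norm_pos[OF assms(1,2), of x y] by simp
  show x: "hx (mix x y t) = (1 - t) / N * hx x + t / N * hx y"
    and y: "hy (mix x y t) = (1 - t) / N * hy x + t / N * hy y"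
    unfolding mix_def N_def[symmetric] Let_def by (simp_all add: add_divide_distrib)
  have "(((1 - t) * ht x + t * ht y) / N)\<^sup>2 - (((1 - t) * hx x + t * hx y) / N)\<^sup>2
     - (((1 - t) * hy x + t * hy y) / N)\<^sup>2
     = ((1 - t)\<^sup>2 * lorentz x x + t\<^sup>2 * lorentz y y + 2 * (1 - t) * t * lorentz x y) / N\<^sup>2"
    unfolding lorentz_def power_divide diff_divide_distrib[symmetric]
    by (simp add: power2_eq_square algebra_simps)
  also have "\<dots> = N\<^sup>2 / N\<^sup>2" unfolding N by (simp add: lorentz_1)
  also have "\<dots> = 1" using N0 by simp
  finally have "(((1 - t) * ht x + t * ht y) / N)\<^sup>2 - (((1 - t) * hx x + t * hx y) / N)\<^sup>2
     - (((1 - t) * hy x + t * hy y) / N)\<^sup>2 = 1" .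
  moreover have "((1 - t) * ht x + t * ht y) / N > 0"
    using N0 assms(1,2) ht_pos[of x] ht_pos[of y]
    by (intro divide_pos_pos) (smt (verit) mult_nonneg_nonneg mult_pos_pos)+
  ultimately have "ht (mix x y t) = ((1 - t) * ht x + t * ht y) / N"
    unfolding mix_def Let_def N_def[symmetric] by (intro hpoint_ht) auto
  then show "ht (mix x y t) = (1 - t) / N * ht x + t / N * ht y"
    by (simp add: add_divide_distrib)
qed

lemma seg_eq_mix: "seg x y = mix x y ` {0..1}"
proof (intro equalityI subsetI)
  fix p assume "p \<in> mix x y ` {0..1}"
  then obtain t where t: "0 \<le> t" "t \<le> 1" and p: "p = mix x y t" by auto
  note m = mix_coords[OF t, of x y]
  show "p \<in> seg x y" unfolding p
    by (rule seg_combI[OF _ _ m(2-4)]) (use t m(1) in auto)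
next
  fix p assume "p \<in> seg x y"
  then obtain \<alpha> \<beta> where ab: "\<alpha> \<ge> 0" "\<beta> \<ge> 0"
    and p: "ht p = \<alpha> * ht x + \<beta> * ht y" "hx p = \<alpha> * hx x + \<beta> * hx y" "hy p = \<alpha> * hy x + \<beta> * hy y"
    by (rule seg_combE)
  have "\<alpha> \<noteq> 0 \<or> \<beta> \<noteq> 0" using p(1) ht_pos[of p] by auto
  then have s: "\<alpha> + \<beta> > 0" using ab by auto
  define t where "t = \<beta> / (\<alpha> + \<beta>)"
  have t: "0 \<le> t" "t \<le> 1" using ab s by (auto simp: t_def)
  have t1: "1 - t = \<alpha> / (\<alpha> + \<beta>)" using s by (simp add: t_def field_simps)
  have "(1 - t)\<^sup>2 + t\<^sup>2 + 2 * (1 - t) * t * lorentz x y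
      = (\<alpha>\<^sup>2 + \<beta>\<^sup>2 + 2 * \<alpha> * \<beta> * lorentz x y) / (\<alpha> + \<beta>)\<^sup>2"
    unfolding t1 unfolding t_def using s by (simp add: power_divide add_divide_distrib power2_eq_square)
  also have "\<dots> = (1 / (\<alpha> + \<beta>))\<^sup>2" by (simp add: combination_norm(1)[OF p] power_divide)
  finally have N: "sqrt ((1 - t)\<^sup>2 + t\<^sup>2 + 2 * (1 - t) * t * lorentz x y) = 1 / (\<alpha> + \<beta>)"
    using s by simp
  have "p = mix x y t"
  proof (rule hyperboloid_eqI)
    show "hx p = hx (mix x y t)" "hy p = hy (mix x y t)"
      using mix_coords(3,4)[OF t, of x y, unfolded N] s p unfolding t1 by (simp_all add: t_def)
  qed
  then show "p \<in> mix x y ` {0..1}" using t by auto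
qed

lemma continuous_on_mix [continuous_intros]:
  assumes "continuous_on S f" "continuous_on S g" "continuous_on S u"
    and "\<And>z. z \<in> S \<Longrightarrow> 0 \<le> u z" "\<And>z. z \<in> S \<Longrightarrow> u z \<le> 1"
  shows "continuous_on S (\<lambda>z. mix (f z) (g z) (u z))"
proof -
  have "sqrt ((1 - u z)\<^sup>2 + (u z)\<^sup>2 + 2 * (1 - u z) * u z * lorentz (f z) (g z)) \<noteq> 0" if "z \<in> S" for z
    using mix_norm_pos[of "u z" "f z" "g z"] assms(4,5)[OF that] by simp
  then show ?thesis
    unfolding mix_def Let_def lorentz_def using assms(1-3)
    by (intro continuous_intros) auto
qed

text \<open>Nonnegative combinations of nonnegative combinations are nonnegative combinations.\<close>

lemma subseg:
  assumes "p \<in> seg x y" "q \<in> seg x y"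
  shows "seg p q \<subseteq> seg x y"
proof
  fix z assume "z \<in> seg p q"
  then obtain \<alpha> \<beta> where ab: "\<alpha> \<ge> 0" "\<beta> \<ge> 0"
    and z: "ht z = \<alpha> * ht p + \<beta> * ht q" "hx z = \<alpha> * hx p + \<beta> * hx q" "hy z = \<alpha> * hy p + \<beta> * hy q"
    by (rule seg_combE)
  obtain a b where a: "a \<ge> 0" "b \<ge> 0"
    and p: "ht p = a * ht x + b * ht y" "hx p = a * hx x + b * hx y" "hy p = a * hy x + b * hy y"
    by (rule seg_combE[OF assms(1)])
  obtain c d where c: "c \<ge> 0" "d \<ge> 0"
    and q: "ht q = c * ht x + d * ht y" "hx q = c * hx x + d * hx y" "hy q = c * hy x + d * hy y"
    by (rule seg_combE[OF assms(2)])
  show "z \<in> seg x y"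
    by (rule seg_combI[of "\<alpha> * a + \<beta> * c" "\<alpha> * b + \<beta> * d"])
      (use ab a c in \<open>auto simp: z p q algebra_simps\<close>)
qed

lemma seg_IVT:
  assumes F: "continuous_on UNIV (F :: hyperbolic_plane \<Rightarrow> real)" and "F x \<le> c" "c \<le> F y"
  obtains p where "p \<in> seg x y" "F p = c"
proof -
  have x: "mix x y 0 = x" and y: "mix x y 1 = y"
    by (simp_all add: mix_def)
  have "continuous_on {0..1} (\<lambda>t. F (mix x y t))"
    by (intro continuous_on_compose2[OF F] continuous_intros) auto
  then obtain t where "0 \<le> t" "t \<le> 1" "F (mix x y t) = c"
    using IVT'[of "\<lambda>t. F (mix x y t)" 0 c 1] assms(2,3) by (auto simp: x y)
  then show thesis using that[of "mix x y t"] by (auto simp: seg_eq_mix)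
qed

section \<open>Isometries, geodesics and balls\<close>

lemma isometryI:
  assumes "\<And>x y. lorentz (\<phi> x) (\<phi> y) = lorentz x y" "\<And>x. \<phi> (\<psi> x) = x"
  shows "isometry \<phi>"
  using assms by (auto simp: isometry_def intro!: dist_eqI surjI[of \<phi> \<psi>])

text \<open>
  The rotation about the origin, the translation along the base line, and the translation along the line
  perpendicular to it at the origin.
\<close>

definition rot :: "real \<Rightarrow> hyperbolic_plane \<Rightarrow> hyperbolic_plane" where
  "rot t p = hpoint (cos t * hx p - sin t * hy p) (sin t * hx p + cos t * hy p)"

definition boost :: "real \<Rightarrow> hyperbolic_plane \<Rightarrow> hyperbolic_plane" where
  "boost s p = hpoint (ht p * sinh s + hx p * cosh s) (hy p)"

definition lift :: "real \<Rightarrow> hyperbolic_plane \<Rightarrow> hyperbolic_plane" where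
  "lift s p = hpoint (hx p) (ht p * sinh s + hy p * cosh s)"

lemma rot_coords [simp]:
  "hx (rot t p) = cos t * hx p - sin t * hy p" "hy (rot t p) = sin t * hx p + cos t * hy p"
  "ht (rot t p) = ht p"
proof -
  show "hx (rot t p) = cos t * hx p - sin t * hy p" "hy (rot t p) = sin t * hx p + cos t * hy p"
    by (simp_all add: rot_def)
  have "(cos t * hx p - sin t * hy p)\<^sup>2 + (sin t * hx p + cos t * hy p)\<^sup>2
      = ((sin t)\<^sup>2 + (cos t)\<^sup>2) * ((hx p)\<^sup>2 + (hy p)\<^sup>2)"
    by (simp add: power2_eq_square algebra_simps del: sin_cos_squared_add sin_cos_squared_add2 sin_cos_squared_add3)
  then show "ht (rot t p) = ht p"
    unfolding rot_def using lorentz_self[of p] ht_pos[of p] by (intro hpoint_ht) auto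
qed

lemma cosh_sinh_combination_pos:
  assumes "\<bar>b\<bar> \<le> a" "a > (0::real)"
  shows "a * cosh s + b * sinh s > 0"
proof -
  have "a * cosh s + b * sinh s = ((a + b) * exp s + (a - b) * exp (- s)) / 2"
    by (simp add: cosh_def sinh_def field_simps)
  moreover have "0 < (a + b) * exp s + (a - b) * exp (- s)"
  proof (cases "a + b > 0")
    case True then show ?thesis using assms by (intro add_pos_nonneg) auto
  next
    case False then show ?thesis using assms by (intro add_nonneg_pos) auto
  qed
  ultimately show ?thesis by simp
qed

lemma boost_coords [simp]:
  "hx (boost s p) = ht p * sinh s + hx p * cosh s" "hy (boost s p) = hy p"
  "ht (boost s p) = ht p * cosh s + hx p * sinh s"
proof -
  show "hx (boost s p) = ht p * sinh s + hx p * cosh s" "hy (boost s p) = hy p"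
    by (simp_all add: boost_def)
  have "(ht p * cosh s + hx p * sinh s)\<^sup>2 - (ht p * sinh s + hx p * cosh s)\<^sup>2
    = ((cosh s)\<^sup>2 - (sinh s)\<^sup>2) * ((ht p)\<^sup>2 - (hx p)\<^sup>2)"
    by (simp add: power2_eq_square algebra_simps)
  also have "\<dots> = 1 + (hy p)\<^sup>2"
    using lorentz_self[of p] hyperbolic_pythagoras[of s] by simp
  finally show "ht (boost s p) = ht p * cosh s + hx p * sinh s"
    unfolding boost_def
    by (intro hpoint_ht cosh_sinh_combination_pos abs_hx_le_ht ht_pos) auto
qed

lemma lift_coords [simp]:
  "hy (lift s p) = ht p * sinh s + hy p * cosh s" "hx (lift s p) = hx p"
  "ht (lift s p) = ht p * cosh s + hy p * sinh s"
proof -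
  show "hy (lift s p) = ht p * sinh s + hy p * cosh s" "hx (lift s p) = hx p"
    by (simp_all add: lift_def)
  have "(ht p * cosh s + hy p * sinh s)\<^sup>2 - (ht p * sinh s + hy p * cosh s)\<^sup>2
    = ((cosh s)\<^sup>2 - (sinh s)\<^sup>2) * ((ht p)\<^sup>2 - (hy p)\<^sup>2)"
    by (simp add: power2_eq_square algebra_simps)
  also have "\<dots> = 1 + (hx p)\<^sup>2"
    using lorentz_self[of p] hyperbolic_pythagoras[of s] by simp
  finally show "ht (lift s p) = ht p * cosh s + hy p * sinh s"
    unfolding lift_def
    by (intro hpoint_ht cosh_sinh_combination_pos abs_hy_le_ht ht_pos) auto
qed

lemma isometry_rot: "isometry (rot t)"
proof (rule isometryI[where \<psi> = "rot (- t)"])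
  fix x y
  have "lorentz (rot t x) (rot t y) = ht x * ht y - ((sin t)\<^sup>2 + (cos t)\<^sup>2) * (hx x * hx y + hy x * hy y)"
    unfolding lorentz_def rot_coords
    by (simp add: power2_eq_square algebra_simps del: sin_cos_squared_add sin_cos_squared_add2 sin_cos_squared_add3)
  then show "lorentz (rot t x) (rot t y) = lorentz x y" by (simp add: lorentz_def)
  have "cos t * (cos t * hx x + sin t * hy x) - sin t * (cos t * hy x - sin t * hx x) = ((sin t)\<^sup>2 + (cos t)\<^sup>2) * hx x"
    "sin t * (cos t * hx x + sin t * hy x) + cos t * (cos t * hy x - sin t * hx x) = ((sin t)\<^sup>2 + (cos t)\<^sup>2) * hy x"
    by (simp_all add: power2_eq_square algebra_simps del: sin_cos_squared_add sin_cos_squared_add2 sin_cos_squared_add3)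
  then show "rot t (rot (- t) x) = x"
    by (intro hyperboloid_eqI) simp_all
qed

lemma isometry_boost: "isometry (boost s)"
proof (rule isometryI[where \<psi> = "boost (- s)"])
  fix x y
  have "lorentz (boost s x) (boost s y) = ((cosh s)\<^sup>2 - (sinh s)\<^sup>2) * (ht x * ht y - hx x * hx y) - hy x * hy y"
    unfolding lorentz_def boost_coords by (simp add: power2_eq_square algebra_simps)
  then show "lorentz (boost s x) (boost s y) = lorentz x y"
    using hyperbolic_pythagoras[of s] by (simp add: lorentz_def)
  have "(ht x * cosh s - hx x * sinh s) * sinh s + (hx x * cosh s - ht x * sinh s) * cosh s
      = ((cosh s)\<^sup>2 - (sinh s)\<^sup>2) * hx x"
    by (simp add: power2_eq_square algebra_simps)
  then show "boost s (boost (- s) x) = x"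
    using hyperbolic_pythagoras[of s] by (intro hyperboloid_eqI) simp_all
qed

lemma isometry_lift: "isometry (lift s)"
proof (rule isometryI[where \<psi> = "lift (- s)"])
  fix x y
  have "lorentz (lift s x) (lift s y) = ((cosh s)\<^sup>2 - (sinh s)\<^sup>2) * (ht x * ht y - hy x * hy y) - hx x * hx y"
    unfolding lorentz_def lift_coords by (simp add: power2_eq_square algebra_simps)
  then show "lorentz (lift s x) (lift s y) = lorentz x y"
    using hyperbolic_pythagoras[of s] by (simp add: lorentz_def)
  have "(ht x * cosh s - hy x * sinh s) * sinh s + (hy x * cosh s - ht x * sinh s) * cosh s
      = ((cosh s)\<^sup>2 - (sinh s)\<^sup>2) * hy x"
    by (simp add: power2_eq_square algebra_simps)
  then show "lift s (lift (- s) x) = x"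
    using hyperbolic_pythagoras[of s] by (intro hyperboloid_eqI) simp_all
qed

lemma boost_base_pt: "boost s (base_pt t) = base_pt (s + t)"
  by (rule hyperboloid_eqI) (simp_all add: sinh_add algebra_simps)

lemma isometry_dist: "isometry \<phi> \<Longrightarrow> dist (\<phi> x) (\<phi> y) = dist x y"
  by (simp add: isometry_def)

lemma isometry_bij:
  assumes "isometry \<phi>" shows "bij \<phi>"
proof (rule bijI)
  show "inj \<phi>"
  proof (rule injI)
    fix x y assume "\<phi> x = \<phi> y"
    then have "dist (\<phi> x) (\<phi> y) = 0" by simp
    then show "x = y" using assms by (simp add: isometry_dist)
  qed
  show "surj \<phi>" using assms by (simp add: isometry_def)
qed

lemma isometry_comp: "isometry \<phi> \<Longrightarrow> isometry \<psi> \<Longrightarrow> isometry (\<phi> \<circ> \<psi>)"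
  unfolding isometry_def using comp_surj[of \<psi> \<phi>] by auto

lemma isometry_inv_apply [simp]:
  assumes "isometry \<phi>" shows "inv \<phi> (\<phi> x) = x" "\<phi> (inv \<phi> x) = x"
  using isometry_bij[OF assms] by (simp_all add: bij_is_inj bij_is_surj surj_f_inv_f)

lemma isometry_inv:
  assumes "isometry \<phi>" shows "isometry (inv \<phi>)"
  unfolding isometry_def
proof (intro conjI allI)
  show "surj (inv \<phi>)" using isometry_bij[OF assms] by (simp add: bij_imp_bij_inv bij_is_surj)
  fix x y
  have "dist (\<phi> (inv \<phi> x)) (\<phi> (inv \<phi> y)) = dist (inv \<phi> x) (inv \<phi> y)"
    by (rule isometry_dist[OF assms])
  then show "dist (inv \<phi> x) (inv \<phi> y) = dist x y" using assms by simp
qed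

lemma isometry_continuous: "isometry \<phi> \<Longrightarrow> continuous_on S \<phi>"
  unfolding continuous_on_iff isometry_def by auto

lemma isometry_image_seg: "isometry \<phi> \<Longrightarrow> \<phi> ` seg x y = seg (\<phi> x) (\<phi> y)"
proof (intro equalityI subsetI)
  fix p assume i: "isometry \<phi>" and "p \<in> seg (\<phi> x) (\<phi> y)"
  then have "inv \<phi> p \<in> seg x y"
    unfolding seg_def mem_Collect_eq
    using isometry_dist[OF i, of _ "inv \<phi> p"] isometry_dist[OF i, of "inv \<phi> p"] i
      isometry_dist[OF i, of x y] by simp
  then show "p \<in> \<phi> ` seg x y" using i by (metis imageI isometry_inv_apply(2))
qed (auto simp: seg_def isometry_dist)

lemma isometry_image_cball: "isometry \<phi> \<Longrightarrow> \<phi> ` cball x r = cball (\<phi> x) r"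
proof (intro equalityI subsetI)
  fix p assume i: "isometry \<phi>" and "p \<in> cball (\<phi> x) r"
  then have "inv \<phi> p \<in> cball x r"
    using isometry_dist[OF i, of x "inv \<phi> p"] i by simp
  then show "p \<in> \<phi> ` cball x r" using i by (metis imageI isometry_inv_apply(2))
qed (auto simp: isometry_dist)

lemma rotate_to_axis: obtains t r where "r \<ge> 0" "rot t x = base_pt r"
proof -
  define z where "z = Complex (hx x) (hy x)"
  define t where "t = - Arg z"
  have h: "hx x = cmod z * cos (Arg z)" "hy x = cmod z * sin (Arg z)"
    using Re_rcis[of "cmod z" "Arg z"] Im_rcis[of "cmod z" "Arg z"]
    unfolding rcis_cmod_Arg by (simp_all add: z_def)
  have "hx (rot t x) = cmod z * ((sin (Arg z))\<^sup>2 + (cos (Arg z))\<^sup>2)" "hy (rot t x) = 0"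
    unfolding rot_coords h t_def
    by (simp_all add: power2_eq_square algebra_simps del: sin_cos_squared_add sin_cos_squared_add2 sin_cos_squared_add3)
  then have "rot t x = base_pt (arsinh (cmod z))"
    by (intro hyperboloid_eqI) auto
  moreover have "arsinh (cmod z) \<ge> 0"
    using sinh_real_nonneg_iff[of "arsinh (cmod z)"] by simp
  ultimately show thesis using that by blast
qed

text \<open>Rotate \<open>x\<close> to the base line, translate it to the origin, then rotate \<open>y\<close> to the base line.\<close>

lemma normalize_pair:
  obtains \<phi> where "isometry \<phi>" "\<phi> x = base_pt 0" "\<phi> y = base_pt (dist x y)"
proof -
  obtain t r where "rot t x = base_pt r" by (metis rotate_to_axis)
  then have 1: "(boost (- r) \<circ> rot t) x = base_pt 0" by (simp add: boost_base_pt)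
  obtain s d where d: "d \<ge> 0" "rot s ((boost (- r) \<circ> rot t) y) = base_pt d" by (metis rotate_to_axis)
  define \<phi> where "\<phi> = rot s \<circ> (boost (- r) \<circ> rot t)"
  have i: "isometry \<phi>"
    unfolding \<phi>_def by (intro isometry_comp isometry_rot isometry_boost)
  have x: "\<phi> x = base_pt 0"
    unfolding \<phi>_def comp_apply[of "rot s"] 1 by (rule hyperboloid_eqI) auto
  have y: "\<phi> y = base_pt d" using d by (simp add: \<phi>_def)
  have "dist x y = dist (\<phi> x) (\<phi> y)" using i by (simp add: isometry_dist)
  then have "dist x y = d" unfolding x y dist_base_pt using d by simp
  then show thesis using that i x y by simp
qed

lemma two_point_homogeneous:
  assumes "dist x y = dist x' y'"
  obtains \<phi> where "isometry \<phi>" "\<phi> x = x'" "\<phi> y = y'"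
proof -
  obtain \<phi> where \<phi>: "isometry \<phi>" "\<phi> x = base_pt 0" "\<phi> y = base_pt (dist x y)"
    by (rule normalize_pair)
  obtain \<psi> where \<psi>: "isometry \<psi>" "\<psi> x' = base_pt 0" "\<psi> y' = base_pt (dist x' y')"
    by (rule normalize_pair)
  show thesis
  proof (rule that)
    show "isometry (inv \<psi> \<circ> \<phi>)" by (intro isometry_comp isometry_inv \<phi> \<psi>)
    show "(inv \<psi> \<circ> \<phi>) x = x'" "(inv \<psi> \<circ> \<phi>) y = y'"
      using \<phi> \<psi> assms by (metis comp_apply isometry_inv_apply(1))+
  qed
qed

text \<open>
  The Lorentz product with a combination of \<open>x\<close> and \<open>y\<close> depends only on the products with \<open>x\<close> and \<open>y\<close>.
  As \<open>p\<close> is such a combination, its product with \<open>q\<close> equals the one with itself.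
\<close>

lemma seg_unique:
  assumes "p \<in> seg x y" "q \<in> seg x y" "dist x p = dist x q"
  shows "p = q"
proof -
  obtain \<alpha> \<beta> where p: "ht p = \<alpha> * ht x + \<beta> * ht y"
    "hx p = \<alpha> * hx x + \<beta> * hx y" "hy p = \<alpha> * hy x + \<beta> * hy y"
    using seg_combE[OF assms(1)] by metis
  have "dist p y = dist q y" using assms by (simp add: seg_def)
  then have l: "lorentz x q = lorentz x p" "lorentz q y = lorentz p y"
    using assms(3) by (simp_all add: cosh_dist[symmetric])
  have "lorentz p z = \<alpha> * lorentz x z + \<beta> * lorentz z y" for z
    unfolding lorentz_def p by (simp add: algebra_simps)
  then have "lorentz p q = lorentz p p" by (simp add: l)
  then have "dist p q = dist p p" by (rule dist_eqI)
  then show ?thesis by simp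
qed

text \<open>By uniqueness, the point of the interval at distance \<open>s\<close> from \<open>\<gamma> 0\<close> is \<open>\<gamma> s\<close>.\<close>

lemma geodesic_contains_seg:
  assumes "\<And>s t. 0 \<le> s \<Longrightarrow> 0 \<le> t \<Longrightarrow> s \<le> r \<Longrightarrow> t \<le> r \<Longrightarrow> dist (\<gamma> s) (\<gamma> t) = \<bar>s - t\<bar>" "0 \<le> r"
  shows "seg (\<gamma> 0) (\<gamma> r) = \<gamma> ` {0..r}"
proof (intro equalityI subsetI)
  fix p assume "p \<in> \<gamma> ` {0..r}"
  then show "p \<in> seg (\<gamma> 0) (\<gamma> r)" using assms(2) by (auto simp: seg_def assms(1))
next
  fix p assume p: "p \<in> seg (\<gamma> 0) (\<gamma> r)"
  define s where "s = dist (\<gamma> 0) p"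
  have s: "0 \<le> s" "s \<le> r"
    using p assms zero_le_dist[of p "\<gamma> r"] zero_le_dist[of "\<gamma> 0" p] by (auto simp: seg_def s_def simp del: zero_le_dist)
  have "\<gamma> s \<in> seg (\<gamma> 0) (\<gamma> r)" using s by (auto simp: seg_def assms(1))
  then have "p = \<gamma> s"
    using p s by (intro seg_unique[of _ "\<gamma> 0" "\<gamma> r"]) (auto simp: assms(1) s_def[symmetric])
  then show "p \<in> \<gamma> ` {0..r}" using s by auto
qed

lemma seg_base_pt:
  assumes "s \<le> t" shows "seg (base_pt s) (base_pt t) = base_pt ` {s..t}"
proof -
  have "seg ((\<lambda>u. base_pt (s + u)) 0) ((\<lambda>u. base_pt (s + u)) (t - s)) = (\<lambda>u. base_pt (s + u)) ` {0..t - s}"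
    by (rule geodesic_contains_seg) (use assms in \<open>auto simp: dist_base_pt\<close>)
  moreover have "(\<lambda>u. base_pt (s + u)) ` {0..t - s} = base_pt ` {s..t}"
    by (simp add: image_image[of base_pt "(+) s", symmetric] image_add_atLeastAtMost)
  ultimately show ?thesis by simp
qed

lemma base_segment_eq_seg: "0 \<le> r \<Longrightarrow> base_segment r = seg (base_pt 0) (base_pt r)"
  by (simp add: seg_base_pt base_segment_def flip: base_pt_eq_Point)

text \<open>A bound on the distance to the origin bounds all coordinates.\<close>

lemma compact_cball_hyperbolic: "compact (cball (x :: hyperbolic_plane) r)"
proof -
  define R where "R = \<bar>r\<bar> + dist x (base_pt 0)"
  define K where "K = {p :: real \<times> real. \<bar>fst p\<bar> \<le> cosh R \<and> \<bar>snd p\<bar> \<le> cosh R}"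
  have K: "K = {- cosh R..cosh R} \<times> {- cosh R..cosh R}"
    by (auto simp: K_def abs_le_iff)
  have "compact K" unfolding K by (intro compact_Times compact_Icc)
  then have c: "compact ((\<lambda>p. hpoint (fst p) (snd p)) ` K)"
    by (intro compact_continuous_image continuous_intros)
  have "cball x r \<subseteq> (\<lambda>p. hpoint (fst p) (snd p)) ` K"
  proof
    fix y assume "y \<in> cball x r"
    then have "dist y (base_pt 0) \<le> R"
      using dist_triangle[of y "base_pt 0" x] by (simp add: R_def dist_commute)
    then have "ht y \<le> cosh R"
      using cosh_dist_le_iff[of R y "base_pt 0"] by (simp add: R_def lorentz_def)
    then have "(hx y, hy y) \<in> K"
      using abs_hx_le_ht[of y] abs_hy_le_ht[of y] by (simp add: K_def)
    then show "y \<in> (\<lambda>p. hpoint (fst p) (snd p)) ` K" by force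
  qed
  then show ?thesis using closed_Int_compact[OF closed_cball c] by (metis Int_absorb2)
qed

lemma seg_subset_cball:
  assumes "x \<in> cball z r" "dist x y \<le> l"
  shows "seg x y \<subseteq> cball z (r + l)"
proof
  fix p assume "p \<in> seg x y"
  then have "dist x p \<le> dist x y" using zero_le_dist[of p y] by (simp add: seg_def del: zero_le_dist)
  then show "p \<in> cball z (r + l)" using assms dist_triangle[of z p x] by simp
qed

section \<open>Crossing events: measurability, invariance and correlation\<close>

text \<open>
  All events below are built from this one: for singletons it is the covering of a fixed segment, for
  small balls it is the visibility of one ball from another.
\<close>

definition crossed :: "hyperbolic_plane set \<Rightarrow> hyperbolic_plane set \<Rightarrow> hyperbolic_plane set \<Rightarrow> bool" where
  "crossed A B C \<longleftrightarrow> (\<exists>a\<in>A. \<exists>b\<in>B. seg a b \<subseteq> C)"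

lemma finite_net:
  assumes "compact K" "0 < (e::real)"
  obtains F where "finite F" "F \<subseteq> K" "\<And>x. x \<in> K \<Longrightarrow> \<exists>y\<in>F. dist y x < e"
proof -
  have "\<exists>k. finite k \<and> k \<subseteq> K \<and> K \<subseteq> (\<Union>x\<in>k. ball x e)"
    using seq_compact_imp_totally_bounded assms compact_imp_seq_compact by blast
  then show thesis using that by (fastforce simp: subset_eq)
qed

lemma hits_in_sets:
  "compact K \<Longrightarrow> K \<subseteq> D \<Longrightarrow> {C. closedin (top_of_set D) C \<and> C \<inter> K \<noteq> {}} \<in> sets (closed_sets_in D)"
  unfolding closed_sets_in_def by (intro in_measure_of) auto

lemma space_closed_sets_in: "space (closed_sets_in D) = {C. closedin (top_of_set D) C}"
  unfolding closed_sets_in_def by (intro space_measure_of) auto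

text \<open>
  The uncountable quantifiers over end points and over the points of a segment are replaced by finite
  nets: a closed set contains a segment if and only if for every precision it comes close to all net
  points of a segment with ends in the net. The nontrivial direction extracts a convergent
  sequence of segments and uses that the set is closed. Intersecting the small balls with
  \<open>D\<close> keeps the event in the \<open>\<sigma>\<close>-algebra of the region \<open>D\<close>, as independence requires.
\<close>

lemma crossed_in_sets:
  assumes A: "compact A" and B: "compact B" and D: "closed D"
    and sub: "\<And>a b. a \<in> A \<Longrightarrow> b \<in> B \<Longrightarrow> seg a b \<subseteq> D"
  shows "{C. closedin (top_of_set D) C \<and> crossed A B C} \<in> sets (closed_sets_in D)"
proof (cases "A = {} \<or> B = {}")
  case True
  then have "{C. closedin (top_of_set D) C \<and> crossed A B C} = {}" by (auto simp: crossed_def)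
  then show ?thesis by (simp only: sets.empty_sets)
next
  case False
  define K where "K = A \<times> B"
  define \<sigma> where "\<sigma> p t = mix (fst p) (snd p) t" for p t
  have K: "compact K" unfolding K_def by (intro compact_Times A B)
  define J where "J = {0..1::real}"
  have J: "compact J" "J \<noteq> {}" by (auto simp: J_def)
  have cont: "continuous_on (K \<times> J) (\<lambda>z. \<sigma> (fst z) (snd z))"
    unfolding \<sigma>_def by (intro continuous_intros) (auto simp: J_def)
  then have "uniformly_continuous_on (K \<times> J) (\<lambda>z. \<sigma> (fst z) (snd z))"
    by (rule compact_uniformly_continuous) (intro compact_Times K J)
  then have "\<forall>n::nat. \<exists>d>0. \<forall>z\<in>K \<times> J. \<forall>z'\<in>K \<times> J. dist z' z < d \<longrightarrow>
      dist (\<sigma> (fst z') (snd z')) (\<sigma> (fst z) (snd z)) < 1 / (n + 1)"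
    unfolding uniformly_continuous_on_def by simp
  then obtain d :: "nat \<Rightarrow> real" where d: "\<And>n. d n > 0"
    "\<And>n z z'. z \<in> K \<times> J \<Longrightarrow> z' \<in> K \<times> J \<Longrightarrow> dist z' z < d n \<Longrightarrow>
      dist (\<sigma> (fst z') (snd z')) (\<sigma> (fst z) (snd z)) < 1 / (n + 1)"
    by metis
  have "\<forall>n. \<exists>F. finite F \<and> F \<subseteq> K \<and> (\<forall>x\<in>K. \<exists>y\<in>F. dist y x < d n)"
    using finite_net[OF K d(1)] by metis
  then obtain F where F: "\<And>n. finite (F n)" "\<And>n. F n \<subseteq> K" "\<And>n x. x \<in> K \<Longrightarrow> \<exists>y\<in>F n. dist y x < d n"
    by metis
  have "\<forall>n. \<exists>G. finite G \<and> G \<subseteq> J \<and> (\<forall>x\<in>J. \<exists>y\<in>G. dist y x < d n)"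
    using finite_net[OF J(1) d(1)] by metis
  then obtain G where G: "\<And>n. finite (G n)" "\<And>n. G n \<subseteq> J" "\<And>n x. x \<in> J \<Longrightarrow> \<exists>y\<in>G n. dist y x < d n"
    by metis
  \<comment> \<open>finite intersections over an empty family would leave the \<open>\<sigma>\<close>-algebra\<close>
  have Gne: "G n \<noteq> {}" for n using G(3)[of 0 n] by (auto simp: J_def)
  define H where "H n p t = {C. closedin (top_of_set D) C \<and> C \<inter> (cball (\<sigma> p t) (1 / real (n + 1)) \<inter> D) \<noteq> {}}" for n p t
  have H: "H n p t \<in> sets (closed_sets_in D)" for n p t
    unfolding H_def by (intro hits_in_sets compact_Int_closed compact_cball_hyperbolic D) auto
  have eq: "{C. closedin (top_of_set D) C \<and> crossed A B C} = (\<Inter>n. \<Union>p\<in>F n. \<Inter>t\<in>G n. H n p t)"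
  proof (intro equalityI subsetI)
    fix C assume "C \<in> {C. closedin (top_of_set D) C \<and> crossed A B C}"
    then obtain a b where C: "closedin (top_of_set D) C" and ab: "a \<in> A" "b \<in> B" "seg a b \<subseteq> C"
      by (auto simp: crossed_def)
    have "(a, b) \<in> K" using ab by (simp add: K_def)
    have "\<exists>p\<in>F n. \<forall>t\<in>G n. C \<in> H n p t" for n
    proof -
      obtain p where p: "p \<in> F n" "dist p (a, b) < d n" using F(3)[OF \<open>(a, b) \<in> K\<close>] by blast
      have "C \<in> H n p t" if t: "t \<in> G n" for t
      proof -
        have "t \<in> J" using t G(2) by blast
        then have "dist (\<sigma> p t) (\<sigma> (a, b) t) < 1 / (n + 1)"
          using d(2)[of "((a,b), t)" "(p, t)" n] p subsetD[OF F(2) p(1)] \<open>(a, b) \<in> K\<close>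
          by (simp add: dist_Pair_Pair add.commute)
        moreover have "\<sigma> (a, b) t \<in> C"
          using ab(3) \<open>t \<in> J\<close> by (auto simp: seg_eq_mix \<sigma>_def J_def)
        moreover have "C \<subseteq> D" using C closedin_imp_subset by blast
        ultimately show ?thesis unfolding H_def using C by (force intro: less_imp_le)
      qed
      then show ?thesis using p by blast
    qed
    then show "C \<in> (\<Inter>n. \<Union>p\<in>F n. \<Inter>t\<in>G n. H n p t)" by simp
  next
    fix C assume C: "C \<in> (\<Inter>n. \<Union>p\<in>F n. \<Inter>t\<in>G n. H n p t)"
    then have "\<forall>n. \<exists>p\<in>F n. \<forall>t\<in>G n. C \<in> H n p t" by auto
    then obtain p where p: "\<And>n. p n \<in> F n" "\<And>n t. t \<in> G n \<Longrightarrow> C \<in> H n (p n) t"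
      by metis
    have Cin: "closedin (top_of_set D) C" using p(2)[of _ 0] Gne[of 0] by (auto simp: H_def)
    then have Ccl: "closed C" using D closedin_closed_trans by blast
    have "\<And>n. p n \<in> K" using p(1) F(2) by blast
    then obtain l r where l: "l \<in> K" "strict_mono r" "(p \<circ> r) \<longlonglongrightarrow> l"
      using K unfolding compact_def by metis
    have "\<sigma> l t \<in> C" if t: "t \<in> J" for t
    proof -
      have "\<exists>c\<in>C. dist (\<sigma> (p n) t) c \<le> 2 / (n + 1)" for n
      proof -
        obtain u where u: "u \<in> G n" "dist u t < d n" using G(3)[OF t] by blast
        have "u \<in> J" using u G(2) by blast
        then have "dist (\<sigma> (p n) u) (\<sigma> (p n) t) < 1 / (n + 1)"
          using d(2)[of "(p n, t)" "(p n, u)" n] u t \<open>p n \<in> K\<close> by (simp add: dist_Pair_Pair add.commute)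
        moreover obtain c where "c \<in> C" "dist (\<sigma> (p n) u) c \<le> 1 / real (n + 1)"
          using p(2)[OF u(1)] by (auto simp: H_def)
        moreover have "dist (\<sigma> (p n) t) c \<le> dist (\<sigma> (p n) u) (\<sigma> (p n) t) + dist (\<sigma> (p n) u) c"
          by (metis dist_commute dist_triangle)
        ultimately have "dist (\<sigma> (p n) t) c \<le> 1 / (n + 1) + 1 / (n + 1)" by simp
        then show ?thesis using \<open>c \<in> C\<close> by (auto simp: add.commute)
      qed
      then obtain c where c: "\<And>n. c n \<in> C" "\<And>n. dist (\<sigma> (p n) t) (c n) \<le> 2 / (n + 1)" by metis
      have "continuous_on K (\<lambda>p. \<sigma> p t)"
        unfolding \<sigma>_def using t by (intro continuous_intros) (auto simp: J_def)
      then have s: "(\<lambda>n. \<sigma> (p (r n)) t) \<longlonglongrightarrow> \<sigma> l t"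
        using l \<open>\<And>n. p n \<in> K\<close> unfolding continuous_on_sequentially comp_def by auto
      have "(\<lambda>n. 2 / (real n + 1)) \<longlonglongrightarrow> 0" by real_asymp
      then have "(\<lambda>n. 2 / (real (r n) + 1)) \<longlonglongrightarrow> 0"
        using LIMSEQ_subseq_LIMSEQ[OF _ l(2)] by (force simp: comp_def)
      then have "(\<lambda>n. dist (\<sigma> (p (r n)) t) (c (r n))) \<longlonglongrightarrow> 0"
        by (rule Lim_null_comparison[rotated]) (use c(2) in \<open>auto simp: algebra_simps\<close>)
      then have *: "(\<lambda>n. dist (\<sigma> (p (r n)) t) (c (r n)) + dist (\<sigma> (p (r n)) t) (\<sigma> l t)) \<longlonglongrightarrow> 0"
        using s[THEN tendsto_dist_iff[THEN iffD1]] by (rule tendsto_add_zero)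
      have "norm (dist (c (r n)) (\<sigma> l t)) \<le> dist (\<sigma> (p (r n)) t) (c (r n)) + dist (\<sigma> (p (r n)) t) (\<sigma> l t)" for n
        using dist_triangle[of "c (r n)" "\<sigma> l t" "\<sigma> (p (r n)) t"] by (simp add: dist_commute)
      then have "(\<lambda>n. dist (c (r n)) (\<sigma> l t)) \<longlonglongrightarrow> 0"
        by (intro Lim_null_comparison[OF always_eventually *]) simp
      then have lim: "(\<lambda>n. c (r n)) \<longlonglongrightarrow> \<sigma> l t" by (rule tendsto_dist_iff[THEN iffD2])
      show ?thesis by (rule closed_sequentially[OF Ccl _ lim]) (simp add: c(1))
    qed
    then have "seg (fst l) (snd l) \<subseteq> C"
      by (auto simp: seg_eq_mix \<sigma>_def J_def)
    moreover have "fst l \<in> A" "snd l \<in> B" using l(1) by (auto simp: K_def)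
    ultimately have "crossed A B C" unfolding crossed_def by blast
    then show "C \<in> {C. closedin (top_of_set D) C \<and> crossed A B C}" using Cin by simp
  qed
  then show ?thesis using H F(1) G(1) Gne
    by (auto intro!: sets.countable_INT sets.finite_UN sets.finite_INT)
qed

lemma crossed_mono: "crossed A B C \<Longrightarrow> C \<subseteq> C' \<Longrightarrow> crossed A B C'"
  by (auto simp: crossed_def)

lemma crossed_isometry:
  assumes "isometry \<phi>"
  shows "crossed (\<phi> ` A) (\<phi> ` B) (\<phi> ` C) \<longleftrightarrow> crossed A B C"
proof -
  have "inj \<phi>" using isometry_bij[OF assms] bij_is_inj by blast
  then show ?thesis
    by (simp add: crossed_def isometry_image_seg[OF assms, symmetric] inj_image_subset_iff)
qed

context well_behaved_percolation
begin

lemma Z_closed: "\<omega> \<in> space M \<Longrightarrow> closed (Z \<omega>)"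
  using measurable_space[OF random_closed_set] by (auto simp: space_closed_sets_in)

lemma Z_event: "E \<in> sets closed_sets \<Longrightarrow> {\<omega> \<in> space M. Z \<omega> \<in> E} \<in> events"
  using measurable_sets[OF random_closed_set, of E] by (simp add: vimage_def Int_def conj_commute)

lemma crossed_closed_sets:
  "compact A \<Longrightarrow> compact B \<Longrightarrow> {C. closed C \<and> crossed A B C} \<in> sets closed_sets"
  using crossed_in_sets[of A B UNIV] by simp

definition cross :: "hyperbolic_plane set \<Rightarrow> hyperbolic_plane set \<Rightarrow> 'w set" where
  "cross A B = {\<omega> \<in> space M. crossed A B (Z \<omega>)}"

lemma cross_eq: "cross A B = {\<omega> \<in> space M. Z \<omega> \<in> {C. closed C \<and> crossed A B C}}"
  unfolding cross_def using Z_closed by auto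

lemma cross_events [measurable]: "compact A \<Longrightarrow> compact B \<Longrightarrow> cross A B \<in> events"
  unfolding cross_eq by (intro Z_event crossed_closed_sets)

lemma image_Z_measurable:
  assumes "isometry \<phi>"
  shows "(\<lambda>\<omega>. \<phi> ` Z \<omega>) \<in> measurable M closed_sets"
  unfolding closed_sets_in_def
proof (rule measurable_measure_of)
  have im: "\<phi> ` S = inv \<phi> -` S" for S
    using isometry_inv_apply[OF assms] by (auto intro: image_eqI[of _ \<phi> "inv \<phi> _"])
  have inv: "isometry (inv \<phi>)" by (rule isometry_inv[OF assms])
  show "(\<lambda>\<omega>. \<phi> ` Z \<omega>) \<in> space M \<rightarrow> {C. closedin (top_of_set UNIV) C}"
    unfolding im using Z_closed isometry_continuous[OF inv, of UNIV]
    by (auto intro: closed_vimage)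
  fix y :: "hyperbolic_plane set set" assume "y \<in> {{C. closedin (top_of_set UNIV) C \<and> C \<inter> K \<noteq> {}} |K. compact K \<and> K \<subseteq> UNIV}"
  then obtain K where K: "compact K" "y = {C. closed C \<and> C \<inter> K \<noteq> {}}" by auto
  have "closed (\<phi> ` Z \<omega>)" if "\<omega> \<in> space M" for \<omega>
    unfolding im using Z_closed[OF that] isometry_continuous[OF inv, of UNIV] by (auto intro: closed_vimage)
  moreover have "\<phi> ` S \<inter> K \<noteq> {} \<longleftrightarrow> S \<inter> inv \<phi> ` K \<noteq> {}" for S
    unfolding im using isometry_inv_apply[OF assms] by force
  ultimately have "(\<lambda>\<omega>. \<phi> ` Z \<omega>) -` y \<inter> space M
     = {\<omega> \<in> space M. Z \<omega> \<in> {C. closedin (top_of_set UNIV) C \<and> C \<inter> inv \<phi> ` K \<noteq> {}}}"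
    unfolding K(2) using Z_closed by auto
  also have "\<dots> \<in> events"
    by (intro Z_event hits_in_sets compact_continuous_image isometry_continuous inv K) auto
  finally show "(\<lambda>\<omega>. \<phi> ` Z \<omega>) -` y \<inter> space M \<in> events" .
qed auto

lemma prob_isometry:
  assumes "isometry \<phi>" "E \<in> sets closed_sets"
  shows "prob {\<omega> \<in> space M. \<phi> ` Z \<omega> \<in> E} = prob {\<omega> \<in> space M. Z \<omega> \<in> E}"
proof -
  have "measure (distr M closed_sets (\<lambda>\<omega>. \<phi> ` Z \<omega>)) E = measure (distr M closed_sets Z) E"
    by (simp add: invariance[OF assms(1)])
  then show ?thesis
    by (simp add: measure_distr image_Z_measurable[OF assms(1)] random_closed_set assms(2)
        vimage_def Int_def conj_commute)
qed

lemma prob_cross_isometry: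
  assumes "isometry \<phi>" "compact A" "compact B"
  shows "prob (cross (\<phi> ` A) (\<phi> ` B)) = prob (cross A B)"
proof -
  have c: "compact (\<phi> ` A)" "compact (\<phi> ` B)"
    using assms by (auto intro!: compact_continuous_image isometry_continuous)
  have "closed (\<phi> ` Z \<omega>)" if "\<omega> \<in> space M" for \<omega>
    using measurable_space[OF image_Z_measurable[OF assms(1)] that] by (simp add: space_closed_sets_in)
  then have "cross A B = {\<omega> \<in> space M. \<phi> ` Z \<omega> \<in> {C. closed C \<and> crossed (\<phi> ` A) (\<phi> ` B) C}}"
    unfolding cross_def using crossed_isometry[OF assms(1)] by auto
  then show ?thesis
    using prob_isometry[OF assms(1) crossed_closed_sets[OF c]] by (simp add: cross_eq)
qed

lemma positive_correlation_events:
  assumes E: "E \<in> sets closed_sets" "\<And>C C'. C \<in> E \<Longrightarrow> closed C' \<Longrightarrow> C \<subseteq> C' \<Longrightarrow> C' \<in> E"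
    and F: "F \<in> sets closed_sets" "\<And>C C'. C \<in> F \<Longrightarrow> closed C' \<Longrightarrow> C \<subseteq> C' \<Longrightarrow> C' \<in> F"
  shows "prob {\<omega> \<in> space M. Z \<omega> \<in> E} * prob {\<omega> \<in> space M. Z \<omega> \<in> F}
    \<le> prob {\<omega> \<in> space M. Z \<omega> \<in> E \<and> Z \<omega> \<in> F}"
proof -
  have ind: "expectation (\<lambda>\<omega>. indicat_real E' (Z \<omega>)) = prob {\<omega> \<in> space M. Z \<omega> \<in> E'}" if "E' \<in> sets closed_sets" for E'
  proof -
    have "expectation (\<lambda>\<omega>. indicat_real E' (Z \<omega>)) = expectation (indicat_real {\<omega> \<in> space M. Z \<omega> \<in> E'})"
      by (rule Bochner_Integration.integral_cong) (auto simp: indicator_def)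
    then show ?thesis using Z_event[OF that] by simp
  qed
  have "expectation (\<lambda>\<omega>. indicat_real E (Z \<omega>) * indicat_real F (Z \<omega>))
      \<ge> expectation (\<lambda>\<omega>. indicat_real E (Z \<omega>)) * expectation (\<lambda>\<omega>. indicat_real F (Z \<omega>))"
  proof (rule positive_correlations)
    show "indicat_real E \<in> borel_measurable closed_sets" "indicat_real F \<in> borel_measurable closed_sets"
      using E(1) F(1) by auto
    show "bounded (indicat_real E ` {C. closed C})" "bounded (indicat_real F ` {C. closed C})"
      by (auto intro!: boundedI[of _ 1] simp: indicator_def)
    show "mono_on {C. closed C} (indicat_real E)" "mono_on {C. closed C} (indicat_real F)"
      using E(2) F(2) by (auto intro!: mono_onI simp: indicator_def)
  qed
  moreover have "indicat_real E (Z \<omega>) * indicat_real F (Z \<omega>) = indicat_real (E \<inter> F) (Z \<omega>)" for \<omega>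
    by (simp add: indicator_def)
  ultimately show ?thesis using ind[OF E(1)] ind[OF F(1)] ind[of "E \<inter> F"] E(1) F(1)
    by (simp add: sets.Int)
qed

lemma prob_cross_Int:
  assumes "compact A" "compact B" "compact A'" "compact B'"
  shows "prob (cross A B) * prob (cross A' B') \<le> prob (cross A B \<inter> cross A' B')"
proof -
  have "cross A B \<inter> cross A' B' = {\<omega> \<in> space M. Z \<omega> \<in> {C. closed C \<and> crossed A B C} \<and>
      Z \<omega> \<in> {C. closed C \<and> crossed A' B' C}}"
    unfolding cross_eq by auto
  then show ?thesis unfolding cross_eq
    using positive_correlation_events[OF crossed_closed_sets[OF assms(1,2)] _ crossed_closed_sets[OF assms(3,4)]]
    by (auto intro: crossed_mono)
qed

text \<open>
  Complements of positively correlated events are positively correlated. Induction is possible since the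
  union of crossing events is again increasing.
\<close>

lemma prob_no_cross_ge:
  assumes "finite I" "\<And>i. i \<in> I \<Longrightarrow> compact (A i) \<and> compact (B i)"
    and "\<And>i. i \<in> I \<Longrightarrow> prob (cross (A i) (B i)) \<le> p" "0 \<le> p" "p \<le> 1"
  shows "(1 - p) ^ card I \<le> prob {\<omega> \<in> space M. \<forall>i\<in>I. \<not> crossed (A i) (B i) (Z \<omega>)}"
  using assms(1-3)
proof (induction I rule: finite_induct)
  case empty
  then show ?case by (simp add: prob_space)
next
  case (insert j I)
  define E where "E = {C. closed C \<and> crossed (A j) (B j) C}"
  define F where "F = (\<Union>i\<in>I. {C. closed C \<and> crossed (A i) (B i) C})"
  have E: "E \<in> sets closed_sets" and F: "F \<in> sets closed_sets"
    unfolding E_def F_def using insert by (auto intro!: crossed_closed_sets)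
  define P where "P = {\<omega> \<in> space M. Z \<omega> \<in> E}"
  define Q where "Q = {\<omega> \<in> space M. Z \<omega> \<in> F}"
  have PQ: "P \<in> events" "Q \<in> events" unfolding P_def Q_def using Z_event E F by auto
  have "prob P * prob Q \<le> prob {\<omega> \<in> space M. Z \<omega> \<in> E \<and> Z \<omega> \<in> F}"
    unfolding P_def Q_def
    by (rule positive_correlation_events[OF E _ F]) (auto simp: E_def F_def intro: crossed_mono)
  then have "prob P * prob Q \<le> prob (P \<inter> Q)" by (simp add: P_def Q_def Int_def conj_ac)
  then have le: "(1 - prob P) * (1 - prob Q) \<le> 1 - (prob P + prob Q - prob (P \<inter> Q))"
    by (simp add: algebra_simps)
  moreover have "prob (P \<union> Q) = prob P + prob Q - prob (P \<inter> Q)"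
    using PQ finite_measure_Union'[of P Q] finite_measure_Diff'[of Q P] by (simp add: Int_commute)
  moreover have "prob (space M - (P \<union> Q)) = 1 - prob (P \<union> Q)" "prob (space M - Q) = 1 - prob Q"
    using PQ by (auto simp: prob_compl)
  ultimately have *: "(1 - prob P) * prob (space M - Q) \<le> prob (space M - (P \<union> Q))"
    using le by simp
  have Pp: "prob P \<le> p"
    using insert.prems(2)[of j] by (simp add: P_def E_def cross_eq)
  have Q: "space M - Q = {\<omega> \<in> space M. \<forall>i\<in>I. \<not> crossed (A i) (B i) (Z \<omega>)}"
    unfolding Q_def F_def using Z_closed by auto
  have PQ': "space M - (P \<union> Q) = {\<omega> \<in> space M. \<forall>i\<in>insert j I. \<not> crossed (A i) (B i) (Z \<omega>)}"
    unfolding P_def E_def Q_def F_def using Z_closed by auto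
  have "(1 - p) ^ card (insert j I) = (1 - p) * (1 - p) ^ card I" using insert by simp
  also have "\<dots> \<le> (1 - prob P) * prob (space M - Q)"
    unfolding Q using insert Pp assms(4,5) by (intro mult_mono) (auto simp: zero_le_power)
  finally show ?case using * PQ' by simp
qed

lemma independent_regions:
  obtains R where "R \<ge> 1"
    "\<And>D D' F F'. (\<And>a a'. a \<in> D \<Longrightarrow> a' \<in> D' \<Longrightarrow> R \<le> dist a a') \<Longrightarrow>
      F \<in> sets (closed_sets_in D) \<Longrightarrow> F' \<in> sets (closed_sets_in D') \<Longrightarrow>
      prob {\<omega> \<in> space M. Z \<omega> \<inter> D \<in> F \<and> Z \<omega> \<inter> D' \<in> F'}
        = prob {\<omega> \<in> space M. Z \<omega> \<inter> D \<in> F} * prob {\<omega> \<in> space M. Z \<omega> \<inter> D' \<in> F'}"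
proof -
  obtain R0 :: real where R0: "\<And>A A'. (\<forall>a\<in>A. \<forall>a'\<in>A'. R0 \<le> dist a a') \<Longrightarrow>
       indep_var (closed_sets_in A) (\<lambda>\<omega>. Z \<omega> \<inter> A) (closed_sets_in A') (\<lambda>\<omega>. Z \<omega> \<inter> A')"
    using independence_at_distance by blast
  show thesis
  proof (rule that[of "max R0 1"])
    fix D D' :: "hyperbolic_plane set" and F F'
    assume "\<And>a a'. a \<in> D \<Longrightarrow> a' \<in> D' \<Longrightarrow> max R0 1 \<le> dist a a'"
      and F: "F \<in> sets (closed_sets_in D)" "F' \<in> sets (closed_sets_in D')"
    then have "indep_var (closed_sets_in D) (\<lambda>\<omega>. Z \<omega> \<inter> D) (closed_sets_in D') (\<lambda>\<omega>. Z \<omega> \<inter> D')"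
      by (intro R0) auto
    from indep_varD[OF this F]
    show "prob {\<omega> \<in> space M. Z \<omega> \<inter> D \<in> F \<and> Z \<omega> \<inter> D' \<in> F'}
        = prob {\<omega> \<in> space M. Z \<omega> \<inter> D \<in> F} * prob {\<omega> \<in> space M. Z \<omega> \<inter> D' \<in> F'}"
      by (simp add: vimage_def Int_def conj_ac)
  qed simp
qed

end

section \<open>A covered segment close to an uncovered one\<close>

text \<open>
  Coordinates of the Klein model, the central projection of the hyperboloid, in which hyperbolic segments are
  Euclidean ones.
\<close>

definition klein_x :: "hyperbolic_plane \<Rightarrow> real" where "klein_x p = hx p / ht p"
definition klein_y :: "hyperbolic_plane \<Rightarrow> real" where "klein_y p = hy p / ht p"

lemma continuous_on_klein: "continuous_on S klein_x" "continuous_on S klein_y"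
  unfolding klein_x_def klein_y_def using ht_pos by (auto intro!: continuous_intros simp: less_imp_neq[symmetric])

lemma klein_mem_seg:
  assumes "0 \<le> t" "t \<le> 1" "klein_x p = (1 - t) * klein_x x + t * klein_x y" "klein_y p = (1 - t) * klein_y x + t * klein_y y"
  shows "p \<in> seg x y"
proof (rule seg_combI)
  define \<alpha> where "\<alpha> = ht p * (1 - t) / ht x"
  define \<beta> where "\<beta> = ht p * t / ht y"
  have pos: "ht p > 0" "ht x > 0" "ht y > 0" by (rule ht_pos)+
  show "\<alpha> \<ge> 0" "\<beta> \<ge> 0" using assms(1,2) pos by (auto simp: \<alpha>_def \<beta>_def)
  have "\<alpha> * ht x = ht p * (1 - t)" "\<beta> * ht y = ht p * t" using pos by (simp_all add: \<alpha>_def \<beta>_def)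
  then show "ht p = \<alpha> * ht x + \<beta> * ht y" by (simp add: algebra_simps)
  have "hx p = ht p * klein_x p" "hy p = ht p * klein_y p" using pos by (simp_all add: klein_x_def klein_y_def)
  then show "hx p = \<alpha> * hx x + \<beta> * hx y" "hy p = \<alpha> * hy x + \<beta> * hy y"
    unfolding assms(3,4) by (simp_all add: \<alpha>_def \<beta>_def klein_x_def klein_y_def algebra_simps)
qed

text \<open>
  The separation argument behind the near-miss estimate. The segment is a straight line over the strip
  between its ends and stays between the heights \<open>l\<close> and \<open>u\<close>; a connected set in that strip which avoids it
  lies above or below it.
\<close>

lemma connected_one_sided:
  assumes U: "connected U" and between: "\<And>p. p \<in> U \<Longrightarrow> klein_x x < klein_x p \<and> klein_x p < klein_x y"
    and disj: "U \<inter> seg x y = {}"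
    and ends: "l \<le> klein_y x" "klein_y x \<le> u" "l \<le> klein_y y" "klein_y y \<le> u"
  shows "(\<forall>p\<in>U. klein_y p \<le> u) \<or> (\<forall>p\<in>U. l \<le> klein_y p)"
proof (rule ccontr)
  assume "\<not> ?thesis"
  then obtain p q where p: "p \<in> U" "klein_y p > u" and q: "q \<in> U" "klein_y q < l" by auto
  define t where "t z = (klein_x z - klein_x x) / (klein_x y - klein_x x)" for z
  define g where "g z = klein_y z - ((1 - t z) * klein_y x + t z * klein_y y)" for z
  have xy: "klein_x x < klein_x y" using between[OF p(1)] by simp
  have t: "0 \<le> t z" "t z \<le> 1" if "z \<in> U" for z
    using between[OF that] by (auto simp: t_def)
  have conv: "l \<le> (1 - t z) * klein_y x + t z * klein_y y \<and> (1 - t z) * klein_y x + t z * klein_y y \<le> u" if "z \<in> U" for z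
  proof
    have "(1 - t z) * l + t z * l \<le> (1 - t z) * klein_y x + t z * klein_y y"
      using t[OF that] ends by (intro add_mono mult_left_mono) auto
    then show "l \<le> (1 - t z) * klein_y x + t z * klein_y y" by (simp add: algebra_simps)
    have "(1 - t z) * klein_y x + t z * klein_y y \<le> (1 - t z) * u + t z * u"
      using t[OF that] ends by (intro add_mono mult_left_mono) auto
    then show "(1 - t z) * klein_y x + t z * klein_y y \<le> u" by (simp add: algebra_simps)
  qed
  have "g p > 0" "g q < 0" unfolding g_def using conv[OF p(1)] conv[OF q(1)] p q by auto
  moreover have "continuous_on U g"
    unfolding g_def t_def using xy by (intro continuous_intros continuous_on_klein) auto
  then have "connected (g ` U)" using U by (rule connected_continuous_image)
  ultimately have "0 \<in> g ` U"
    using p(1) q(1) connectedD_interval[of "g ` U" "g q" "g p" 0] by auto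
  then obtain z where z: "z \<in> U" "g z = 0" by auto
  have "klein_x x + t z * (klein_x y - klein_x x) = klein_x z"
    using xy by (simp add: t_def)
  then have "klein_x z = (1 - t z) * klein_x x + t z * klein_x y" by (simp add: algebra_simps)
  then have "z \<in> seg x y"
    using z t[OF z(1)] by (intro klein_mem_seg[of "t z"]) (auto simp: g_def)
  then show False using z disj by auto
qed

text \<open>
  The point at signed distance \<open>v\<close> from the base line whose foot on that line is \<open>base_pt u\<close>.
\<close>

definition side_pt :: "real \<Rightarrow> real \<Rightarrow> hyperbolic_plane" where
  "side_pt u v = hpoint (cosh v * sinh u) (sinh v)"

definition gate :: "real \<Rightarrow> real \<Rightarrow> hyperbolic_plane set" where
  "gate u w = side_pt u ` {-w..w}"

lemma side_pt_coords [simp]: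
  "hx (side_pt u v) = cosh v * sinh u" "hy (side_pt u v) = sinh v" "ht (side_pt u v) = cosh v * cosh u"
proof -
  show "hx (side_pt u v) = cosh v * sinh u" "hy (side_pt u v) = sinh v"
    by (simp_all add: side_pt_def)
  have "(cosh v * cosh u)\<^sup>2 - (cosh v * sinh u)\<^sup>2 - (sinh v)\<^sup>2 = (cosh v)\<^sup>2 * ((cosh u)\<^sup>2 - (sinh u)\<^sup>2) - (sinh v)\<^sup>2"
    by (simp add: power2_eq_square algebra_simps)
  also have "\<dots> = 1" by (simp add: hyperbolic_pythagoras)
  finally show "ht (side_pt u v) = cosh v * cosh u"
    unfolding side_pt_def by (intro hpoint_ht) auto
qed

lemma compact_gate: "compact (gate u w)"
  unfolding gate_def side_pt_def
  by (intro compact_continuous_image continuous_intros compact_Icc)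

text \<open>
  \<open>artanh klein_y\<close> is the position of the foot of a point on the line perpendicular to the axis at the
  origin, and a translation along that line adds to it. On a gate this position is at most \<open>w\<close>
  in absolute value.
\<close>

lemma klein_y_lift_gate:
  assumes "p \<in> gate u w" "0 \<le> w"
  shows "tanh (h - w) \<le> klein_y (lift h p)" "klein_y (lift h p) \<le> tanh (h + w)"
proof -
  obtain v where "v \<in> {-w..w}" and v2: "p = side_pt u v" using assms by (auto simp: gate_def)
  then have v: "\<bar>v\<bar> \<le> w" "p = side_pt u v" by (auto simp: abs_le_iff)
  define k where "k = klein_y p"
  have "\<bar>k\<bar> = \<bar>tanh v\<bar> / cosh u" by (simp add: k_def klein_y_def v tanh_def abs_mult)
  also have "\<dots> \<le> \<bar>tanh v\<bar> / 1" by (intro divide_left_mono) (auto simp: cosh_real_ge_1)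
  also have "\<bar>tanh v\<bar> / 1 = tanh \<bar>v\<bar>" by (simp add: tanh_real_abs)
  also have "\<dots> \<le> tanh w" using v(1) by (simp only: tanh_real_le_iff)
  finally have k: "\<bar>k\<bar> \<le> tanh w" .
  have k1: "\<bar>k\<bar> < 1" using k tanh_real_lt_1[of w] by linarith
  have e: "klein_y (lift h p) = (sinh h + k * cosh h) / (cosh h + k * sinh h)"
    unfolding klein_y_def k_def lift_coords using ht_pos[of p]
    by (simp add: divide_simps) (simp add: algebra_simps)
  have pos: "cosh h + k * sinh h > 0"
    using cosh_sinh_combination_pos[of k 1 h] k1 by simp
  have mono: "(sinh h + a * cosh h) / (cosh h + a * sinh h) \<le> (sinh h + b * cosh h) / (cosh h + b * sinh h)"
    if "a \<le> b" "\<bar>a\<bar> < 1" "\<bar>b\<bar> < 1" for a b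
  proof -
    have p: "cosh h + a * sinh h > 0" "cosh h + b * sinh h > 0"
      using cosh_sinh_combination_pos[of a 1 h] cosh_sinh_combination_pos[of b 1 h] that by simp_all
    have "(sinh h + b * cosh h) * (cosh h + a * sinh h) - (sinh h + a * cosh h) * (cosh h + b * sinh h)
        = (b - a) * ((cosh h)\<^sup>2 - (sinh h)\<^sup>2)"
      by (simp add: power2_eq_square algebra_simps)
    also have "\<dots> \<ge> 0" using that hyperbolic_pythagoras[of h] by simp
    finally show ?thesis using p by (simp add: divide_simps mult.commute)
  qed
  have th: "(sinh h + tanh c * cosh h) / (cosh h + tanh c * sinh h) = tanh (h + c)" for c
    unfolding tanh_def sinh_add cosh_add by (simp add: divide_simps)  (simp add: algebra_simps)
  have w1: "\<bar>tanh w\<bar> < 1" "\<bar>tanh (- w)\<bar> < 1" using tanh_real_abs[of w] tanh_real_lt_1[of "\<bar>w\<bar>"] by auto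
  show "klein_y (lift h p) \<le> tanh (h + w)"
    unfolding e th[symmetric] using k k1 w1 by (intro mono) auto
  show "tanh (h - w) \<le> klein_y (lift h p)"
    unfolding e using mono[of "tanh (- w)" k] th[of "- w"] k k1 w1 by auto
qed

lemma tanh_1_le: "tanh 1 \<le> (4/5 :: real)"
proof -
  have "exp 1 * exp 1 \<le> 3 * (3::real)" by (intro mult_mono exp_le) auto
  moreover have "0 < exp 1 * (exp 1 :: real)" by simp
  ultimately have "exp 1 * exp 1 \<le> (9 :: real)" "0 < exp 1 * exp 1 + (1 :: real)" by linarith+
  then show ?thesis by (simp add: tanh_altdef divide_simps exp_minus)
qed

lemma tanh_3_ge: "(19/20 :: real) \<le> tanh 3"
proof -
  have "2 ^ 6 \<le> (exp 1 :: real) ^ 6"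
    using exp_ge_add_one_self[of 1] by (intro power_mono) auto
  also have "\<dots> = exp 3 * exp 3"
    by (simp add: exp_of_nat_mult[symmetric] exp_add[symmetric] del: exp_of_nat_mult)
  finally have "64 \<le> exp 3 * (exp 3 :: real)" by simp
  moreover from this have "0 < exp 3 * exp 3 + (1 :: real)" by linarith
  ultimately show ?thesis by (simp add: tanh_altdef divide_simps exp_minus)
qed

text \<open>
  With the next lemma: the gates at distance \<open>3\<close>, even after a translation by up to \<open>1/8\<close>,
  lie on the two sides of the unit ball, so every segment from gate to gate crosses the whole ball.
\<close>

lemma klein_x_unit_ball:
  assumes "p \<in> cball (base_pt 0) 1" shows "\<bar>klein_x p\<bar> \<le> 4/5"
proof -
  have "ht p \<le> cosh 1"
    using assms cosh_dist_le_iff[of 1 "base_pt 0" p] by (simp add: lorentz_def)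
  have "(hx p)\<^sup>2 \<le> (ht p)\<^sup>2 - 1" using lorentz_self[of p] by (smt (verit) zero_le_power2)
  then have "(klein_x p)\<^sup>2 \<le> ((ht p)\<^sup>2 - 1) / (ht p)\<^sup>2"
    unfolding klein_x_def power_divide by (intro divide_right_mono) auto
  also have "\<dots> = 1 - 1 / (ht p)\<^sup>2" using ht_pos[of p] by (simp add: field_simps)
  also have "\<dots> \<le> 1 - 1 / (cosh 1)\<^sup>2"
    using \<open>ht p \<le> cosh 1\<close> ht_pos[of p] by (intro diff_left_mono divide_left_mono power_mono) auto
  also have "\<dots> = ((cosh 1)\<^sup>2 - 1) / (cosh (1::real))\<^sup>2" by (simp add: field_simps)
  also have "\<dots> = (tanh 1)\<^sup>2" by (simp add: tanh_def power_divide sinh_square_eq)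
  also have "\<dots> \<le> (4/5)\<^sup>2" using tanh_1_le by (intro power_mono) auto
  finally show ?thesis by (simp add: abs_le_square_iff[symmetric])
qed

lemma klein_x_lift_gate:
  assumes "p \<in> gate u w" "0 \<le> h" "h \<le> 1/8"
  shows "\<bar>u\<bar> = 3 \<Longrightarrow> \<bar>klein_x (lift h p)\<bar> > 4/5" "klein_x (lift h p) * u \<ge> 0"
proof -
  obtain v where v: "p = side_pt u v" using assms by (auto simp: gate_def)
  define d where "d = cosh h + klein_y p * sinh h"
  have k: "\<bar>klein_y p\<bar> \<le> 1" unfolding klein_y_def using abs_hy_le_ht[of p] ht_pos[of p] by simp
  have "ht p * d = ht (lift h p)" using ht_pos[of p] by (simp add: d_def klein_y_def algebra_simps)
  then have d0: "d > 0" using ht_pos[of p] ht_pos[of "lift h p"] by (metis zero_less_mult_pos)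
  have "klein_y p * sinh h \<le> 1 * sinh h" using k assms by (intro mult_right_mono) auto
  then have "d \<le> exp h" by (simp add: d_def cosh_plus_sinh[symmetric])
  also have "\<dots> \<le> exp (1/8)" using assms by simp
  finally have d: "d \<le> exp (1/8)" .
  have klein_x: "klein_x (lift h p) = tanh u / d"
    unfolding klein_x_def \<open>ht p * d = ht (lift h p)\<close>[symmetric] by (simp add: v tanh_def)
  show "klein_x (lift h p) * u \<ge> 0"
    unfolding klein_x using d0 by (cases "u \<ge> 0") (auto simp: mult_nonpos_nonpos divide_nonpos_pos)
  assume "\<bar>u\<bar> = 3"
  then have "\<bar>klein_x (lift h p)\<bar> = tanh 3 / d"
    unfolding klein_x using d0 by (simp add: abs_divide tanh_real_abs[symmetric])
  also have "tanh 3 / d \<ge> (19/20) / exp (1/8)"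
    using tanh_3_ge d d0 by (intro frac_le) auto
  also have "(19/20) / exp (1/8) = (19/20) * exp (- (1/8::real))" by (simp add: exp_minus field_simps)
  also have "\<dots> \<ge> (19/20) * (7/8)" using exp_ge_add_one_self[of "-(1/8::real)"] by simp
  finally show "\<bar>klein_x (lift h p)\<bar> > 4/5" by simp
qed

text \<open>
  The gates are at distance \<open>3\<close> from the centre of the frame \<open>\<phi>\<close>, so that the covered segment crosses a whole
  unit ball, while the uncovered piece of the axis lies well inside that ball.
\<close>

definition near_miss :: "(hyperbolic_plane \<Rightarrow> hyperbolic_plane) \<Rightarrow> real \<Rightarrow> hyperbolic_plane set \<Rightarrow> bool" where
  "near_miss \<phi> w C \<longleftrightarrow> crossed (\<phi> ` gate (-3) w) (\<phi> ` gate 3 w) C \<and>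
     \<not> crossed {\<phi> (base_pt (-1/2))} {\<phi> (base_pt (1/2))} C"

lemma compact_frame_gate: "isometry \<phi> \<Longrightarrow> compact (\<phi> ` gate u w)"
  by (intro compact_continuous_image isometry_continuous compact_gate)

lemma near_miss_comp_isometry:
  assumes "isometry \<phi>"
  shows "near_miss (\<phi> \<circ> \<psi>) w (\<phi> ` C) \<longleftrightarrow> near_miss \<psi> w C"
  using crossed_isometry[OF assms, of "\<psi> ` gate (-3) w" "\<psi> ` gate 3 w" C]
    crossed_isometry[OF assms, of "{\<psi> (base_pt (-1/2))}" "{\<psi> (base_pt (1/2))}" C]
  by (simp add: near_miss_def image_comp)

text \<open>
  The component of an uncovered point of the axis cannot cross the covered segment, so it does not reach
  height \<open>w\<close> on both sides of the axis. The translation by at most \<open>1/8\<close> and the axis piece of length \<open>1\<close>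
  keep this point inside the unit ball.
\<close>

lemma near_miss_component:
  assumes \<Phi>: "isometry \<Phi>" "\<Phi> (base_pt 0) = b" and w: "0 \<le> w" and h: "0 \<le> h" "h \<le> 1/8"
    and near_miss: "near_miss (\<Phi> \<circ> lift h) w C"
  obtains U p where "U \<in> components (cball b 1 - C)" "p \<in> U" "klein_y (inv \<Phi> p) = tanh h"
    "(\<forall>p\<in>U. klein_y (inv \<Phi> p) \<le> tanh (h + w)) \<or> (\<forall>p\<in>U. tanh (h - w) \<le> klein_y (inv \<Phi> p))"
proof -
  note l = isometry_lift[of h]
  obtain x y where x: "x \<in> gate (-3) w" and y: "y \<in> gate 3 w"
    and xy: "seg (\<Phi> (lift h x)) (\<Phi> (lift h y)) \<subseteq> C"
    using near_miss by (auto simp: near_miss_def crossed_def)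
  have "\<not> seg (\<Phi> (lift h (base_pt (-1/2)))) (\<Phi> (lift h (base_pt (1/2)))) \<subseteq> C"
    using near_miss by (simp add: near_miss_def crossed_def)
  then have "\<not> \<Phi> ` lift h ` base_pt ` {-1/2..1/2} \<subseteq> C"
    by (simp add: isometry_image_seg[OF \<Phi>(1), symmetric] isometry_image_seg[OF l, symmetric] seg_base_pt)
  then obtain q where "q \<in> \<Phi> ` lift h ` base_pt ` {-1/2..1/2}" "q \<notin> C" unfolding subset_iff by blast
  then obtain t where "t \<in> {-1/2..1/2}" and t2: "\<Phi> (lift h (base_pt t)) \<notin> C" by blast
  then have t: "\<bar>t\<bar> \<le> 1/2" "\<Phi> (lift h (base_pt t)) \<notin> C" by (auto simp: abs_le_iff)
  define p where "p = \<Phi> (lift h (base_pt t))"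
  have ip: "inv \<Phi> p = lift h (base_pt t)" by (simp add: p_def \<Phi>(1))
  have "cosh (dist (base_pt 0) (lift h (base_pt 0))) = cosh h" by (simp add: cosh_dist lorentz_def)
  then have "dist (base_pt 0) (lift h (base_pt 0)) = h" by (rule cosh_real_inj) (use h in auto)
  moreover have "dist (lift h (base_pt 0)) (lift h (base_pt t)) = \<bar>t\<bar>"
    by (simp add: isometry_dist[OF l] dist_base_pt)
  ultimately have "dist (base_pt 0) (lift h (base_pt t)) \<le> 1"
    using dist_triangle[of "base_pt 0" "lift h (base_pt t)" "lift h (base_pt 0)"] t h by simp
  then have pb: "p \<in> cball b 1 - C"
    using t(2) isometry_dist[OF \<Phi>(1), of "base_pt 0" "lift h (base_pt t)"] by (simp add: p_def \<Phi>(2))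
  define U where "U = connected_component_set (cball b 1 - C) p"
  have U: "U \<in> components (cball b 1 - C)" "p \<in> U"
    using pb by (auto simp: U_def components_def)
  have Usub: "U \<subseteq> cball b 1 - C" by (simp add: U_def connected_component_subset)
  define V where "V = inv \<Phi> ` U"
  have V: "connected V"
    unfolding V_def U_def
    by (intro connected_continuous_image isometry_continuous isometry_inv \<Phi> connected_connected_component)
  have VD: "V \<subseteq> cball (base_pt 0) 1"
    using Usub isometry_image_cball[OF isometry_inv[OF \<Phi>(1)], of b 1] \<Phi>
    unfolding V_def by (metis Diff_subset image_mono isometry_inv_apply(1) subset_trans)
  have "(\<forall>p\<in>V. klein_y p \<le> tanh (h + w)) \<or> (\<forall>p\<in>V. tanh (h - w) \<le> klein_y p)"
  proof (rule connected_one_sided[OF V])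
    show "klein_x (lift h x) < klein_x p \<and> klein_x p < klein_x (lift h y)" if "p \<in> V" for p
      using klein_x_unit_ball[of p] VD that klein_x_lift_gate[OF x h] klein_x_lift_gate[OF y h] by force
    show "V \<inter> seg (lift h x) (lift h y) = {}"
    proof (rule ccontr)
      assume "V \<inter> seg (lift h x) (lift h y) \<noteq> {}"
      then obtain q where q: "q \<in> U" "inv \<Phi> q \<in> seg (lift h x) (lift h y)" by (auto simp: V_def)
      then have "q \<in> \<Phi> ` seg (lift h x) (lift h y)" using \<Phi>(1) by (metis image_eqI isometry_inv_apply(2))
      then have "q \<in> C" using xy by (auto simp: isometry_image_seg[OF \<Phi>(1)])
      then show False using q(1) Usub by auto
    qed
  qed (use klein_y_lift_gate[OF x w] klein_y_lift_gate[OF y w] in auto)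
  then show thesis
    using that[OF U] ip by (auto simp: V_def klein_y_def tanh_def)
qed

text \<open>
  Each near miss is charged to a component and to the side on which the component stays within \<open>w\<close>. Axes
  that are \<open>2 w\<close> apart cannot charge the same component on the same side: it meets both
  axes, so its height varies by more than \<open>w\<close> upwards from the lower and downwards from the upper one.
\<close>

lemma near_misses_le_components:
  assumes \<Phi>: "isometry \<Phi>" "\<Phi> (base_pt 0) = b" and w: "0 < w" "\<And>j. j < N \<Longrightarrow> 2 * real j * w \<le> 1/8"
  shows "ennreal (card {j\<in>{..<N}. near_miss (\<Phi> \<circ> lift (2 * real j * w)) w C})
     \<le> 2 * emeasure (count_space UNIV) (components (cball b 1 - C))"
proof -
  define h where "h j = 2 * real j * w" for j :: nat
  define J where "J = {j\<in>{..<N}. near_miss (\<Phi> \<circ> lift (h j)) w C}"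
  define good where "good j Us p \<longleftrightarrow> fst Us \<in> components (cball b 1 - C) \<and> p \<in> fst Us \<and> klein_y (inv \<Phi> p) = tanh (h j) \<and>
     (if snd Us then (\<forall>p\<in>fst Us. klein_y (inv \<Phi> p) \<le> tanh (h j + w)) else (\<forall>p\<in>fst Us. tanh (h j - w) \<le> klein_y (inv \<Phi> p)))"
    for j and Us :: "hyperbolic_plane set \<times> bool" and p
  have "\<exists>Us p. good j Us p" if "j \<in> J" for j
  proof -
    have j: "near_miss (\<Phi> \<circ> lift (h j)) w C" "0 \<le> h j" "h j \<le> 1/8"
      using w that by (auto simp: J_def h_def)
    obtain U p where U: "U \<in> components (cball b 1 - C)" "p \<in> U" "klein_y (inv \<Phi> p) = tanh (h j)"
      "(\<forall>p\<in>U. klein_y (inv \<Phi> p) \<le> tanh (h j + w)) \<or> (\<forall>p\<in>U. tanh (h j - w) \<le> klein_y (inv \<Phi> p))"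
      using near_miss_component[OF \<Phi> _ j(2,3,1)] w by auto
    then have "good j (U, \<forall>p\<in>U. klein_y (inv \<Phi> p) \<le> tanh (h j + w)) p"
      unfolding good_def by auto
    then show ?thesis by blast
  qed
  then obtain f p where "\<And>j. j \<in> J \<Longrightarrow> good j (f j) (p j)" by metis
  then have f: "\<And>j. j \<in> J \<Longrightarrow> fst (f j) \<in> components (cball b 1 - C)"
    "\<And>j. j \<in> J \<Longrightarrow> p j \<in> fst (f j)" "\<And>j. j \<in> J \<Longrightarrow> klein_y (inv \<Phi> (p j)) = tanh (h j)"
    "\<And>j. j \<in> J \<Longrightarrow> if snd (f j) then (\<forall>p\<in>fst (f j). klein_y (inv \<Phi> p) \<le> tanh (h j + w))
        else (\<forall>p\<in>fst (f j). tanh (h j - w) \<le> klein_y (inv \<Phi> p))"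
    unfolding good_def by blast+
  have "inj_on f J"
  proof (rule linorder_inj_onI)
    fix i j assume ij: "i < j" "i \<in> J" "j \<in> J"
    have "1 + real i \<le> real j" using ij(1) by linarith
    then have "2 * w * (1 + real i) \<le> 2 * w * real j" using w(1) by (intro mult_left_mono) auto
    then have "h i + 2 * w \<le> h j" by (simp add: h_def algebra_simps)
    then have lt: "tanh (h i + w) < tanh (h j)" "tanh (h i) < tanh (h j - w)" using w by auto
    show "f i \<noteq> f j"
    proof
      assume e: "f i = f j"
      show False
      proof (cases "snd (f i)")
        case True
        then have "klein_y (inv \<Phi> (p j)) \<le> tanh (h i + w)" using f(4)[OF ij(2)] f(2)[OF ij(3)] e by auto
        then show False using f(3)[OF ij(3)] lt by simp
      next
        case False
        then have "tanh (h j - w) \<le> klein_y (inv \<Phi> (p i))" using f(4)[OF ij(3)] f(2)[OF ij(2)] e by auto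
        then show False using f(3)[OF ij(2)] lt by simp
      qed
    qed
  qed auto
  have "ennreal (card J) \<le> 2 * emeasure (count_space UNIV) (components (cball b 1 - C))"
  proof (cases "finite (components (cball b 1 - C))")
    case True
    have "f ` J \<subseteq> components (cball b 1 - C) \<times> UNIV"
      using f(1) by (simp add: image_subset_iff mem_Times_iff)
    then have "card J \<le> card (components (cball b 1 - C) \<times> (UNIV :: bool set))"
      using \<open>inj_on f J\<close> True by (intro card_inj_on_le) auto
    then have "real (card J) \<le> 2 * real (card (components (cball b 1 - C)))"
      by (simp add: card_cartesian_product)
    then have "ennreal (card J) \<le> ennreal (2 * real (card (components (cball b 1 - C))))"
      by (rule ennreal_leI)
    then show ?thesis using True by (simp add: ennreal_mult ennreal_of_nat_eq_real_of_nat)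
  next
    case False
    then show ?thesis by (simp add: ennreal_mult_top)
  qed
  then show ?thesis unfolding J_def h_def .
qed

context well_behaved_percolation
begin

lemma near_miss_closed_sets:
  assumes "isometry \<phi>"
  shows "{C. closed C \<and> near_miss \<phi> w C} \<in> sets closed_sets"
proof -
  have "{C. closed C \<and> near_miss \<phi> w C} = {C. closed C \<and> crossed (\<phi> ` gate (-3) w) (\<phi> ` gate 3 w) C}
      - {C. closed C \<and> crossed {\<phi> (base_pt (-1/2))} {\<phi> (base_pt (1/2))} C}"
    by (auto simp: near_miss_def)
  then show ?thesis
    by (simp only:) (intro sets.Diff crossed_closed_sets compact_frame_gate assms compact_sing)
qed

lemma near_miss_event: "isometry \<phi> \<Longrightarrow> {\<omega> \<in> space M. near_miss \<phi> w (Z \<omega>)} \<in> events"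
  using Z_event[OF near_miss_closed_sets[of \<phi> w]] Z_closed by (simp cong: conj_cong)

lemma prob_near_miss_isometry:
  assumes "isometry \<phi>"
  shows "prob {\<omega> \<in> space M. near_miss \<phi> w (Z \<omega>)} = prob {\<omega> \<in> space M. near_miss id w (Z \<omega>)}"
proof -
  have "closed (\<phi> ` Z \<omega>)" if "\<omega> \<in> space M" for \<omega>
    using measurable_space[OF image_Z_measurable[OF assms] that] by (simp add: space_closed_sets_in)
  then have "{\<omega> \<in> space M. near_miss id w (Z \<omega>)} = {\<omega> \<in> space M. \<phi> ` Z \<omega> \<in> {C. closed C \<and> near_miss \<phi> w C}}"
    using near_miss_comp_isometry[OF assms, of id] by auto
  then have "prob {\<omega> \<in> space M. near_miss id w (Z \<omega>)} = prob {\<omega> \<in> space M. Z \<omega> \<in> {C. closed C \<and> near_miss \<phi> w C}}"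
    using prob_isometry[OF assms near_miss_closed_sets[OF assms]] by simp
  then show ?thesis using Z_closed by (simp cong: conj_cong)
qed

text \<open>
  About \<open>1 / (16 w)\<close> translates with heights at most \<open>1/8\<close> have near misses of equal
  probability, and the mean number of them that occur is at most twice the mean number of components.
\<close>

lemma prob_near_miss_le:
  obtains c where "c > 0" "\<And>\<phi> w. isometry \<phi> \<Longrightarrow> 0 < w \<Longrightarrow> prob {\<omega> \<in> space M. near_miss \<phi> w (Z \<omega>)} \<le> c * w"
proof -
  define m where "m = enn2real (\<integral>\<^sup>+ \<omega>. emeasure (count_space UNIV) (components (cball b 1 - Z \<omega>)) \<partial>M)"
  have m: "(\<integral>\<^sup>+ \<omega>. emeasure (count_space UNIV) (components (cball b 1 - Z \<omega>)) \<partial>M) = ennreal m" "m \<ge> 0"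
    using finite_expected_components by (auto simp: m_def)
  obtain \<Phi>' where \<Phi>': "isometry \<Phi>'" "\<Phi>' b = base_pt 0" using normalize_pair[of b b] by metis
  define \<Phi> where "\<Phi> = inv \<Phi>'"
  have \<Phi>: "isometry \<Phi>" "\<Phi> (base_pt 0) = b"
    unfolding \<Phi>_def using \<Phi>' by (auto intro: isometry_inv) (metis isometry_inv_apply(1))
  have main: "prob {\<omega> \<in> space M. near_miss id w (Z \<omega>)} \<le> (32 * m + 1) * w" if w: "0 < w" for w
  proof -
    define p where "p = prob {\<omega> \<in> space M. near_miss id w (Z \<omega>)}"
    \<comment> \<open>the number of heights \<open>2 j w\<close> between \<open>0\<close> and \<open>1/8\<close>\<close>
    define N where "N = nat \<lfloor>1 / (16 * w)\<rfloor> + 1"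
    define G where "G j = {\<omega> \<in> space M. near_miss (\<Phi> \<circ> lift (2 * real j * w)) w (Z \<omega>)}" for j :: nat
    have iso: "isometry (\<Phi> \<circ> lift h)" for h by (intro isometry_comp \<Phi> isometry_lift)
    have G: "G j \<in> events" "prob (G j) = p" for j
      unfolding G_def p_def using near_miss_event[OF iso] prob_near_miss_isometry[OF iso] by auto
    have N: "real N \<ge> 1 / (16 * w)" unfolding N_def using w by linarith
    have small: "2 * real j * w \<le> 1/8" if "j < N" for j
    proof -
      have "0 \<le> \<lfloor>1 / (16 * w)\<rfloor>" using w by simp
      moreover have "j \<le> nat \<lfloor>1 / (16 * w)\<rfloor>" using that by (simp add: N_def)
      ultimately have "int j \<le> \<lfloor>1 / (16 * w)\<rfloor>" by linarith
      then have "real j \<le> 1 / (16 * w)" by linarith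
      then show ?thesis using w by (simp add: field_simps)
    qed
    have "ennreal (real N * p) = (\<Sum>j<N. emeasure M (G j))"
      using G by (simp add: emeasure_eq_measure ennreal_mult p_def ennreal_of_nat_eq_real_of_nat)
    also have "\<dots> = (\<integral>\<^sup>+ \<omega>. (\<Sum>j<N. indicator (G j) \<omega>) \<partial>M)"
      using G by (simp add: nn_integral_sum)
    also have "\<dots> \<le> (\<integral>\<^sup>+ \<omega>. 2 * emeasure (count_space UNIV) (components (cball b 1 - Z \<omega>)) \<partial>M)"
    proof (rule nn_integral_mono)
      fix \<omega> assume "\<omega> \<in> space M"
      then have "(\<Sum>j<N. indicator (G j) \<omega> :: ennreal) = of_nat (card {j\<in>{..<N}. near_miss (\<Phi> \<circ> lift (2 * real j * w)) w (Z \<omega>)})"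
        by (simp add: G_def indicator_def sum.If_cases Int_def)
      also have "\<dots> = ennreal (card {j\<in>{..<N}. near_miss (\<Phi> \<circ> lift (2 * real j * w)) w (Z \<omega>)})"
        by (simp add: ennreal_of_nat_eq_real_of_nat)
      also have "\<dots> \<le> 2 * emeasure (count_space UNIV) (components (cball b 1 - Z \<omega>))"
        by (rule near_misses_le_components[OF \<Phi> w small])
      finally show "(\<Sum>j<N. indicator (G j) \<omega>) \<le> 2 * emeasure (count_space UNIV) (components (cball b 1 - Z \<omega>))" .
    qed
    also have "\<dots> = ennreal (2 * m)"
      using components_measurable m by (simp add: nn_integral_cmult ennreal_mult)
    finally have "real N * p \<le> 2 * m" using m by (simp add: ennreal_le_iff)
    moreover have "1 / (16 * w) * p \<le> real N * p" using N by (intro mult_right_mono) (auto simp: p_def)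
    ultimately have "1 / (16 * w) * p \<le> 2 * m" by simp
    then have "p \<le> 32 * m * w" using w by (simp add: field_simps)
    then show ?thesis using w by (simp add: p_def algebra_simps)
  qed
  show thesis
    by (rule that[of "32 * m + 1"]) (use m main prob_near_miss_isometry in \<open>auto simp: add_nonneg_pos\<close>)
qed

end

section \<open>Events that depend on a region\<close>

text \<open>
  The form in which independence at a distance applies to events that only look at \<open>D\<close>. It is stable under
  finite Boolean combinations.
\<close>

definition localized :: "hyperbolic_plane set \<Rightarrow> (hyperbolic_plane set \<Rightarrow> bool) \<Rightarrow> bool" where
  "localized D E \<longleftrightarrow> {C. closedin (top_of_set D) C \<and> E C} \<in> sets (closed_sets_in D) \<and>
     (\<forall>C. closed C \<longrightarrow> E (C \<inter> D) = E C)"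

lemma localized_const: "localized D (\<lambda>C. c)"
proof -
  have "{C. closedin (top_of_set D) C \<and> c} = (if c then space (closed_sets_in D) else {})"
    by (auto simp: space_closed_sets_in)
  then show ?thesis unfolding localized_def by (metis sets.empty_sets sets.top)
qed

lemma localized_not: assumes "localized D E" shows "localized D (\<lambda>C. \<not> E C)"
proof -
  have "{C. closedin (top_of_set D) C \<and> \<not> E C} = space (closed_sets_in D) - {C. closedin (top_of_set D) C \<and> E C}"
    by (auto simp: space_closed_sets_in)
  then show ?thesis using assms unfolding localized_def by auto
qed

lemma localized_conj:
  assumes "localized D E" "localized D F" shows "localized D (\<lambda>C. E C \<and> F C)"
proof -
  have "{C. closedin (top_of_set D) C \<and> E C \<and> F C}
      = {C. closedin (top_of_set D) C \<and> E C} \<inter> {C. closedin (top_of_set D) C \<and> F C}" by auto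
  then show ?thesis using assms unfolding localized_def by auto
qed

lemma localized_ball:
  assumes "finite I" "\<And>i. i \<in> I \<Longrightarrow> localized D (E i)"
  shows "localized D (\<lambda>C. \<forall>i\<in>I. E i C)"
  using assms by (induction I rule: finite_induct) (auto intro: localized_const localized_conj)

lemma localized_iff_const: "localized D E \<Longrightarrow> localized D (\<lambda>C. E C \<longleftrightarrow> c)"
  by (cases c) (auto intro: localized_not)

lemma localized_crossed:
  assumes "compact A" "compact B" "closed D" "\<And>a b. a \<in> A \<Longrightarrow> b \<in> B \<Longrightarrow> seg a b \<subseteq> D"
  shows "localized D (crossed A B)"
  unfolding localized_def using crossed_in_sets[OF assms(1-4)] assms(4) by (auto simp: crossed_def)

lemma localized_near_miss:
  assumes "isometry \<phi>" "closed D" "\<And>x y. x \<in> gate (-3) w \<Longrightarrow> y \<in> gate 3 w \<Longrightarrow> seg (\<phi> x) (\<phi> y) \<subseteq> D"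
    "seg (\<phi> (base_pt (-1/2))) (\<phi> (base_pt (1/2))) \<subseteq> D"
  shows "localized D (near_miss \<phi> w)"
  unfolding near_miss_def using assms
  by (intro localized_conj localized_not localized_crossed compact_continuous_image
      isometry_continuous compact_gate) auto

context well_behaved_percolation
begin

lemma localized_independent:
  obtains R where "R \<ge> 1"
    "\<And>D D' E E'. (\<And>a a'. a \<in> D \<Longrightarrow> a' \<in> D' \<Longrightarrow> R \<le> dist a a') \<Longrightarrow> localized D E \<Longrightarrow> localized D' E' \<Longrightarrow>
      prob {\<omega> \<in> space M. E (Z \<omega>) \<and> E' (Z \<omega>)} = prob {\<omega> \<in> space M. E (Z \<omega>)} * prob {\<omega> \<in> space M. E' (Z \<omega>)}"
proof -
  obtain R where R: "R \<ge> 1"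
    "\<And>D D' F F'. (\<And>a a'. a \<in> D \<Longrightarrow> a' \<in> D' \<Longrightarrow> R \<le> dist a a') \<Longrightarrow>
      F \<in> sets (closed_sets_in D) \<Longrightarrow> F' \<in> sets (closed_sets_in D') \<Longrightarrow>
      prob {\<omega> \<in> space M. Z \<omega> \<inter> D \<in> F \<and> Z \<omega> \<inter> D' \<in> F'}
        = prob {\<omega> \<in> space M. Z \<omega> \<inter> D \<in> F} * prob {\<omega> \<in> space M. Z \<omega> \<inter> D' \<in> F'}"
    using independent_regions by blast
  have eq: "Z \<omega> \<inter> D \<in> {C. closedin (top_of_set D) C \<and> E C} \<longleftrightarrow> E (Z \<omega>)"
    if "\<omega> \<in> space M" "localized D E" for \<omega> D E
  proof -
    have "closedin (top_of_set D) (Z \<omega> \<inter> D)"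
      using closedin_closed_Int[OF Z_closed[OF that(1)], of D] by (simp add: Int_commute)
    moreover have "E (Z \<omega> \<inter> D) = E (Z \<omega>)" using that(2) Z_closed[OF that(1)] by (simp add: localized_def)
    ultimately show ?thesis by simp
  qed
  show thesis
  proof (rule that[OF R(1)])
    fix D D' E E'
    assume far: "\<And>a a'. a \<in> D \<Longrightarrow> a' \<in> D' \<Longrightarrow> R \<le> dist a a'" and l: "localized D E" "localized D' E'"
    define F where "F = {C. closedin (top_of_set D) C \<and> E C}"
    define F' where "F' = {C. closedin (top_of_set D') C \<and> E' C}"
    have "prob {\<omega> \<in> space M. Z \<omega> \<inter> D \<in> F \<and> Z \<omega> \<inter> D' \<in> F'}
      = prob {\<omega> \<in> space M. Z \<omega> \<inter> D \<in> F} * prob {\<omega> \<in> space M. Z \<omega> \<inter> D' \<in> F'}"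
      using l by (intro R(2) far) (auto simp: localized_def F_def F'_def)
    then show "prob {\<omega> \<in> space M. E (Z \<omega>) \<and> E' (Z \<omega>)} = prob {\<omega> \<in> space M. E (Z \<omega>)} * prob {\<omega> \<in> space M. E' (Z \<omega>)}"
      using eq[OF _ l(1), folded F_def] eq[OF _ l(2), folded F'_def] by (simp cong: conj_cong)
  qed
qed

lemma localized_UNIV_event: "localized UNIV E \<Longrightarrow> {\<omega> \<in> space M. E (Z \<omega>)} \<in> events"
  using Z_event[of "{C. closed C \<and> E C}"] Z_closed by (simp add: localized_def cong: conj_cong)

end

section \<open>Segments with nearby ends\<close>

lemma side_pt_exhaust: obtains u v where "p = side_pt u v"
proof -
  define v where "v = arsinh (hy p)"
  define u where "u = arsinh (hx p / cosh v)"
  have "p = side_pt u v" by (rule hyperboloid_eqI) (simp_all add: u_def v_def)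
  then show thesis by (rule that)
qed

lemma cosh_dist_side_pt: "cosh (dist (base_pt t) (side_pt u v)) = cosh v * cosh (u - t)"
  by (simp add: cosh_dist lorentz_def cosh_diff algebra_simps)

lemma cosh_le_iff_abs: "cosh x \<le> cosh y \<longleftrightarrow> \<bar>x\<bar> \<le> \<bar>y :: real\<bar>"
  using cosh_real_nonneg_le_iff[of "\<bar>x\<bar>" "\<bar>y\<bar>"] by simp

lemma side_pt_in_cball:
  assumes "side_pt u v \<in> cball (base_pt t) r"
  shows "\<bar>u - t\<bar> \<le> r" "\<bar>v\<bar> \<le> r"
proof -
  have r: "0 \<le> r" using assms zero_le_dist[of "base_pt t" "side_pt u v"] by (simp del: zero_le_dist)
  have "cosh v * cosh (u - t) \<le> cosh r"
    using assms r unfolding cosh_dist_side_pt[symmetric] by (simp add: cosh_real_nonneg_le_iff)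
  moreover have "cosh v * 1 \<le> cosh v * cosh (u - t)" "1 * cosh (u - t) \<le> cosh v * cosh (u - t)"
    by (intro mult_left_mono mult_right_mono cosh_real_ge_1; simp)+
  ultimately have "cosh (u - t) \<le> cosh r" "cosh v \<le> cosh r" by linarith+
  then show "\<bar>u - t\<bar> \<le> r" "\<bar>v\<bar> \<le> r" using r by (simp_all add: cosh_le_iff_abs)
qed

lemma dist_side_pt_base_pt: "dist (base_pt u) (side_pt u v) = \<bar>v\<bar>"
proof -
  have "cosh (dist (base_pt u) (side_pt u v)) = cosh \<bar>v\<bar>" by (simp add: cosh_dist_side_pt)
  then show ?thesis by (rule cosh_real_inj) auto
qed

lemma klein_x_side_pt: "klein_x (side_pt u v) = tanh u"
  by (simp add: klein_x_def tanh_def)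

lemma boost_side_pt: "boost s (side_pt u v) = side_pt (s + u) v"
  by (rule hyperboloid_eqI) (simp_all add: sinh_add algebra_simps)

lemma boost_gate: "boost s ` gate u w = gate (s + u) w"
  by (simp add: gate_def image_image boost_side_pt)

text \<open>
  The hyperbolic tangent of the height over the base line satisfies the linear law of a
  straight line, with hyperbolic sines in place of lengths: \<open>ht\<close> and \<open>hx\<close> determine the
  two coefficients up to the common factor \<open>cosh v\<close>, and \<open>hy\<close> gives the height.
\<close>

lemma seg_height:
  assumes "u0 < u1" "u0 \<le> u" "u \<le> u1"
  obtains v where "side_pt u v \<in> seg (side_pt u0 v0) (side_pt u1 v1)"
    "tanh v = (sinh (u1 - u) * tanh v0 + sinh (u - u0) * tanh v1) / sinh (u1 - u0)"
proof -
  obtain p where p: "p \<in> seg (side_pt u0 v0) (side_pt u1 v1)" "klein_x p = tanh u"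
    using assms by (rule_tac seg_IVT[OF continuous_on_klein(1), of "side_pt u0 v0" "tanh u" "side_pt u1 v1"])
      (auto simp: klein_x_side_pt)
  obtain u' v where "p = side_pt u' v" by (rule side_pt_exhaust)
  with p(2) have pv: "p = side_pt u v" by (metis klein_x_side_pt tanh_real_eq_iff)
  obtain \<alpha> \<beta> where ab: "ht p = \<alpha> * ht (side_pt u0 v0) + \<beta> * ht (side_pt u1 v1)"
    "hx p = \<alpha> * hx (side_pt u0 v0) + \<beta> * hx (side_pt u1 v1)"
    "hy p = \<alpha> * hy (side_pt u0 v0) + \<beta> * hy (side_pt u1 v1)"
    using p(1) seg_combE by metis
  define a b A B where "a = u - u0" and "b = u1 - u" and "A = \<alpha> * cosh v0" and "B = \<beta> * cosh v1"
  have T: "cosh v * cosh u = A * cosh u0 + B * cosh u1" and X: "cosh v * sinh u = A * sinh u0 + B * sinh u1"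
    using ab by (simp_all add: pv A_def B_def)
  have Y: "sinh v = A * tanh v0 + B * tanh v1"
    using ab(3) by (simp add: pv A_def B_def tanh_def)
  have hp: "(cosh u)\<^sup>2 - (sinh u)\<^sup>2 = 1" by (rule hyperbolic_pythagoras)
  have "cosh v * ((cosh u)\<^sup>2 - (sinh u)\<^sup>2) = (cosh v * cosh u) * cosh u - (cosh v * sinh u) * sinh u"
    by (simp add: power2_eq_square algebra_simps)
  also have "\<dots> = A * cosh a + B * cosh b"
    unfolding T X a_def b_def cosh_diff by (simp add: algebra_simps)
  finally have c: "cosh v = A * cosh a + B * cosh b" by (simp add: hp)
  have "0 = (cosh v * cosh u) * sinh u - (cosh v * sinh u) * cosh u" by simp
  also have "\<dots> = A * sinh a - B * sinh b"
    unfolding T X a_def b_def sinh_diff by (simp add: algebra_simps)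
  finally have s: "A * sinh a = B * sinh b" by simp
  have ab': "u1 - u0 = a + b" by (simp add: a_def b_def)
  have A: "A * sinh (u1 - u0) = sinh b * cosh v"
    unfolding ab' c sinh_add using s by (simp add: algebra_simps)
  have B: "B * sinh (u1 - u0) = sinh a * cosh v"
    unfolding ab' c sinh_add using s by (simp add: algebra_simps)
  have "sinh v * sinh (u1 - u0) = (A * sinh (u1 - u0)) * tanh v0 + (B * sinh (u1 - u0)) * tanh v1"
    unfolding Y by (simp add: algebra_simps)
  also have "\<dots> = cosh v * (sinh b * tanh v0 + sinh a * tanh v1)"
    unfolding A B by (simp add: algebra_simps)
  finally have "tanh v = (sinh b * tanh v0 + sinh a * tanh v1) / sinh (u1 - u0)"
    using assms(1) by (simp add: tanh_def[of v] field_simps)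
  then show thesis using that p(1) by (simp add: pv a_def b_def)
qed

lemma abs_tanh: "\<bar>tanh x\<bar> = tanh \<bar>x :: real\<bar>"
  by (simp add: tanh_real_abs)

lemma sinh_ratio_le:
  assumes "0 \<le> a" "0 \<le> b" "0 < a + (b :: real)"
  shows "sinh a / sinh (a + b) \<le> exp (- b)"
proof -
  have "sinh a * exp b = sinh a * cosh b + sinh a * sinh b"
    by (simp add: cosh_plus_sinh[symmetric] algebra_simps)
  also have "\<dots> \<le> sinh a * cosh b + cosh a * sinh b"
    using assms sinh_le_cosh_real[of a] by (intro add_left_mono mult_right_mono) auto
  finally have "sinh a * exp b \<le> sinh (a + b)" by (simp add: sinh_add)
  then show ?thesis using assms by (simp add: exp_minus field_simps)
qed

lemma tanh_ge_half: assumes "0 \<le> x" "x \<le> 1" shows "x / 2 \<le> tanh (x :: real)"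
proof -
  have "exp (-1) \<le> (1 :: real)" by simp
  then have "exp 1 + exp (-1) \<le> (4 :: real)" using exp_le by linarith
  then have "cosh 1 \<le> (2 :: real)" by (simp add: cosh_def)
  moreover have "cosh x \<le> cosh 1" using assms by (simp add: cosh_real_nonneg_le_iff)
  ultimately have "cosh x \<le> 2" by linarith
  moreover have "x \<le> sinh x" using real_le_x_sinh[of x] assms by (simp add: sinh_def exp_minus)
  ultimately show ?thesis unfolding tanh_def using assms by (intro frac_le) auto
qed

lemma tanh_le_self: assumes "0 \<le> x" shows "tanh x \<le> (x :: real)"
proof -
  have "\<exists>y. ((\<lambda>x. x - tanh x) has_real_derivative y) (at t) \<and> 0 \<le> y" for t :: real
    by (rule exI[of _ "(tanh t)\<^sup>2"]) (auto intro!: derivative_eq_intros)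
  then have "0 - tanh 0 \<le> x - tanh x"
    using DERIV_nonneg_imp_nondecreasing[of 0 x "\<lambda>x. x - tanh x"] assms by blast
  then show ?thesis by simp
qed

text \<open>
  Segments with nearby ends approach each other exponentially fast in the middle. The first bound, without a
  constant, matters as well: it lets an initial or final part of the segment cross a tube of the
  same radius.
\<close>

lemma fellow_travel:
  assumes "u0 < u1" "u0 \<le> u" "u \<le> u1" "\<bar>v0\<bar> \<le> \<rho>" "\<bar>v1\<bar> \<le> \<rho>" "\<rho> \<le> 1"
  obtains v where "side_pt u v \<in> seg (side_pt u0 v0) (side_pt u1 v1)" "\<bar>v\<bar> \<le> \<rho>"
    "\<bar>v\<bar> \<le> 2 * \<rho> * (exp (- (u - u0)) + exp (- (u1 - u)))"
proof -
  define a b where "a = u - u0" and "b = u1 - u"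
  have ab: "0 \<le> a" "0 \<le> b" "0 < a + b" "u1 - u0 = a + b" using assms by (auto simp: a_def b_def)
  have \<rho>: "0 \<le> \<rho>" using assms by linarith
  obtain v where v: "side_pt u v \<in> seg (side_pt u0 v0) (side_pt u1 v1)"
    "tanh v = (sinh b * tanh v0 + sinh a * tanh v1) / sinh (a + b)"
    using seg_height[OF assms(1-3)] unfolding ab(4) unfolding a_def b_def by metis
  have sp: "sinh (a + b) > 0" using ab by simp
  have t: "\<bar>tanh v0\<bar> \<le> tanh \<rho>" "\<bar>tanh v1\<bar> \<le> tanh \<rho>" using assms by (simp_all only: abs_tanh tanh_real_le_iff)
  have "\<bar>sinh b * tanh v0 + sinh a * tanh v1\<bar> \<le> sinh b * \<bar>tanh v0\<bar> + sinh a * \<bar>tanh v1\<bar>"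
    using ab by (intro order_trans[OF abs_triangle_ineq]) (simp add: abs_mult)
  also have "\<dots> \<le> sinh b * tanh \<rho> + sinh a * tanh \<rho>"
    using t ab by (intro add_mono mult_left_mono) auto
  finally have "\<bar>tanh v\<bar> \<le> (sinh b * tanh \<rho> + sinh a * tanh \<rho>) / sinh (a + b)"
    unfolding v(2) using sp by (simp add: abs_divide divide_right_mono)
  also have "\<dots> = tanh \<rho> * (sinh a / sinh (a + b) + sinh b / sinh (a + b))"
    by (simp add: add_divide_distrib algebra_simps)
  finally have tv: "\<bar>tanh v\<bar> \<le> tanh \<rho> * (sinh a / sinh (a + b) + sinh b / sinh (a + b))" .
  have "sinh a * 1 + 1 * sinh b \<le> sinh (a + b)"
    unfolding sinh_add using ab by (intro add_mono mult_left_mono mult_right_mono) (auto simp: cosh_real_ge_1)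
  then have "sinh a / sinh (a + b) + sinh b / sinh (a + b) \<le> 1"
    using sp by (simp add: add_divide_distrib[symmetric])
  then have "tanh \<rho> * (sinh a / sinh (a + b) + sinh b / sinh (a + b)) \<le> tanh \<rho> * 1"
    using \<rho> by (intro mult_left_mono) auto
  then have "tanh \<bar>v\<bar> \<le> tanh \<rho>" using tv unfolding abs_tanh by simp
  then have v1: "\<bar>v\<bar> \<le> \<rho>" by (simp only: tanh_real_le_iff)
  have "\<bar>v\<bar> / 2 \<le> \<bar>tanh v\<bar>" unfolding abs_tanh using v1 assms by (intro tanh_ge_half) auto
  also have "\<dots> \<le> tanh \<rho> * (exp (- b) + exp (- a))"
    using tv sinh_ratio_le[OF ab(1-3)] sinh_ratio_le[of b a] ab \<rho>
    by (intro order_trans[OF tv] mult_left_mono add_mono) (auto simp: add.commute)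
  also have "\<dots> \<le> \<rho> * (exp (- b) + exp (- a))"
    using \<rho> by (intro mult_right_mono) (auto simp: tanh_le_self)
  finally show thesis using that[OF v(1) v1] by (simp add: a_def b_def algebra_simps)
qed

section \<open>Crossings of long tubes\<close>

text \<open>
  The factor \<open>exp 4\<close> absorbs the distance \<open>3\<close> of the gates from the point at \<open>s\<close>, and the radius \<open>\<rho> \<le> 1/8\<close>.
\<close>

definition deviation :: "real \<Rightarrow> nat \<Rightarrow> nat \<Rightarrow> real" where
  "deviation \<rho> n s = 2 * exp 4 * \<rho> * (exp (- real s) + exp (- real (n - s)))"

lemma tube_point:
  assumes x: "x \<in> cball (base_pt 0) \<rho>" and y: "y \<in> cball (base_pt (real n)) \<rho>"
    and \<rho>: "0 < \<rho>" "\<rho> \<le> 1/8" and u: "1 \<le> u" "u \<le> real n - 1"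
  obtains v where "side_pt u v \<in> seg x y" "\<bar>v\<bar> \<le> \<rho>"
    "\<And>s. s \<le> n \<Longrightarrow> \<bar>u - real s\<bar> \<le> 3 \<Longrightarrow> \<bar>v\<bar> \<le> deviation \<rho> n s"
proof -
  obtain u0 v0 where x': "x = side_pt u0 v0" by (rule side_pt_exhaust)
  obtain u1 v1 where y': "y = side_pt u1 v1" by (rule side_pt_exhaust)
  have b: "\<bar>u0\<bar> \<le> \<rho>" "\<bar>v0\<bar> \<le> \<rho>" "\<bar>u1 - real n\<bar> \<le> \<rho>" "\<bar>v1\<bar> \<le> \<rho>"
    using side_pt_in_cball[of u0 v0 0 \<rho>] side_pt_in_cball[of u1 v1 "real n" \<rho>] x y
    unfolding x' y' by simp_all
  have i: "u0 < u1" "u0 \<le> u" "u \<le> u1" "\<rho> \<le> 1" using b \<rho> u by (auto simp: abs_le_iff)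
  obtain v where v: "side_pt u v \<in> seg x y" "\<bar>v\<bar> \<le> \<rho>"
    "\<bar>v\<bar> \<le> 2 * \<rho> * (exp (- (u - u0)) + exp (- (u1 - u)))"
    using fellow_travel[OF i(1-3) b(2,4) i(4)] unfolding x' y' by metis
  show thesis
  proof (rule that[OF v(1,2)])
    fix s assume s: "s \<le> n" "\<bar>u - real s\<bar> \<le> 3"
    have "exp (- (u - u0)) \<le> exp (4 + - real s)" "exp (- (u1 - u)) \<le> exp (4 + - real (n - s))"
      using s b \<rho> by (auto simp: abs_le_iff of_nat_diff)
    then have "exp (- (u - u0)) + exp (- (u1 - u)) \<le> exp 4 * (exp (- real s) + exp (- real (n - s)))"
      unfolding exp_add distrib_left by (rule add_mono)
    then have "2 * \<rho> * (exp (- (u - u0)) + exp (- (u1 - u))) \<le> 2 * \<rho> * (exp 4 * (exp (- real s) + exp (- real (n - s))))"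
      using \<rho> by (intro mult_left_mono) auto
    then show "\<bar>v\<bar> \<le> deviation \<rho> n s" using v(3) by (simp add: deviation_def algebra_simps)
  qed
qed

definition tube :: "real \<Rightarrow> real \<Rightarrow> real \<Rightarrow> hyperbolic_plane set \<Rightarrow> bool" where
  "tube \<rho> s t = crossed (cball (base_pt s) \<rho>) (cball (base_pt t) \<rho>)"

text \<open>
  A hole in the axis, at distance at least \<open>4\<close> from the ends so that there is room for the gates, lies within
  \<open>1/2\<close> of an integer \<open>s\<close>. The part of the axis within distance \<open>a\<close> of \<open>base_pt s\<close> is given up: it makes room for
  independence.
\<close>

lemma tube_near_miss:
  assumes C: "tube \<rho> 0 (real n) C" and \<rho>: "0 < \<rho>" "\<rho> \<le> 1/8" and n: "8 \<le> n" and a: "1 \<le> a"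
    and hole: "\<not> seg (base_pt 4) (base_pt (real n - 4)) \<subseteq> C"
  obtains s where "4 \<le> s" "s \<le> n - 4" "near_miss (boost (real s)) (deviation \<rho> n s) C"
    "a < s \<Longrightarrow> tube \<rho> 0 (real s - real a) C"
    "a < n - s \<Longrightarrow> tube \<rho> (real s + real a) (real n) C"
proof -
  obtain x y where x: "x \<in> cball (base_pt 0) \<rho>" and y: "y \<in> cball (base_pt (real n)) \<rho>"
    and xy: "seg x y \<subseteq> C"
    using C by (auto simp: tube_def crossed_def)
  have "\<not> base_pt ` {4..real n - 4} \<subseteq> C" using hole n by (simp add: seg_base_pt)
  then obtain t where "t \<in> {4..real n - 4}" and "base_pt t \<notin> C" unfolding subset_iff by blast
  then have t: "4 \<le> t" "t \<le> real n - 4" "base_pt t \<notin> C" by auto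
  define s where "s = nat \<lfloor>t + 1/2\<rfloor>"
  have s: "\<bar>real s - t\<bar> \<le> 1/2" using t(1) unfolding s_def by linarith
  have s4: "4 \<le> s" unfolding s_def using t(1) by linarith
  have "real s < real n - 4 + 1" using s t(2) by linarith
  then have sn: "s \<le> n - 4" using n by linarith
  have pt: "\<exists>v. side_pt u v \<in> seg x y \<and> \<bar>v\<bar> \<le> \<rho> \<and> (\<bar>u - real s\<bar> \<le> 3 \<longrightarrow> \<bar>v\<bar> \<le> deviation \<rho> n s)"
    if "1 \<le> u" "u \<le> real n - 1" for u
    using tube_point[OF x y \<rho> that] sn by (metis diff_le_self le_trans)
  have gate: "\<exists>p\<in>gate u (deviation \<rho> n s). p \<in> seg x y" if u: "\<bar>u - real s\<bar> \<le> 3" for u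
  proof -
    have "1 \<le> u" "u \<le> real n - 1" using u s4 sn n by (auto simp: abs_le_iff)
    then obtain v where v: "side_pt u v \<in> seg x y" "\<bar>v\<bar> \<le> deviation \<rho> n s" using pt[of u] u by auto
    then have "side_pt u v \<in> gate u (deviation \<rho> n s)"
      unfolding gate_def by (intro imageI) (simp add: abs_le_iff)
    then show ?thesis using v(1) by blast
  qed
  have ball: "\<exists>p\<in>cball (base_pt u) \<rho>. p \<in> seg x y" if "1 \<le> u" "u \<le> real n - 1" for u
    using pt[OF that] by (metis dist_side_pt_base_pt mem_cball)
  show thesis
  proof (rule that[OF s4 sn])
    obtain p q where p: "p \<in> gate (real s + -3) (deviation \<rho> n s)" "p \<in> seg x y"
      and q: "q \<in> gate (real s + 3) (deviation \<rho> n s)" "q \<in> seg x y"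
      using gate[of "real s + -3"] gate[of "real s + 3"] by auto
    have "crossed (boost s ` gate (-3) (deviation \<rho> n s)) (boost s ` gate 3 (deviation \<rho> n s)) C"
      unfolding boost_gate crossed_def using p q subseg[OF p(2) q(2)] xy by blast
    moreover have "t \<in> {real s + -1/2..real s + 1/2}"
      using s unfolding atLeastAtMost_iff by linarith
    then have "base_pt t \<in> seg (base_pt (real s + -1/2)) (base_pt (real s + 1/2))"
      by (subst seg_base_pt) auto
    then have "\<not> crossed {boost s (base_pt (-1/2))} {boost s (base_pt (1/2))} C"
      unfolding boost_base_pt crossed_def using t(3) by auto
    ultimately show "near_miss (boost (real s)) (deviation \<rho> n s) C" by (simp add: near_miss_def)
  next
    assume "a < s"
    then have "1 \<le> real s - real a" "real s - real a \<le> real n - 1" using sn n a by auto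
    then obtain p where "p \<in> cball (base_pt (real s - real a)) \<rho>" "p \<in> seg x y" using ball by blast
    then show "tube \<rho> 0 (real s - real a) C"
      unfolding tube_def crossed_def using x xy subseg[OF seg_ends(1), of p x y] by blast
  next
    assume "a < n - s"
    then have "1 \<le> real s + real a" "real s + real a \<le> real n - 1" using s4 a by auto
    then obtain p where "p \<in> cball (base_pt (real s + real a)) \<rho>" "p \<in> seg x y" using ball by blast
    then show "tube \<rho> (real s + real a) (real n) C"
      unfolding tube_def crossed_def using y xy subseg[OF _ seg_ends(2), of p x y] by blast
  qed
qed

lemma seg_of_balls_subset:
  assumes "x \<in> cball p r" "y \<in> cball q r"
  shows "seg x y \<subseteq> cball p (dist p q + 3 * r)"
proof -
  have "dist x y \<le> dist p q + 2 * r"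
    using assms dist_triangle[of x y p] dist_triangle[of p y q] by (simp add: dist_commute)
  then have "seg x y \<subseteq> cball p (r + (dist p q + 2 * r))" by (rule seg_subset_cball[OF assms(1)])
  moreover have "r + (dist p q + 2 * r) = dist p q + 3 * r" by simp
  ultimately show ?thesis by (simp only:)
qed

lemma localized_tube:
  assumes "cball (base_pt s) (\<bar>s - t\<bar> + 3 * \<rho>) \<subseteq> D \<or> cball (base_pt t) (\<bar>s - t\<bar> + 3 * \<rho>) \<subseteq> D" "closed D"
  shows "localized D (tube \<rho> s t)"
  unfolding tube_def
proof (rule localized_crossed[OF compact_cball_hyperbolic compact_cball_hyperbolic assms(2)])
  fix x y assume xy: "x \<in> cball (base_pt s) \<rho>" "y \<in> cball (base_pt t) \<rho>"
  have "seg x y \<subseteq> cball (base_pt s) (\<bar>s - t\<bar> + 3 * \<rho>)" "seg x y \<subseteq> cball (base_pt t) (\<bar>s - t\<bar> + 3 * \<rho>)"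
    using seg_of_balls_subset[OF xy] seg_of_balls_subset[OF xy(2,1)]
    by (simp_all add: dist_base_pt abs_minus_commute seg_commute)
  then show "seg x y \<subseteq> D" using assms(1) by blast
qed

lemma localized_near_miss_boost:
  assumes "w \<le> 1"
  shows "localized (cball (base_pt s) 12) (near_miss (boost s) w)"
proof (rule localized_near_miss[OF isometry_boost closed_cball])
  have g: "boost s p \<in> cball (base_pt s) 4" if "p \<in> gate u w" "\<bar>u\<bar> = 3" for p u
  proof -
    obtain v where "v \<in> {-w..w}" and v2: "p = side_pt u v" using \<open>p \<in> gate u w\<close> by (auto simp: gate_def)
    then have v: "\<bar>v\<bar> \<le> w" "p = side_pt u v" by (auto simp: abs_le_iff)
    have "dist (base_pt s) (boost s p) \<le> dist (base_pt s) (base_pt (s + u)) + dist (base_pt (s + u)) (side_pt (s + u) v)"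
      unfolding v boost_side_pt by (rule dist_triangle)
    then show ?thesis using v assms that(2) by (simp add: dist_base_pt dist_side_pt_base_pt)
  qed
  fix x y assume "x \<in> gate (-3) w" "y \<in> gate 3 w"
  then have xy: "boost s x \<in> cball (base_pt s) 4" "boost s y \<in> cball (base_pt s) 4" using g by auto
  then show "seg (boost s x) (boost s y) \<subseteq> cball (base_pt s) 12"
    using seg_of_balls_subset[OF xy] by simp
next
  have "seg (boost s (base_pt (-1/2))) (boost s (base_pt (1/2))) \<subseteq> cball (base_pt s) (1 + 1)"
    by (rule seg_subset_cball) (auto simp: boost_base_pt dist_base_pt)
  also have "\<dots> \<subseteq> cball (base_pt s) 12" by auto
  finally show "seg (boost s (base_pt (-1/2))) (boost s (base_pt (1/2))) \<subseteq> cball (base_pt s) 12" .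
qed

text \<open>The deviations decay geometrically away from the two ends, whence a bound independent of \<open>n\<close>.\<close>

lemma sum_deviation_le: assumes "0 \<le> \<rho>" shows "(\<Sum>s=4..n - 4. deviation \<rho> n s) \<le> 8 * exp 4 * \<rho>"
proof -
  have half: "(\<Sum>s\<le>n. exp (- real s)) \<le> 2"
  proof -
    have e: "exp (- real s) \<le> (1/2) ^ s" for s
    proof -
      have "exp (-1) \<le> (1/2 :: real)" using exp_ge_add_one_self[of 1] by (simp add: exp_minus field_simps)
      then have "exp (-1) ^ s \<le> (1/2 :: real) ^ s" by (intro power_mono) auto
      then show ?thesis by (simp add: exp_of_nat_mult[symmetric])
    qed
    have "(\<Sum>s\<le>n. exp (- real s)) \<le> (\<Sum>s\<le>n. (1/2) ^ s)" by (intro sum_mono e)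
    also have "\<dots> \<le> 2" by (simp add: sum_gp0)
    finally show ?thesis .
  qed
  have "(\<Sum>s=4..n - 4. deviation \<rho> n s) \<le> (\<Sum>s\<le>n. deviation \<rho> n s)"
    using assms by (intro sum_mono2) (auto simp: deviation_def)
  also have "\<dots> = 2 * exp 4 * \<rho> * ((\<Sum>s\<le>n. exp (- real s)) + (\<Sum>s\<le>n. exp (- real (n - s))))"
    unfolding deviation_def by (simp only: sum_distrib_left[symmetric] sum.distrib)
  also have "(\<Sum>s\<le>n. exp (- real (n - s))) = (\<Sum>s\<le>n. exp (- real s))"
    using sum.nat_diff_reindex[of "\<lambda>s. exp (- real s)" "Suc n"] by (simp add: lessThan_Suc_atMost)
  also have "2 * exp 4 * \<rho> * ((\<Sum>s\<le>n. exp (- real s)) + (\<Sum>s\<le>n. exp (- real s))) \<le> 2 * exp 4 * \<rho> * (2 + 2)"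
    using half assms by (intro mult_left_mono add_mono) auto
  finally show ?thesis by simp
qed

context well_behaved_percolation
begin

definition segment :: "real \<Rightarrow> real \<Rightarrow> 'w set" where
  "segment s t = cross {base_pt s} {base_pt t}"

definition seg_prob :: "nat \<Rightarrow> real" where "seg_prob n = prob (segment 0 (real n))"

lemma segment_events: "segment s t \<in> events"
  unfolding segment_def by (intro cross_events compact_sing)

lemma prob_segment: "s + real n = t \<Longrightarrow> prob (segment s t) = seg_prob n"
  using prob_cross_isometry[OF isometry_boost[of s], of "{base_pt 0}" "{base_pt (real n)}"]
  by (auto simp: seg_prob_def segment_def boost_base_pt)

lemma seg_prob_eq_segment_prob: "seg_prob n = segment_prob M Z (real n)"
  by (simp add: seg_prob_def segment_def cross_def crossed_def segment_prob_def base_segment_eq_seg)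

lemma seg_prob_le_1: "seg_prob n \<le> 1" by (simp add: seg_prob_def)

lemma seg_prob_nonneg: "0 \<le> seg_prob n" by (simp add: seg_prob_def)

text \<open>Positive correlation of the coverings of two consecutive pieces.\<close>

lemma seg_prob_add: "seg_prob (j + k) \<ge> seg_prob j * seg_prob k"
proof -
  have "segment 0 (real j) \<inter> segment (real j) (real (j + k)) \<subseteq> segment 0 (real (j + k))"
  proof
    fix \<omega> assume "\<omega> \<in> segment 0 (real j) \<inter> segment (real j) (real (j + k))"
    moreover have "{0..real (j + k)} = {0..real j} \<union> {real j..real (j + k)}" by auto
    ultimately show "\<omega> \<in> segment 0 (real (j + k))"
      by (auto simp: segment_def cross_def crossed_def seg_base_pt image_Un)
  qed
  then have "prob (segment 0 (real j) \<inter> segment (real j) (real (j + k))) \<le> prob (segment 0 (real (j + k)))"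
    by (intro finite_measure_mono segment_events)
  moreover have "prob (segment 0 (real j)) * prob (segment (real j) (real (j + k)))
      \<le> prob (segment 0 (real j) \<inter> segment (real j) (real (j + k)))"
    unfolding segment_def by (intro prob_cross_Int compact_sing)
  ultimately show ?thesis using prob_segment[of "real j" k "real (j + k)"] by (simp add: seg_prob_def)
qed

lemma seg_prob_antimono: "j \<le> k \<Longrightarrow> seg_prob k \<le> seg_prob j"
  unfolding seg_prob_def
  by (intro finite_measure_mono segment_events)
     (auto simp: segment_def cross_def crossed_def seg_base_pt)

definition tube_prob :: "real \<Rightarrow> nat \<Rightarrow> real" where
  "tube_prob \<rho> n = prob {\<omega> \<in> space M. tube \<rho> 0 (real n) (Z \<omega>)}"

lemma tube_eq_cross: "{\<omega> \<in> space M. tube \<rho> s t (Z \<omega>)} = cross (cball (base_pt s) \<rho>) (cball (base_pt t) \<rho>)"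
  by (simp add: tube_def cross_def)

lemma prob_link:
  assumes "dist x y = real n"
  shows "prob (cross (cball x \<rho>) (cball y \<rho>)) = tube_prob \<rho> n"
proof -
  obtain \<phi> where \<phi>: "isometry \<phi>" "\<phi> (base_pt 0) = x" "\<phi> (base_pt (real n)) = y"
    using two_point_homogeneous[of "base_pt 0" "base_pt (real n)" x y] assms by (auto simp: dist_base_pt)
  then show ?thesis
    using prob_cross_isometry[OF \<phi>(1) compact_cball_hyperbolic compact_cball_hyperbolic, of "base_pt 0" \<rho> "base_pt (real n)" \<rho>]
    by (simp add: tube_prob_def tube_eq_cross isometry_image_cball)
qed

text \<open>
  The probability of crossing a tube of length \<open>k\<close> whose last piece of length \<open>a\<close> is given up. The value is \<open>1\<close>
  when nothing remains.
\<close>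

definition padded :: "real \<Rightarrow> nat \<Rightarrow> nat \<Rightarrow> real" where
  "padded \<rho> a k = (if k \<le> a then 1 else tube_prob \<rho> (k - a))"

text \<open>
  Either the axis is covered away from its ends, or there is a near miss at some \<open>s\<close>, and the
  crossings before and after and the near miss concern three regions at mutual distance at least \<open>R\<close>.
\<close>

lemma tube_prob_recursion:
  obtains a c where "1 \<le> a" "c > 0"
    "\<And>\<rho> n. 0 < \<rho> \<Longrightarrow> \<rho> \<le> 1/8 \<Longrightarrow> 4 * exp 4 * \<rho> \<le> 1 \<Longrightarrow> 8 \<le> n \<Longrightarrow>
      tube_prob \<rho> n \<le> seg_prob (n - 8) + (\<Sum>s=4..n - 4. padded \<rho> a s * padded \<rho> a (n - s) * (c * deviation \<rho> n s))"
proof -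
  obtain R where R: "R \<ge> 1"
    "\<And>D D' E E'. (\<And>a a'. a \<in> D \<Longrightarrow> a' \<in> D' \<Longrightarrow> R \<le> dist a a') \<Longrightarrow> localized D E \<Longrightarrow> localized D' E' \<Longrightarrow>
      prob {\<omega> \<in> space M. E (Z \<omega>) \<and> E' (Z \<omega>)} = prob {\<omega> \<in> space M. E (Z \<omega>)} * prob {\<omega> \<in> space M. E' (Z \<omega>)}"
    using localized_independent by blast
  obtain c where c: "c > 0" "\<And>\<phi> w. isometry \<phi> \<Longrightarrow> 0 < w \<Longrightarrow> prob {\<omega> \<in> space M. near_miss \<phi> w (Z \<omega>)} \<le> c * w"
    using prob_near_miss_le by blast
  \<comment> \<open>near misses are decided within radius \<open>12\<close>, and a crossing of a tube stays within \<open>1\<close> of its length\<close>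
  define a where "a = nat \<lceil>R\<rceil> + 13"
  have a: "1 \<le> a" "R + 13 \<le> real a" unfolding a_def using R(1) by linarith+
  show thesis
  proof (rule that[OF a(1) c(1)])
    fix \<rho> :: real and n :: nat
    assume \<rho>: "0 < \<rho>" "\<rho> \<le> 1/8" "4 * exp 4 * \<rho> \<le> 1" and n: "8 \<le> n"
    define pre where "pre s C \<longleftrightarrow> a < s \<longrightarrow> tube \<rho> 0 (real s - real a) C" for s C
    define post where "post s C \<longleftrightarrow> a < n - s \<longrightarrow> tube \<rho> (real s + real a) (real n) C" for s C
    define bad where "bad s = {\<omega> \<in> space M. (pre s (Z \<omega>) \<and> post s (Z \<omega>)) \<and> near_miss (boost (real s)) (deviation \<rho> n s) (Z \<omega>)}" for s
    have bad: "bad s \<in> events" "prob (bad s) \<le> padded \<rho> a s * padded \<rho> a (n - s) * (c * deviation \<rho> n s)"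
      if s: "s \<in> {4..n - 4}" for s
    proof -
      have sn: "s \<le> n" "real (n - s) = real n - real s" using s n by auto
      define D1 where "D1 = (if a < s then cball (base_pt 0) (real s - real a + 1) else {})"
      define D3 where "D3 = (if a < n - s then cball (base_pt (real n)) (real n - real s - real a + 1) else {})"
      define D2 where "D2 = cball (base_pt (real s)) 12"
      have w: "0 < deviation \<rho> n s" "deviation \<rho> n s \<le> 1"
      proof -
        show "0 < deviation \<rho> n s" unfolding deviation_def using \<rho>(1) by (intro mult_pos_pos add_pos_pos) auto
        have "deviation \<rho> n s \<le> 2 * exp 4 * \<rho> * (1 + 1)"
          unfolding deviation_def using \<rho>(1) by (intro mult_left_mono add_mono) auto
        then show "deviation \<rho> n s \<le> 1" using \<rho>(3) by simp
      qed
      have cl: "closed D1" "closed D3" by (auto simp: D1_def D3_def)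
      have pre: "localized D (pre s)" if "D1 \<subseteq> D" "closed D" for D
      proof (cases "a < s")
        case True
        then have "localized D (tube \<rho> 0 (real s - real a))"
          using that \<rho>(2) by (intro localized_tube disjI1) (auto simp: D1_def intro: order_trans[OF subset_cball])
        moreover have "pre s = tube \<rho> 0 (real s - real a)" using True by (simp add: pre_def fun_eq_iff)
        ultimately show ?thesis by simp
      next
        case False
        then have "pre s = (\<lambda>C. True)" by (simp add: pre_def fun_eq_iff)
        then show ?thesis by (simp add: localized_const)
      qed
      have post: "localized D (post s)" if "D3 \<subseteq> D" "closed D" for D
      proof (cases "a < n - s")
        case True
        then have "localized D (tube \<rho> (real s + real a) (real n))"
          using that \<rho>(2) sn by (intro localized_tube disjI2) (auto simp: D3_def intro: order_trans[OF subset_cball])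
        moreover have "post s = tube \<rho> (real s + real a) (real n)" using True by (simp add: post_def fun_eq_iff)
        ultimately show ?thesis by simp
      next
        case False
        then have "post s = (\<lambda>C. True)" by (simp add: post_def fun_eq_iff)
        then show ?thesis by (simp add: localized_const)
      qed
      have gp: "localized D2 (near_miss (boost (real s)) (deviation \<rho> n s))"
        unfolding D2_def by (rule localized_near_miss_boost[OF w(2)])
      have far12: "R \<le> dist x y" if "x \<in> D1" "y \<in> D2" for x y
      proof -
        have "real s = dist (base_pt 0) (base_pt (real s))" by (simp add: dist_base_pt)
        also have "\<dots> \<le> dist (base_pt 0) x + dist x y + dist y (base_pt (real s))"
          using dist_triangle[of "base_pt 0" "base_pt (real s)" x] dist_triangle[of x "base_pt (real s)" y] by linarith
        finally show ?thesis using that a(2) by (auto simp: D1_def D2_def dist_commute split: if_splits)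
      qed
      have far32: "R \<le> dist x y" if "x \<in> D3" "y \<in> D2" for x y
      proof -
        have "real n - real s = dist (base_pt (real n)) (base_pt (real s))" using sn by (simp add: dist_base_pt)
        also have "\<dots> \<le> dist (base_pt (real n)) x + dist x y + dist y (base_pt (real s))"
          using dist_triangle[of "base_pt (real n)" "base_pt (real s)" x] dist_triangle[of x "base_pt (real s)" y] by linarith
        finally show ?thesis using that a(2) by (auto simp: D3_def D2_def dist_commute split: if_splits)
      qed
      have far13: "R \<le> dist x y" if "x \<in> D1" "y \<in> D3" for x y
      proof -
        have "real n = dist (base_pt 0) (base_pt (real n))" by (simp add: dist_base_pt)
        also have "\<dots> \<le> dist (base_pt 0) x + dist x y + dist y (base_pt (real n))"
          using dist_triangle[of "base_pt 0" "base_pt (real n)" x] dist_triangle[of x "base_pt (real n)" y] by linarith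
        finally show ?thesis using that a(2) R(1) by (auto simp: D1_def D3_def dist_commute split: if_splits)
      qed
      have l13: "localized (D1 \<union> D3) (\<lambda>C. pre s C \<and> post s C)"
        by (intro localized_conj pre post closed_Un cl) auto
      have "prob (bad s) = prob {\<omega> \<in> space M. pre s (Z \<omega>) \<and> post s (Z \<omega>)} * prob {\<omega> \<in> space M. near_miss (boost (real s)) (deviation \<rho> n s) (Z \<omega>)}"
        unfolding bad_def by (rule R(2)[OF _ l13 gp]) (use far12 far32 in auto)
      also have "prob {\<omega> \<in> space M. pre s (Z \<omega>) \<and> post s (Z \<omega>)} = prob {\<omega> \<in> space M. pre s (Z \<omega>)} * prob {\<omega> \<in> space M. post s (Z \<omega>)}"
        by (rule R(2)[OF far13 pre[OF order_refl cl(1)] post[OF order_refl cl(2)]])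
      also have "prob {\<omega> \<in> space M. pre s (Z \<omega>)} = padded \<rho> a s"
      proof (cases "a < s")
        case True
        then show ?thesis unfolding pre_def padded_def tube_prob_def by (simp add: of_nat_diff)
      qed (simp add: pre_def padded_def prob_space)
      also have "prob {\<omega> \<in> space M. post s (Z \<omega>)} = padded \<rho> a (n - s)"
      proof (cases "a < n - s")
        case True
        then have "prob {\<omega> \<in> space M. post s (Z \<omega>)} = tube_prob \<rho> (n - s - a)"
          
            unfolding post_def using sn prob_link[of "base_pt (real s + real a)" "base_pt (real n)" "n - s - a" \<rho>]
            by (simp add: tube_eq_cross dist_base_pt)
        then show ?thesis using True by (simp add: padded_def)
      qed (simp add: post_def padded_def prob_space)
      also have "padded \<rho> a s * padded \<rho> a (n - s) * prob {\<omega> \<in> space M. near_miss (boost (real s)) (deviation \<rho> n s) (Z \<omega>)}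
          \<le> padded \<rho> a s * padded \<rho> a (n - s) * (c * deviation \<rho> n s)"
        by (intro mult_left_mono c(2) isometry_boost w) (auto simp: padded_def tube_prob_def)
      finally show "prob (bad s) \<le> padded \<rho> a s * padded \<rho> a (n - s) * (c * deviation \<rho> n s)" .
      have "localized UNIV (\<lambda>C. (pre s C \<and> post s C) \<and> near_miss (boost (real s)) (deviation \<rho> n s) C)"
        by (intro localized_conj pre post localized_near_miss isometry_boost) auto
      then show "bad s \<in> events" unfolding bad_def by (rule localized_UNIV_event)
    qed
    have "{\<omega> \<in> space M. tube \<rho> 0 (real n) (Z \<omega>)} \<subseteq> segment 4 (real n - 4) \<union> (\<Union>s\<in>{4..n - 4}. bad s)"
    proof
      fix \<omega> assume \<omega>: "\<omega> \<in> {\<omega> \<in> space M. tube \<rho> 0 (real n) (Z \<omega>)}"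
      show "\<omega> \<in> segment 4 (real n - 4) \<union> (\<Union>s\<in>{4..n - 4}. bad s)"
      proof (cases "seg (base_pt 4) (base_pt (real n - 4)) \<subseteq> Z \<omega>")
        case True
        then show ?thesis using \<omega> by (simp add: segment_def cross_def crossed_def)
      next
        case False
        then obtain s where "4 \<le> s" "s \<le> n - 4" "near_miss (boost (real s)) (deviation \<rho> n s) (Z \<omega>)" "pre s (Z \<omega>)" "post s (Z \<omega>)"
          using tube_near_miss[of \<rho> n "Z \<omega>" a] \<omega> \<rho>(1,2) n a(1) unfolding pre_def post_def by (metis (no_types, lifting) mem_Collect_eq)
        then show ?thesis using \<omega> by (auto simp: bad_def)
      qed
    qed
    then have "tube_prob \<rho> n \<le> prob (segment 4 (real n - 4) \<union> (\<Union>s\<in>{4..n - 4}. bad s))"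
      unfolding tube_prob_def using bad(1) by (intro finite_measure_mono sets.Un segment_events sets.finite_UN) auto
    also have "\<dots> \<le> prob (segment 4 (real n - 4)) + prob (\<Union>s\<in>{4..n - 4}. bad s)"
      using bad(1) by (intro measure_Un_le segment_events sets.finite_UN) auto
    also have "prob (segment 4 (real n - 4)) = seg_prob (n - 8)"
      using n by (intro prob_segment) (simp add: of_nat_diff)
    also have "prob (\<Union>s\<in>{4..n - 4}. bad s) \<le> (\<Sum>s=4..n - 4. prob (bad s))"
      using bad(1) by (intro measure_UNION_le) auto
    also have "\<dots> \<le> (\<Sum>s=4..n - 4. padded \<rho> a s * padded \<rho> a (n - s) * (c * deviation \<rho> n s))"
      by (intro sum_mono bad(2))
    finally show "tube_prob \<rho> n \<le> seg_prob (n - 8) + (\<Sum>s=4..n - 4. padded \<rho> a s * padded \<rho> a (n - s) * (c * deviation \<rho> n s))"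
      by simp
  qed
qed

text \<open>
  The constant \<open>K\<close> is twice the one forced by the main term of the recursion. The error term is
  quadratic in \<open>K\<close> but has a factor \<open>\<rho>\<close>, while \<open>a\<close> and \<open>c\<close> do not depend on \<open>\<rho>\<close>; so a small \<open>\<rho>\<close> lets the
  induction close with the same \<open>K\<close>.
\<close>

lemma tube_prob_le_seg_prob:
  assumes seg_prob_pos: "\<And>n. seg_prob n > 0"
  obtains \<rho> K where "0 < \<rho>" "\<rho> \<le> 1/8" "K > 0" "\<And>n. tube_prob \<rho> n \<le> K * seg_prob n"
proof -
  obtain a c where ac: "1 \<le> a" "c > 0"
    "\<And>\<rho> n. 0 < \<rho> \<Longrightarrow> \<rho> \<le> 1/8 \<Longrightarrow> 4 * exp 4 * \<rho> \<le> 1 \<Longrightarrow> 8 \<le> n \<Longrightarrow>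
      tube_prob \<rho> n \<le> seg_prob (n - 8) + (\<Sum>s=4..n - 4. padded \<rho> a s * padded \<rho> a (n - s) * (c * deviation \<rho> n s))"
    using tube_prob_recursion by blast
  define K where "K = 2 / seg_prob 8"
  have K: "K > 0" "K \<ge> 1" using seg_prob_pos[of 8] seg_prob_le_1[of 8] by (auto simp: K_def divide_simps)
  define B where "B = K\<^sup>2 * c * (8 * exp 4) / (seg_prob a)\<^sup>2"
  have B: "B > 0" unfolding B_def using K ac seg_prob_pos[of a] by simp
  define \<rho> where "\<rho> = min (min (1/8) (1 / (4 * exp 4))) (1 / (seg_prob 8 * B))"
  have \<rho>: "0 < \<rho>" "\<rho> \<le> 1/8" "4 * exp 4 * \<rho> \<le> 1" "B * \<rho> \<le> 1 / seg_prob 8"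
  proof -
    show "0 < \<rho>" using B seg_prob_pos[of 8] by (simp add: \<rho>_def)
    show "\<rho> \<le> 1/8" by (simp add: \<rho>_def)
    have "\<rho> \<le> 1 / (4 * exp 4)" by (simp add: \<rho>_def)
    then show "4 * exp 4 * \<rho> \<le> 1" by (simp add: field_simps)
    have "\<rho> \<le> 1 / (seg_prob 8 * B)" by (simp add: \<rho>_def)
    then show "B * \<rho> \<le> 1 / seg_prob 8" using B seg_prob_pos[of 8] by (simp add: field_simps)
  qed
  define F where "F k = (if k \<le> a then 1 else seg_prob (k - a))" for k
  have F: "F k * seg_prob a \<le> seg_prob k" for k
  proof (cases "k \<le> a")
    case True then show ?thesis using seg_prob_antimono by (simp add: F_def)
  next
    case False then show ?thesis using seg_prob_add[of "k - a" a] by (simp add: F_def)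
  qed
  have F0: "0 \<le> F k" for k by (simp add: F_def seg_prob_nonneg)
  have FF: "F s * F (n - s) \<le> seg_prob n / (seg_prob a)\<^sup>2" if "s \<le> n" for s n
  proof -
    have "(F s * seg_prob a) * (F (n - s) * seg_prob a) \<le> seg_prob s * seg_prob (n - s)"
      by (intro mult_mono F) (auto simp: seg_prob_nonneg F0)
    also have "\<dots> \<le> seg_prob n" using seg_prob_add[of s "n - s"] that by simp
    finally show ?thesis using seg_prob_pos[of a] by (simp add: field_simps power2_eq_square)
  qed
  have "tube_prob \<rho> n \<le> K * seg_prob n" for n
  proof (induction n rule: less_induct)
    case (less n)
    show ?case
    proof (cases "8 \<le> n")
      case False
      then have "seg_prob 8 \<le> seg_prob n" by (intro seg_prob_antimono) simp
      then have "1 \<le> K * seg_prob n" using seg_prob_pos[of 8] by (simp add: K_def field_simps)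
      moreover have "tube_prob \<rho> n \<le> 1" by (simp add: tube_prob_def)
      ultimately show ?thesis by linarith
    next
      case True
      have QF: "padded \<rho> a k \<le> K * F k" if "k \<le> n" for k
        using less.IH[of "k - a"] that ac(1) K(2) by (auto simp: padded_def F_def)
      have "padded \<rho> a s * padded \<rho> a (n - s) * (c * deviation \<rho> n s) \<le> (K\<^sup>2 * c * seg_prob n / (seg_prob a)\<^sup>2) * deviation \<rho> n s"
        if "s \<in> {4..n - 4}" for s
      proof -
        have sn: "s \<le> n" using that by auto
        have "padded \<rho> a s * padded \<rho> a (n - s) \<le> (K * F s) * (K * F (n - s))"
          using K sn by (intro mult_mono QF) (auto simp: padded_def tube_prob_def F0)
        also have "\<dots> = K\<^sup>2 * (F s * F (n - s))" by (simp add: power2_eq_square)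
        also have "\<dots> \<le> K\<^sup>2 * (seg_prob n / (seg_prob a)\<^sup>2)" by (intro mult_left_mono FF sn) auto
        finally have "padded \<rho> a s * padded \<rho> a (n - s) * (c * deviation \<rho> n s) \<le> K\<^sup>2 * (seg_prob n / (seg_prob a)\<^sup>2) * (c * deviation \<rho> n s)"
          using ac(2) \<rho>(1) by (intro mult_right_mono) (auto simp: deviation_def)
        then show ?thesis by (simp add: algebra_simps)
      qed
      then have "(\<Sum>s=4..n - 4. padded \<rho> a s * padded \<rho> a (n - s) * (c * deviation \<rho> n s))
          \<le> (\<Sum>s=4..n - 4. (K\<^sup>2 * c * seg_prob n / (seg_prob a)\<^sup>2) * deviation \<rho> n s)"
        by (rule sum_mono)
      also have "\<dots> = (K\<^sup>2 * c * seg_prob n / (seg_prob a)\<^sup>2) * (\<Sum>s=4..n - 4. deviation \<rho> n s)"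
        by (simp add: sum_distrib_left)
      also have "\<dots> \<le> (K\<^sup>2 * c * seg_prob n / (seg_prob a)\<^sup>2) * (8 * exp 4 * \<rho>)"
        using ac(2) \<rho>(1) by (intro mult_left_mono sum_deviation_le) (auto simp: seg_prob_nonneg)
      also have "\<dots> = B * \<rho> * seg_prob n" by (simp add: B_def)
      also have "\<dots> \<le> 1 / seg_prob 8 * seg_prob n" by (intro mult_right_mono \<rho> seg_prob_nonneg)
      finally have s: "(\<Sum>s=4..n - 4. padded \<rho> a s * padded \<rho> a (n - s) * (c * deviation \<rho> n s)) \<le> seg_prob n / seg_prob 8" by simp
      have "seg_prob (n - 8) * seg_prob 8 \<le> seg_prob n" using seg_prob_add[of "n - 8" 8] True by simp
      then have "seg_prob (n - 8) \<le> seg_prob n / seg_prob 8" using seg_prob_pos[of 8] by (simp add: field_simps)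
      then show ?thesis using s ac(3)[OF \<rho>(1-3) True] by (simp add: K_def)
    qed
  qed
  then show thesis using that \<rho> K by blast
qed

end

section \<open>Counting on spheres and extinction\<close>

lemma one_minus_cos_le: "1 - cos x \<le> x\<^sup>2 / (2 :: real)"
proof -
  have "1 - cos x = 2 * (sin (x / 2))\<^sup>2" using cos_double_sin[of "x / 2"] by simp
  also have "(sin (x / 2))\<^sup>2 \<le> (x / 2)\<^sup>2"
    using abs_sin_x_le_abs_x[of "x / 2"] by (simp only: abs_le_square_iff)
  finally show ?thesis by (simp add: power2_eq_square)
qed

lemma cosh_ge_quadratic: "1 + x\<^sup>2 / 2 \<le> cosh (x :: real)"
proof -
  have "\<bar>x\<bar> / 2 \<le> sinh (\<bar>x\<bar> / 2)"
    using real_le_x_sinh[of "\<bar>x\<bar> / 2"] by (simp add: sinh_def exp_minus)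
  then have "(\<bar>x\<bar> / 2)\<^sup>2 \<le> (sinh (\<bar>x\<bar> / 2))\<^sup>2" by (intro power_mono) auto
  moreover have "cosh \<bar>x\<bar> = 1 + 2 * (sinh (\<bar>x\<bar> / 2))\<^sup>2"
    using cosh_double_cosh[of "\<bar>x\<bar> / 2"] by (simp add: cosh_square_eq)
  ultimately show ?thesis by (simp add: power_divide)
qed

text \<open>
  The length of the circle of radius \<open>n\<close> is \<open>2 pi sinh n\<close>; equally spaced points at arc distance at most \<open>\<rho>\<close>
  form a net.
\<close>

lemma sphere_net_origin:
  assumes "0 < \<rho>"
  obtains N where "finite N" "real (card N) \<le> (2 * pi / \<rho> + 2) * exp (real n)"
    "\<And>c. c \<in> N \<Longrightarrow> dist (base_pt 0) c = real n"
    "\<And>y. dist (base_pt 0) y = real n \<Longrightarrow> \<exists>c\<in>N. dist c y \<le> \<rho>"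
proof -
  define r where "r = real n"
  define J where "J = nat \<lceil>2 * pi * sinh r / \<rho>\<rceil> + 1"
  have s0: "sinh r \<ge> 0" by (simp add: r_def)
  have J: "2 * pi * sinh r / \<rho> \<le> real J" unfolding J_def by linarith
  have J0: "J > 0" by (simp add: J_def)
  define N where "N = (\<lambda>j. rot (2 * pi * real j / real J) (base_pt r)) ` {..<J}"
  show thesis
  proof (rule that[of N])
    show "finite N" by (simp add: N_def)
    have "card N \<le> J" unfolding N_def by (metis card_image_le card_lessThan finite_lessThan)
    then have "real (card N) \<le> real J" by simp
    also have "\<dots> \<le> 2 * pi * sinh r / \<rho> + 2"
    proof -
      have "0 \<le> 2 * pi * sinh r / \<rho>" using s0 assms by simp
      then show ?thesis unfolding J_def by linarith
    qed
    also have "\<dots> \<le> 2 * pi / \<rho> * exp r + 2 * exp r"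
    proof -
      have "sinh r \<le> exp r" using cosh_plus_sinh[of r] cosh_real_pos[of r] by linarith
      then have "2 * pi / \<rho> * sinh r \<le> 2 * pi / \<rho> * exp r" using assms by (intro mult_left_mono) auto
      moreover have "1 \<le> exp r" by (simp add: r_def)
      ultimately have "2 * pi / \<rho> * sinh r + 2 \<le> 2 * pi / \<rho> * exp r + 2 * exp r" by linarith
      then show ?thesis by simp
    qed
    finally show "real (card N) \<le> (2 * pi / \<rho> + 2) * exp (real n)" by (simp add: r_def algebra_simps)
    have d: "dist (base_pt 0) (rot t (base_pt r)) = r" for t
    proof -
      have "rot t (base_pt 0) = base_pt 0" by (rule hyperboloid_eqI) auto
      then have "dist (base_pt 0) (rot t (base_pt r)) = dist (base_pt 0) (base_pt r)"
        using isometry_dist[OF isometry_rot, of t "base_pt 0" "base_pt r"] by simp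
      then show ?thesis by (simp add: dist_base_pt r_def)
    qed
    then show "dist (base_pt 0) c = real n" if "c \<in> N" for c using that by (auto simp: N_def r_def)
    fix y assume "dist (base_pt 0) y = real n"
    then have ht: "ht y = cosh r" using cosh_dist[of "base_pt 0" y] by (simp add: lorentz_def r_def)
    have sq: "(hx y)\<^sup>2 + (hy y)\<^sup>2 = (sinh r)\<^sup>2" using lorentz_self[of y] by (simp add: ht cosh_square_eq)
    obtain t where t: "0 \<le> t" "t < 2 * pi" "hx y = sinh r * cos t" "hy y = sinh r * sin t"
    proof (cases "sinh r = 0")
      case True
      then have "hx y = 0 \<and> hy y = 0" using sq by (simp add: sum_power2_eq_zero_iff)
      then show thesis using True by (intro that[of 0]) auto
    next
      case False
      then have "(hx y / sinh r)\<^sup>2 + (hy y / sinh r)\<^sup>2 = 1"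
        using sq by (simp add: power_divide add_divide_distrib[symmetric])
      then obtain t where "0 \<le> t" "t < 2 * pi" "hx y / sinh r = cos t" "hy y / sinh r = sin t"
        using sincos_total_2pi by metis
      then show thesis using False by (intro that[of t]) (auto simp: field_simps)
    qed
    define j where "j = nat \<lfloor>t * real J / (2 * pi)\<rfloor>"
    have x0: "0 \<le> t * real J / (2 * pi)" using t by simp
    have xJ: "t * real J / (2 * pi) < real J" using t J0 by (simp add: field_simps)
    have j: "real j \<le> t * real J / (2 * pi)" "t * real J / (2 * pi) < real j + 1"
      unfolding j_def using x0 by linarith+
    have jJ: "j < J" using j(1) xJ by linarith
    define \<Delta> where "\<Delta> = t - 2 * pi * real j / real J"
    have D0: "0 \<le> \<Delta>" unfolding \<Delta>_def using j(1) J0 by (simp add: field_simps)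
    have "\<Delta> * real J \<le> 2 * pi"
    proof -
      have "t * real J < (real j + 1) * (2 * pi)" using j(2) by (simp add: field_simps)
      then show ?thesis unfolding \<Delta>_def using J0 by (simp add: algebra_simps)
    qed
    moreover have "\<Delta> * (2 * pi * sinh r / \<rho>) \<le> \<Delta> * real J" using J D0 by (intro mult_left_mono)
    ultimately have "\<Delta> * (2 * pi * sinh r / \<rho>) \<le> 2 * pi" by linarith
    then have Ds: "\<Delta> * sinh r \<le> \<rho>" using assms by (simp add: field_simps)
    define c where "c = rot (2 * pi * real j / real J) (base_pt r)"
    have cj: "c \<in> N" using jJ by (auto simp: N_def c_def)
    have "cosh (dist c y) = (cosh r)\<^sup>2 - (sinh r)\<^sup>2 * cos \<Delta>"
      by (simp add: cosh_dist lorentz_def c_def ht t \<Delta>_def cos_diff power2_eq_square algebra_simps)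
    also have "\<dots> = 1 + (sinh r)\<^sup>2 * (1 - cos \<Delta>)" by (simp add: cosh_square_eq algebra_simps)
    also have "\<dots> \<le> 1 + (sinh r)\<^sup>2 * (\<Delta>\<^sup>2 / 2)"
      by (intro add_left_mono mult_left_mono one_minus_cos_le) auto
    also have "\<dots> = 1 + (\<Delta> * sinh r)\<^sup>2 / 2" by (simp add: power_mult_distrib)
    also have "\<dots> \<le> 1 + \<rho>\<^sup>2 / 2" using Ds D0 s0 by (intro add_left_mono divide_right_mono power_mono) auto
    also have "\<dots> \<le> cosh \<rho>" by (rule cosh_ge_quadratic)
    finally have "dist c y \<le> \<rho>" using assms by (simp add: cosh_real_nonneg_le_iff)
    then show "\<exists>c\<in>N. dist c y \<le> \<rho>" using cj by blast
  qed
qed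

lemma sphere_nets:
  assumes "0 < \<rho>"
  obtains N :: "hyperbolic_plane \<Rightarrow> nat \<Rightarrow> hyperbolic_plane set" and K where "K > 0" "\<And>z n. finite (N z n)" "\<And>z n. real (card (N z n)) \<le> K * exp (real n)"
    "\<And>z n c. c \<in> N z n \<Longrightarrow> dist z c = real n"
    "\<And>z n y. dist z y = real n \<Longrightarrow> \<exists>c\<in>N z n. dist c y \<le> \<rho>"
proof -
  define K where "K = 2 * pi / \<rho> + 2"
  define net where "net z n N \<longleftrightarrow> finite N \<and> real (card N) \<le> K * exp (real n) \<and>
      (\<forall>c\<in>N. dist z c = real n) \<and> (\<forall>y. dist z y = real n \<longrightarrow> (\<exists>c\<in>N. dist c y \<le> \<rho>))"
    for z :: hyperbolic_plane and n and N
  have "\<exists>N. net z n N" for z n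
  proof -
    obtain N where N: "net (base_pt 0) n N"
      using sphere_net_origin[OF assms, of n] unfolding net_def K_def by metis
    obtain \<phi> where \<phi>: "isometry \<phi>" "\<phi> (base_pt 0) = z"
      by (rule two_point_homogeneous[of "base_pt 0" "base_pt 0" z z]) simp_all
    have "net z n (\<phi> ` N)"
      unfolding net_def
    proof (intro conjI ballI allI impI)
      show "finite (\<phi> ` N)" using N by (simp add: net_def)
      have "card (\<phi> ` N) \<le> card N" using N by (intro card_image_le) (simp add: net_def)
      then show "real (card (\<phi> ` N)) \<le> K * exp (real n)" using N unfolding net_def by linarith
      show "dist z c = real n" if "c \<in> \<phi> ` N" for c
        using that N \<phi> by (auto simp: net_def isometry_dist simp flip: \<phi>(2))
      fix y assume "dist z y = real n"
      then have "dist (base_pt 0) (inv \<phi> y) = real n"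
        using isometry_dist[OF \<phi>(1), of "base_pt 0" "inv \<phi> y"] \<phi> by simp
      then obtain c where "c \<in> N" "dist c (inv \<phi> y) \<le> \<rho>" using N unfolding net_def by blast
      then show "\<exists>c\<in>\<phi> ` N. dist c y \<le> \<rho>"
        using isometry_dist[OF \<phi>(1), of c "inv \<phi> y"] \<phi>(1) by (intro bexI[of _ "\<phi> c"]) auto
    qed
    then show ?thesis by blast
  qed
  then obtain N where "\<And>z n. net z n (N z n)" by metis
  moreover have "K > 0" unfolding K_def using assms by (intro add_pos_pos) auto
  ultimately show thesis using that[of K N] unfolding net_def by blast
qed

lemma seg_split_dist:
  assumes "p \<in> seg x y" "p' \<in> seg p y"
  shows "dist x p' = dist x p + dist p p'"
  using assms dist_triangle[of x p' p] dist_triangle[of x y p'] by (simp add: seg_def)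

text \<open>
  The net points of the sphere of radius \<open>n\<close> about \<open>z\<close> near which the view from the ball of radius \<open>\<rho>\<close> about \<open>z\<close>
  reaches.
\<close>

definition reached :: "(hyperbolic_plane \<Rightarrow> nat \<Rightarrow> hyperbolic_plane set) \<Rightarrow> real \<Rightarrow> hyperbolic_plane \<Rightarrow>
    nat \<Rightarrow> hyperbolic_plane set \<Rightarrow> hyperbolic_plane set" where
  "reached N \<rho> z n C = {c \<in> N z n. crossed (cball z \<rho>) (cball c \<rho>) C}"

context
  fixes N :: "hyperbolic_plane \<Rightarrow> nat \<Rightarrow> hyperbolic_plane set" and \<rho> :: real
  assumes \<rho>: "0 < \<rho>" "\<rho> \<le> 1/8"
    and net: "\<And>z n c. c \<in> N z n \<Longrightarrow> dist z c = real n"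
      "\<And>z n y. dist z y = real n \<Longrightarrow> \<exists>c\<in>N z n. dist c y \<le> \<rho>"
begin

lemma seg_meets_net:
  assumes "dist z x \<le> \<rho>" "1 \<le> n" "real n \<le> dist z y"
  obtains p c where "p \<in> seg x y" "dist z p = real n" "c \<in> N z n" "dist c p \<le> \<rho>"
proof -
  obtain p where "p \<in> seg x y" "dist z p = real n"
    using assms \<rho> by (rule_tac seg_IVT[of "dist z" x "real n" y]) (auto intro!: continuous_intros)
  then show thesis using net(2) that by blast
qed

lemma reached_nonempty:
  assumes "dist z x \<le> \<rho>" "1 \<le> n" "real n \<le> dist z y" "seg x y \<subseteq> C"
  shows "reached N \<rho> z n C \<noteq> {}"
proof -
  obtain p c where pc: "p \<in> seg x y" "dist z p = real n" "c \<in> N z n" "dist c p \<le> \<rho>"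
    using seg_meets_net[OF assms(1-3)] .
  have "seg x p \<subseteq> C" using subseg[OF seg_ends(1) pc(1)] assms(4) by blast
  then have "crossed (cball z \<rho>) (cball c \<rho>) C"
    unfolding crossed_def using assms(1) pc(4) by force
  then show ?thesis using pc(3) by (auto simp: reached_def)
qed

text \<open>
  A view beyond radius \<open>n\<close> passes a reached net point \<open>c\<close>, then a net point \<open>c1\<close> of the sphere of
  radius \<open>T\<close> about \<open>c\<close>, then one of the sphere of radius \<open>k\<close> about \<open>c1\<close>. For large \<open>T\<close> the last step is
  far from what decides whether \<open>c\<close> is reached, and given \<open>c\<close> there are boundedly many candidates for it.
\<close>

lemma reached_continues:
  assumes ne: "reached N \<rho> z (n + (T + k + 1)) C \<noteq> {}" and "1 \<le> n" "1 \<le> T" "1 \<le> k"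
  shows "\<exists>c\<in>reached N \<rho> z n C. \<exists>c1\<in>N c T. real n + real T - 1 \<le> dist z c1 \<and>
    (\<exists>c2\<in>N c1 k. crossed (cball c1 \<rho>) (cball c2 \<rho>) C)"
proof -
  obtain c' x y where c': "c' \<in> N z (n + (T + k + 1))" and x: "dist z x \<le> \<rho>" and y: "dist c' y \<le> \<rho>"
    and xy: "seg x y \<subseteq> C"
    using ne by (auto simp: reached_def crossed_def)
  have zy: "real n + real T + real k + 1 - \<rho> \<le> dist z y"
    using net(1)[OF c'] dist_triangle[of z c' y] y by (simp add: dist_commute)
  have "real n \<le> dist z y" using zy \<rho> by linarith
  then obtain p c where p: "p \<in> seg x y" "dist z p = real n" "c \<in> N z n" "dist c p \<le> \<rho>"
    using seg_meets_net[OF x assms(2)] by blast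
  have "seg x p \<subseteq> C" using subseg[OF seg_ends(1) p(1)] xy by blast
  then have c: "c \<in> reached N \<rho> z n C"
    using x p(3,4) unfolding reached_def crossed_def by force
  have cy: "real T + real k + 1 - \<rho> \<le> dist c y"
    using zy dist_triangle[of z y c] net(1)[OF p(3)] by linarith
  have "real T \<le> dist c y" using cy \<rho> by linarith
  then obtain p1 c1 where p1: "p1 \<in> seg p y" "dist c p1 = real T" "c1 \<in> N c T" "dist c1 p1 \<le> \<rho>"
    using seg_meets_net[OF p(4) assms(3)] by blast
  have p1': "p1 \<in> seg x y" using subseg[OF p(1) seg_ends(2)] p1(1) by blast
  have "real k \<le> dist c1 y"
    using cy dist_triangle[of c y c1] net(1)[OF p1(3)] \<rho> by linarith
  then obtain p2 c2 where p2: "p2 \<in> seg p1 y" "c2 \<in> N c1 k" "dist c2 p2 \<le> \<rho>"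
    using seg_meets_net[OF p1(4) assms(4)] by blast
  have "seg p1 p2 \<subseteq> C"
    using subseg[OF p1' seg_ends(2)] subseg[OF seg_ends(1) p2(1)] xy by blast
  then have "crossed (cball c1 \<rho>) (cball c2 \<rho>) C"
    unfolding crossed_def using p1(4) p2(3) by force
  moreover have "real n + real T - 1 \<le> dist z c1"
  proof -
    have "dist x p1 = dist x p + dist p p1" by (rule seg_split_dist[OF p(1) p1(1)])
    moreover have "dist z p \<le> dist z x + dist x p" "dist c p1 \<le> dist c p + dist p p1"
      "dist x p1 \<le> dist z x + dist z p1" "dist z p1 \<le> dist z c1 + dist c1 p1"
      using dist_triangle[of z p x] dist_triangle[of c p1 p] dist_triangle[of x p1 z] dist_triangle[of z p1 c1]
      by (simp_all add: dist_commute)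
    ultimately show ?thesis using p p1 x \<rho> by linarith
  qed
  ultimately show ?thesis using c p1(3) p2(2) by blast
qed

end

context well_behaved_percolation
begin

text \<open>Markov's inequality for the number of events that occur.\<close>

lemma sum_prob_card:
  assumes "finite F" "\<And>i. i \<in> F \<Longrightarrow> A i \<in> events"
  shows "(\<Sum>i\<in>F. prob (A i)) \<ge> real k * prob {\<omega> \<in> space M. k \<le> card {i \<in> F. \<omega> \<in> A i}}"
proof -
  define X where "X \<omega> = (\<Sum>i\<in>F. indicat_real (A i) \<omega>)" for \<omega>
  have X: "X \<omega> = real (card {i \<in> F. \<omega> \<in> A i})" for \<omega>
    unfolding X_def using assms(1) by (simp add: indicator_def sum.If_cases Int_def)
  have Xm: "X \<in> borel_measurable M"
    unfolding X_def using assms(2) by (intro borel_measurable_sum borel_measurable_indicator)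
  define B where "B = {\<omega> \<in> space M. real k \<le> X \<omega>}"
  have B: "B \<in> events" unfolding B_def using Xm by measurable
  have "real k * prob B = expectation (\<lambda>\<omega>. real k * indicat_real B \<omega>)" using B by simp
  also have "\<dots> \<le> expectation X"
  proof (rule integral_mono)
    show "integrable M (\<lambda>\<omega>. real k * indicat_real B \<omega>)"
      using B by (intro integrable_mult_right integrable_real_indicator) (auto simp: emeasure_eq_measure)
    show "integrable M X"
      unfolding X_def using assms
      by (intro Bochner_Integration.integrable_sum integrable_real_indicator) (auto simp: emeasure_eq_measure)
    show "real k * indicat_real B \<omega> \<le> X \<omega>" for \<omega>
      using X[of \<omega>] unfolding indicator_def by (auto simp: B_def)
  qed
  also have "expectation X = (\<Sum>i\<in>F. prob (A i))"
    unfolding X_def using assms by (subst Bochner_Integration.integral_sum) (auto simp: emeasure_eq_measure)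
  finally show ?thesis by (simp add: B_def X)
qed

text \<open>
  Let \<open>S n\<close> be the event that the view reaches radius \<open>n\<close>. By the first-moment bound at most \<open>m\<close> net points
  are reached, except with probability \<open>K0 * K1 / m\<close>. Given which ones, all continuations are blocked with
  probability at least \<open>\<delta> > 0\<close>. If \<open>prob (S n)\<close> did not tend to \<open>0\<close>, it would thus drop by a
  fixed amount infinitely often.
\<close>

lemma extinction:
  assumes seg_prob_pos: "\<And>n. seg_prob n > 0" and seg_prob_le: "\<And>n. seg_prob n \<le> exp (- real n)"
  obtains \<rho> where "0 < \<rho>"
    "\<And>z. AE \<omega> in M. \<not> (\<forall>n\<ge>1. \<exists>x y. dist z x \<le> \<rho> \<and> real n \<le> dist z y \<and> seg x y \<subseteq> Z \<omega>)"
proof -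
  obtain \<rho> K0 where \<rho>: "0 < \<rho>" "\<rho> \<le> 1/8" and K0: "K0 > 0" "\<And>n. tube_prob \<rho> n \<le> K0 * seg_prob n"
    using tube_prob_le_seg_prob[OF seg_prob_pos] by blast
  have q: "tube_prob \<rho> n \<le> K0 * exp (- real n)" for n
    using K0(2)[of n] mult_left_mono[OF seg_prob_le[of n], of K0] K0(1) by linarith
  obtain N :: "hyperbolic_plane \<Rightarrow> nat \<Rightarrow> hyperbolic_plane set" and K1
    where K1: "K1 > 0" and N: "\<And>z n. finite (N z n)" "\<And>z n. real (card (N z n)) \<le> K1 * exp (real n)"
    "\<And>z n c. c \<in> N z n \<Longrightarrow> dist z c = real n"
    "\<And>z n y. dist z y = real n \<Longrightarrow> \<exists>c\<in>N z n. dist c y \<le> \<rho>"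
    using sphere_nets[OF \<rho>(1)] by metis
  obtain R where R: "R \<ge> 1"
    "\<And>D D' E E'. (\<And>a a'. a \<in> D \<Longrightarrow> a' \<in> D' \<Longrightarrow> R \<le> dist a a') \<Longrightarrow> localized D E \<Longrightarrow> localized D' E' \<Longrightarrow>
      prob {\<omega> \<in> space M. E (Z \<omega>) \<and> E' (Z \<omega>)} = prob {\<omega> \<in> space M. E (Z \<omega>)} * prob {\<omega> \<in> space M. E' (Z \<omega>)}"
    using localized_independent by blast
  have "(\<lambda>k. K0 * exp (- real k)) \<longlonglongrightarrow> 0" by real_asymp
  then have "\<forall>\<^sub>F k in sequentially. K0 * exp (- real k) < 1/2" by (rule order_tendstoD) simp
  then obtain k where k: "1 \<le> k" "K0 * exp (- real k) < 1/2"
    unfolding eventually_sequentially by (metis le_cases)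
  \<comment> \<open>leaves distance \<open>R\<close> between the views up to radius \<open>n + 1\<close> and the crossings that start beyond \<open>n + T - 1\<close>\<close>
  define T where "T = nat \<lceil>R\<rceil> + k + 4"
  have T: "1 \<le> T" "R + real k + 4 \<le> real T" unfolding T_def using R(1) by linarith+
  define J1 where "J1 = nat \<lfloor>K1 * exp (real T)\<rfloor>"
  define J2 where "J2 = nat \<lfloor>K1 * exp (real k)\<rfloor>"
  have J: "card (N c T) \<le> J1" "card (N c k) \<le> J2" for c
    unfolding J1_def J2_def using N(2)[of c T] N(2)[of c k] by linarith+
  show thesis
  proof (rule that[OF \<rho>(1)])
    fix z
    define H where "H n C = reached N \<rho> z n C" for n C
    define S where "S n = {\<omega> \<in> space M. H n (Z \<omega>) \<noteq> {}}" for n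
    have HN: "H n C \<subseteq> N z n" for n C by (auto simp: H_def reached_def)
    have link_sub: "seg x y \<subseteq> cball c (real m + 1)"
      if "dist c c' = real m" "x \<in> cball c \<rho>" "y \<in> cball c' \<rho>" for c c' m x y
      using seg_of_balls_subset[OF that(2,3)] that(1) \<rho>(2) by (auto intro: order_trans[OF _ subset_cball])
    have loc_link: "localized D (crossed (cball c \<rho>) (cball c' \<rho>))"
      if "dist c c' = real m" "closed D" "cball c (real m + 1) \<subseteq> D" for c c' m D
      using link_sub[OF that(1)] that(2,3)
      by (intro localized_crossed compact_cball_hyperbolic) blast+
    have loc_H: "localized D (\<lambda>C. H n C = I)" if "closed D" "cball z (real n + 1) \<subseteq> D" "I \<subseteq> N z n" for D n I
    proof -
      have eq: "(\<lambda>C. H n C = I) = (\<lambda>C. \<forall>c\<in>N z n. crossed (cball z \<rho>) (cball c \<rho>) C \<longleftrightarrow> c \<in> I)"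
        using that(3) by (auto simp: H_def reached_def fun_eq_iff)
      show ?thesis
        unfolding eq using that(1,2)
        by (intro localized_ball N(1) localized_iff_const loc_link[OF N(3)]) auto
    qed
    have ev_H: "{\<omega> \<in> space M. H n (Z \<omega>) = I} \<in> events" if "I \<subseteq> N z n" for n I
      using that by (intro localized_UNIV_event loc_H) auto
    have ev_HP: "{\<omega> \<in> space M. P (H n (Z \<omega>))} \<in> events" for n P
    proof -
      have "{\<omega> \<in> space M. P (H n (Z \<omega>))} = (\<Union>I\<in>{I. I \<subseteq> N z n \<and> P I}. {\<omega> \<in> space M. H n (Z \<omega>) = I})"
        using HN by auto
      also have "\<dots> \<in> events" using ev_H N(1) by (intro sets.finite_UN) auto
      finally show ?thesis .
    qed
    have S: "S n \<in> events" for n unfolding S_def by (rule ev_HP)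
    have Smono: "S (n + j) \<subseteq> S n" if "1 \<le> n" for n j
    proof
      fix \<omega> assume "\<omega> \<in> S (n + j)"
      then obtain c x y where w: "\<omega> \<in> space M" "c \<in> N z (n + j)" "dist z x \<le> \<rho>" "dist c y \<le> \<rho>" "seg x y \<subseteq> Z \<omega>"
        by (auto simp: S_def H_def reached_def crossed_def)
      show "\<omega> \<in> S n"
      proof (cases "j = 0")
        case True
        then show ?thesis using \<open>\<omega> \<in> S (n + j)\<close> by simp
      next
        case False
        then have "real n + 1 \<le> dist z c" using N(3)[OF w(2)] by simp
        then have "real n \<le> dist z y" using dist_triangle[of z c y] w(4) \<rho> by (simp add: dist_commute)
        then show ?thesis
          unfolding S_def H_def using reached_nonempty[where N = N, OF \<rho> N(3,4) w(3) that _ w(5)] w(1) by blast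
      qed
    qed
    have mean: "real m * prob {\<omega> \<in> space M. m \<le> card (H n (Z \<omega>))} \<le> K0 * K1" for n m
    proof -
      define A where "A c = cross (cball z \<rho>) (cball c \<rho>)" for c
      have "real m * prob {\<omega> \<in> space M. m \<le> card {c \<in> N z n. \<omega> \<in> A c}} \<le> (\<Sum>c\<in>N z n. prob (A c))"
        unfolding A_def by (intro sum_prob_card N(1) cross_events compact_cball_hyperbolic)
      also have "\<dots> \<le> (\<Sum>c\<in>N z n. K0 * exp (- real n))"
        unfolding A_def using q N(3) by (intro sum_mono) (simp add: prob_link)
      also have "\<dots> = real (card (N z n)) * (K0 * exp (- real n))" by simp
      also have "\<dots> \<le> (K1 * exp (real n)) * (K0 * exp (- real n))"
        using K0(1) by (intro mult_right_mono N(2)) auto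
      also have "\<dots> = K0 * K1" by (simp add: exp_minus)
      finally have "real m * prob {\<omega> \<in> space M. m \<le> card {c \<in> N z n. \<omega> \<in> A c}} \<le> K0 * K1" .
      moreover have "{\<omega> \<in> space M. m \<le> card {c \<in> N z n. \<omega> \<in> A c}} = {\<omega> \<in> space M. m \<le> card (H n (Z \<omega>))}"
        by (auto simp: A_def cross_def H_def reached_def)
      ultimately show ?thesis by simp
    qed
    have drop: "prob (S (n + (T + k + 1))) \<le> prob (S n) - (1/2) ^ (m * J1 * J2) * (prob (S n) - K0 * K1 / real m)"
      if n: "1 \<le> n" and m: "0 < m" for n m
    proof -
      define \<delta> where "\<delta> = (1/2 :: real) ^ (m * J1 * J2)"
      \<comment> \<open>the pairs of balls through which a view passing near \<open>c\<close> may continue\<close>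
      define X where "X c = (SIGMA c1 : {c1 \<in> N c T. real n + real T - 1 \<le> dist z c1}. N c1 k)" for c
      define Y where "Y I = (\<Union>c\<in>I. X c)" for I
      define blocked where "blocked I C \<longleftrightarrow> (\<forall>p\<in>Y I. \<not> crossed (cball (fst p) \<rho>) (cball (snd p) \<rho>) C)" for I C
      define \<I> where "\<I> = {I. I \<subseteq> N z n \<and> I \<noteq> {} \<and> card I \<le> m}"
      define G where "G I = {\<omega> \<in> space M. H n (Z \<omega>) = I \<and> blocked I (Z \<omega>)}" for I
      have X: "finite (X c)" "card (X c) \<le> J1 * J2" for c
      proof -
        show "finite (X c)" unfolding X_def using N(1) by auto
        have "card (X c) = (\<Sum>c1\<in>{c1 \<in> N c T. real n + real T - 1 \<le> dist z c1}. card (N c1 k))"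
          unfolding X_def using N(1) by (intro card_SigmaI) auto
        also have "\<dots> \<le> (\<Sum>c1\<in>N c T. card (N c1 k))" using N(1) by (intro sum_mono2) auto
        also have "\<dots> \<le> (\<Sum>c1\<in>N c T. J2)" by (intro sum_mono J(2))
        also have "\<dots> \<le> J1 * J2" using J(1) by simp
        finally show "card (X c) \<le> J1 * J2" .
      qed
      have finI: "finite \<I>" unfolding \<I>_def using N(1)[of z n] by (auto intro: finite_subset[of _ "Pow (N z n)"])
      have IY: "finite I" "finite (Y I)" "card (Y I) \<le> m * J1 * J2" if "I \<in> \<I>" for I
      proof -
        show fI: "finite I" using that N(1) finite_subset unfolding \<I>_def by blast
        then show "finite (Y I)" unfolding Y_def using X by auto
        have "card (Y I) \<le> (\<Sum>c\<in>I. card (X c))" unfolding Y_def by (rule card_UN_le[OF fI])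
        also have "\<dots> \<le> (\<Sum>c\<in>I. J1 * J2)" by (intro sum_mono X)
        also have "\<dots> \<le> m * (J1 * J2)" using that by (simp add: \<I>_def)
        finally show "card (Y I) \<le> m * J1 * J2" by (simp add: mult.assoc)
      qed
      define D where "D = cball z (real n + 1)"
      define D' where "D' = {p. real n + real T - real k - 2 \<le> dist z p}"
      have far: "R \<le> dist p p'" if "p \<in> D" "p' \<in> D'" for p p'
        using that T(2) dist_triangle[of z p' p] by (simp add: D_def D'_def)
      have loc_b: "localized D'' (blocked I)" if "I \<in> \<I>" "closed D''" "D' \<subseteq> D''" for I D''
        unfolding blocked_def
      proof (intro localized_ball IY(2) that localized_not)
        fix p assume "p \<in> Y I"
        then have p: "real n + real T - 1 \<le> dist z (fst p)" "snd p \<in> N (fst p) k" by (auto simp: Y_def X_def)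
        have "cball (fst p) (real k + 1) \<subseteq> D'"
        proof
          fix x assume "x \<in> cball (fst p) (real k + 1)"
          then show "x \<in> D'" using p(1) dist_triangle[of z "fst p" x] by (simp add: D'_def dist_commute)
        qed
        then show "localized D'' (crossed (cball (fst p) \<rho>) (cball (snd p) \<rho>))"
          using that by (intro loc_link[OF N(3)[OF p(2)]]) auto
      qed
      have closedD': "closed D'" unfolding D'_def by (intro closed_Collect_le continuous_intros)
      have G: "G I \<in> events" if "I \<in> \<I>" for I
        unfolding G_def using that
        by (intro localized_UNIV_event localized_conj loc_H loc_b) (auto simp: \<I>_def)
      have PG: "\<delta> * prob {\<omega> \<in> space M. H n (Z \<omega>) = I} \<le> prob (G I)" if "I \<in> \<I>" for I
      proof -
        have "\<delta> \<le> (1 - 1/2) ^ card (Y I)"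
          unfolding \<delta>_def using IY(3)[OF that] by (simp add: power_decreasing)
        also have "\<dots> \<le> prob {\<omega> \<in> space M. \<forall>p\<in>Y I. \<not> crossed (cball (fst p) \<rho>) (cball (snd p) \<rho>) (Z \<omega>)}"
        proof (rule prob_no_cross_ge[OF IY(2)[OF that]])
          fix p assume "p \<in> Y I"
          then have "snd p \<in> N (fst p) k" by (auto simp: Y_def X_def)
          then have "prob (cross (cball (fst p) \<rho>) (cball (snd p) \<rho>)) = tube_prob \<rho> k" by (intro prob_link N(3))
          then show "prob (cross (cball (fst p) \<rho>) (cball (snd p) \<rho>)) \<le> 1/2" using q[of k] k(2) by simp
        qed (auto simp: compact_cball_hyperbolic)
        finally have "\<delta> \<le> prob {\<omega> \<in> space M. blocked I (Z \<omega>)}" by (simp add: blocked_def)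
        moreover have "prob (G I) = prob {\<omega> \<in> space M. H n (Z \<omega>) = I} * prob {\<omega> \<in> space M. blocked I (Z \<omega>)}"
          unfolding G_def using that
          by (intro R(2)[OF far loc_H[of D] loc_b[OF that closedD' order_refl]]) (auto simp: D_def \<I>_def)
        ultimately show ?thesis by (simp add: mult.commute mult_right_mono)
      qed
      have disjG: "disjoint_family_on G \<I>" unfolding disjoint_family_on_def G_def by auto
      define U where "U = (\<Union>I\<in>\<I>. G I)"
      have U: "U \<in> events" unfolding U_def using finI G by (intro sets.finite_UN)
      have "{\<omega> \<in> space M. H n (Z \<omega>) \<in> \<I>} = (\<Union>I\<in>\<I>. {\<omega> \<in> space M. H n (Z \<omega>) = I})" by auto
      then have "prob {\<omega> \<in> space M. H n (Z \<omega>) \<in> \<I>} = (\<Sum>I\<in>\<I>. prob {\<omega> \<in> space M. H n (Z \<omega>) = I})"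
        using ev_HP by (simp only:) (rule finite_measure_finite_Union[OF finI], auto simp: disjoint_family_on_def)
      then have "\<delta> * prob {\<omega> \<in> space M. H n (Z \<omega>) \<in> \<I>} = (\<Sum>I\<in>\<I>. \<delta> * prob {\<omega> \<in> space M. H n (Z \<omega>) = I})"
        by (simp add: sum_distrib_left)
      also have "\<dots> \<le> (\<Sum>I\<in>\<I>. prob (G I))" by (intro sum_mono PG)
      also have "\<dots> = prob U" unfolding U_def
        using G by (intro finite_measure_finite_Union[symmetric] finI disjG) auto
      finally have PU: "\<delta> * prob {\<omega> \<in> space M. H n (Z \<omega>) \<in> \<I>} \<le> prob U" .
      have "S n \<subseteq> {\<omega> \<in> space M. H n (Z \<omega>) \<in> \<I>} \<union> {\<omega> \<in> space M. m \<le> card (H n (Z \<omega>))}"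
        using HN by (auto simp: S_def \<I>_def)
      then have "prob (S n) \<le> prob ({\<omega> \<in> space M. H n (Z \<omega>) \<in> \<I>} \<union> {\<omega> \<in> space M. m \<le> card (H n (Z \<omega>))})"
        by (intro finite_measure_mono sets.Un ev_HP)
      also have "\<dots> \<le> prob {\<omega> \<in> space M. H n (Z \<omega>) \<in> \<I>} + prob {\<omega> \<in> space M. m \<le> card (H n (Z \<omega>))}"
        by (intro measure_Un_le ev_HP)
      also have "prob {\<omega> \<in> space M. m \<le> card (H n (Z \<omega>))} \<le> K0 * K1 / real m"
        using mean[of m n] m by (simp add: field_simps)
      finally have PS: "prob (S n) - K0 * K1 / real m \<le> prob {\<omega> \<in> space M. H n (Z \<omega>) \<in> \<I>}" by simp
      have "\<delta> \<ge> 0" by (simp add: \<delta>_def)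
      from mult_left_mono[OF PS this] PU have low: "\<delta> * (prob (S n) - K0 * K1 / real m) \<le> prob U" by linarith
      have "S (n + (T + k + 1)) \<inter> U = {}"
      proof (rule ccontr)
        assume "S (n + (T + k + 1)) \<inter> U \<noteq> {}"
        then obtain \<omega> I where w: "\<omega> \<in> S (n + (T + k + 1))" "I \<in> \<I>" "\<omega> \<in> G I" by (auto simp: U_def)
        then have "reached N \<rho> z (n + (T + k + 1)) (Z \<omega>) \<noteq> {}" by (simp add: S_def H_def)
        then obtain c c1 c2 where c: "c \<in> reached N \<rho> z n (Z \<omega>)" "c1 \<in> N c T" "real n + real T - 1 \<le> dist z c1"
          "c2 \<in> N c1 k" "crossed (cball c1 \<rho>) (cball c2 \<rho>) (Z \<omega>)"
          using reached_continues[where N = N, OF \<rho> N(3,4) _ n T(1) k(1)] by blast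
        have "c \<in> I" using c(1) w(3) by (simp add: G_def H_def)
        then have "(c1, c2) \<in> Y I" using c(2-4) by (auto simp: Y_def X_def)
        moreover have "blocked I (Z \<omega>)" using w(3) by (simp add: G_def)
        ultimately show False using c(5) by (force simp: blocked_def)
      qed
      then have "prob (S (n + (T + k + 1))) + prob U = prob (S (n + (T + k + 1)) \<union> U)"
        using S U by (simp add: finite_measure_Union)
      also have "\<dots> \<le> prob (S n)"
      proof (intro finite_measure_mono S)
        show "S (n + (T + k + 1)) \<union> U \<subseteq> S n"
          using Smono[OF n, of "T + k + 1"] by (auto simp: U_def G_def S_def \<I>_def)
      qed
      finally show ?thesis using low unfolding \<delta>_def by linarith
    qed
    define A where "A = (\<Inter>n\<in>{1..}. S n)"
    have A: "A \<in> events" unfolding A_def using S by (intro sets.countable_INT') auto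
    have "prob A = 0"
    proof (rule ccontr)
      define \<epsilon> where "\<epsilon> = prob A"
      assume "prob A \<noteq> 0"
      then have \<epsilon>: "\<epsilon> > 0" using measure_nonneg[of M A] unfolding \<epsilon>_def by linarith
      have low: "\<epsilon> \<le> prob (S n)" if "1 \<le> n" for n
        unfolding \<epsilon>_def using that S by (intro finite_measure_mono) (auto simp: A_def)
      \<comment> \<open>\<open>m\<close> so large that crowded spheres account for at most half of \<open>\<epsilon>\<close>\<close>
      obtain m :: nat where m: "2 * (K0 * K1) / \<epsilon> < real m" using reals_Archimedean2 by blast
      have KK: "0 < K0 * K1" using K0(1) K1 by simp
      then have "0 < real m" using m \<epsilon> by (smt (verit) divide_pos_pos)
      then have m0: "0 < m" by simp
      have mm: "K0 * K1 / real m \<le> \<epsilon> / 2" using m m0 \<epsilon> by (simp add: field_simps)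
      define \<delta> where "\<delta> = (1/2 :: real) ^ (m * J1 * J2)"
      have \<delta>: "\<delta> > 0" by (simp add: \<delta>_def)
      define t where "t = T + k + 1"
      have dec: "prob (S (n + t)) \<le> prob (S n) - \<delta> * (\<epsilon> / 2)" if "1 \<le> n" for n
      proof -
        have "\<delta> * (\<epsilon> / 2) \<le> \<delta> * (prob (S n) - K0 * K1 / real m)"
          using low[OF that] mm \<delta> by (intro mult_left_mono) auto
        then show ?thesis using drop[OF that m0] unfolding t_def \<delta>_def by linarith
      qed
      have "prob (S (1 + i * t)) \<le> 1 - real i * (\<delta> * (\<epsilon> / 2))" for i
      proof (induction i)
        case 0
        then show ?case by simp
      next
        case (Suc i)
        have "prob (S (1 + i * t + t)) \<le> prob (S (1 + i * t)) - \<delta> * (\<epsilon> / 2)" by (rule dec) simp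
        also have "\<dots> \<le> 1 - real i * (\<delta> * (\<epsilon> / 2)) - \<delta> * (\<epsilon> / 2)" using Suc by simp
        also have "\<dots> = 1 - real (Suc i) * (\<delta> * (\<epsilon> / 2))" by (simp add: algebra_simps add_divide_distrib)
        finally show ?case by (simp add: add.commute add.left_commute)
      qed
      moreover obtain i :: nat where "1 / (\<delta> * (\<epsilon> / 2)) < real i" using reals_Archimedean2 by blast
      then have "1 < real i * (\<delta> * (\<epsilon> / 2))" using \<delta> \<epsilon> by (simp add: field_simps)
      ultimately have "prob (S (1 + i * t)) < 0" by (smt (verit))
      then show False using measure_nonneg[of M "S (1 + i * t)"] by linarith
    qed
    then have "AE \<omega> in M. \<omega> \<notin> A"
      using A by (simp add: AE_iff_measurable[OF A] emeasure_eq_measure prob_eq_0)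
    then show "AE \<omega> in M. \<not> (\<forall>n\<ge>1. \<exists>x y. dist z x \<le> \<rho> \<and> real n \<le> dist z y \<and> seg x y \<subseteq> Z \<omega>)"
    proof (rule AE_mp, intro AE_I2 impI notI)
      fix \<omega> assume w: "\<omega> \<in> space M" "\<omega> \<notin> A"
        and far: "\<forall>n\<ge>1. \<exists>x y. dist z x \<le> \<rho> \<and> real n \<le> dist z y \<and> seg x y \<subseteq> Z \<omega>"
      have "\<omega> \<in> S n" if n: "1 \<le> n" for n
      proof -
        obtain x y where "dist z x \<le> \<rho>" "real n \<le> dist z y" "seg x y \<subseteq> Z \<omega>" using far n by blast
        then show ?thesis unfolding S_def H_def
          using reached_nonempty[where N = N, OF \<rho> N(3,4) _ n] w(1) by blast
      qed
      then show False using w(2) by (auto simp: A_def)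
    qed
  qed
qed

end

lemma countable_ball_cover:
  assumes "0 < (\<rho> :: real)"
  obtains F :: "nat \<Rightarrow> hyperbolic_plane set" where "\<And>n. finite (F n)" "\<And>x. \<exists>n. \<exists>z\<in>F n. dist z x \<le> \<rho>"
proof -
  have "\<forall>n. \<exists>F. finite F \<and> (\<forall>x\<in>cball (base_pt 0) (real n). \<exists>z\<in>F. dist z x < \<rho>)"
    using finite_net[OF compact_cball_hyperbolic assms] by metis
  then obtain F where F: "\<And>n. finite (F n)" "\<And>n x. x \<in> cball (base_pt 0) (real n) \<Longrightarrow> \<exists>z\<in>F n. dist z x < \<rho>"
    by metis
  have "\<exists>n. \<exists>z\<in>F n. dist z x \<le> \<rho>" for x
  proof -
    obtain n where "dist (base_pt 0) x \<le> real n" using real_arch_simple by blast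
    then show ?thesis using F(2)[of x n] by (auto intro: less_imp_le)
  qed
  then show thesis using that F(1) by blast
qed

theorem lemma3p4:
  fixes M :: "'w measure" and Z :: "'w \<Rightarrow> hyperbolic_plane set"
    and b :: hyperbolic_plane and \<alpha> :: real
  assumes "well_behaved_percolation M Z b"
    and "decay_exponent M Z \<alpha>"
    and "\<alpha> \<ge> 1"
  shows "AE \<omega> in M. \<not> (\<exists>L. half_line L \<and> L \<subseteq> Z \<omega>)"
proof -
  interpret well_behaved_percolation M Z b by (rule assms(1))
  obtain c where c: "c > 0" "\<And>r. r \<ge> 0 \<Longrightarrow> c * exp (- \<alpha> * r) \<le> segment_prob M Z r"
    "\<And>r. r \<ge> 0 \<Longrightarrow> segment_prob M Z r \<le> exp (- \<alpha> * r)"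
    using assms(2) unfolding decay_exponent_def by blast
  have seg_prob_pos: "seg_prob n > 0" for n
    using c(2)[of "real n"] c(1) by (simp add: seg_prob_eq_segment_prob) (smt (verit) exp_gt_zero mult_pos_pos)
  have seg_prob_le: "seg_prob n \<le> exp (- real n)" for n
  proof -
    have "real n \<le> \<alpha> * real n" using mult_right_mono[OF assms(3), of "real n"] by simp
    then have "exp (- \<alpha> * real n) \<le> exp (- real n)" by simp
    with c(3)[OF of_nat_0_le_iff, of n] show ?thesis unfolding seg_prob_eq_segment_prob by (rule order_trans)
  qed
  obtain \<rho> where \<rho>: "0 < \<rho>"
    "\<And>z. AE \<omega> in M. \<not> (\<forall>n\<ge>1. \<exists>x y. dist z x \<le> \<rho> \<and> real n \<le> dist z y \<and> seg x y \<subseteq> Z \<omega>)"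
    using extinction[OF seg_prob_pos seg_prob_le] by blast
  obtain F :: "nat \<Rightarrow> hyperbolic_plane set"
    where F: "\<And>n. finite (F n)" "\<And>x. \<exists>n. \<exists>z\<in>F n. dist z x \<le> \<rho>"
    using countable_ball_cover[OF \<rho>(1)] by blast
  have "AE \<omega> in M. \<forall>i. \<forall>z\<in>F i. \<not> (\<forall>n\<ge>1. \<exists>x y. dist z x \<le> \<rho> \<and> real n \<le> dist z y \<and> seg x y \<subseteq> Z \<omega>)"
    unfolding AE_all_countable using F(1) \<rho>(2) by (intro allI AE_finite_allI)
  then show ?thesis
  proof (rule AE_mp, intro AE_I2 impI notI)
    fix \<omega>
    assume none: "\<forall>i. \<forall>z\<in>F i. \<not> (\<forall>n\<ge>1. \<exists>x y. dist z x \<le> \<rho> \<and> real n \<le> dist z y \<and> seg x y \<subseteq> Z \<omega>)"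
      and "\<exists>L. half_line L \<and> L \<subseteq> Z \<omega>"
    then obtain L where L: "half_line L" "L \<subseteq> Z \<omega>" by blast
    then obtain \<gamma> where "\<forall>s\<in>{0..}. \<forall>t\<in>{0..}. dist (\<gamma> s) (\<gamma> t) = \<bar>s - t\<bar>" "L = \<gamma> ` {0..}"
      unfolding half_line_def by blast
    then have g: "\<And>s t. 0 \<le> s \<Longrightarrow> 0 \<le> t \<Longrightarrow> dist (\<gamma> s) (\<gamma> t) = \<bar>s - t\<bar>" "\<gamma> ` {0::real..} \<subseteq> Z \<omega>"
      using L(2) by auto
    obtain i z where z: "z \<in> F i" "dist z (\<gamma> 0) \<le> \<rho>" using F(2) by blast
    have "\<exists>x y. dist z x \<le> \<rho> \<and> real n \<le> dist z y \<and> seg x y \<subseteq> Z \<omega>" for n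
    proof -
      define r where "r = real n + \<rho>"
      have r: "0 \<le> r" using \<rho>(1) by (simp add: r_def)
      have "seg (\<gamma> 0) (\<gamma> r) = \<gamma> ` {0..r}" by (rule geodesic_contains_seg[OF g(1) r])
      then have "seg (\<gamma> 0) (\<gamma> r) \<subseteq> Z \<omega>" using g(2) by auto
      moreover have "real n \<le> dist z (\<gamma> r)"
        using g(1)[of 0 r] r z(2) dist_triangle[of "\<gamma> 0" "\<gamma> r" z] by (simp add: r_def dist_commute)
      ultimately show ?thesis using z(2) by blast
    qed
    then show False using none z(1) by blast
  qed
qed

end
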